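(* Let $K$ be an algebraically closed field of characteristic zero. Let $\underline{h}$ be a Gorenstein $h$-vector of Sperner number at most $6$. Then every artinian Gorenstein standard graded $K$-algebra with Hilbert function $\underline{h}$ has the weak Lefschetz property if and only if $\underline{h}$ is not one of the $h$-vectors $(1,5,5,1)$, $(1,6,6,1)$, $(1,6,6,6,1)$.
   Context: A standard graded artinian $K$-algebra is $A=R/I$ with $R=K[x_1,\dots,x_n]$ (standard grading, any $n$) and $I$ a homogeneous ideal such that $\dim_K A<\infty$. Its $h$-vector (Hilbert function) is $(h_0,\dots,h_d)$ with $h_i=\dim_K[A]_i>0$ for $0\le i\le d$, where $d$ is the largest degree in which $A$ is nonzero; $d$ is called the socle degree. $A$ is Gorenstein if its socle is one-dimensional, concentrated in degree $d$ (then its $h$-vector is symmetric). A Gorenstein $h$-vector is a vector that is the $h$-vector of some artinian Gorenstein standard graded $K$-algebra. The Sperner number is $\max_i h_i$. $A$ has the weak Lefschetz property (WLP) if there is a linear form $\ell\in[A]_1$ such that for every integer $i\ge 0$ the multiplication map $\times\ell\colon[A]_i\to[A]_{i+1}$ has maximal rank (i.e. is injective or surjective). *)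

theory Defs
  imports
    "HOL-Algebra.Algebra"
    "HOL-Library.Poly_Mapping"
    "HOL-Computational_Algebra.Polynomial"
begin

text \<open>
  A monomial is a finitely supported exponent function on the variable indices, and a polynomial is
  a finitely supported coefficient function on monomials; multiplication on this type is
  convolution. The ring in \<open>n\<close> variables consists of the polynomials involving only the variables
  with index below \<open>n\<close>.
\<close>

type_synonym 'k mpoly = "(nat \<Rightarrow>\<^sub>0 nat) \<Rightarrow>\<^sub>0 'k"

definition mon_degree :: "(nat \<Rightarrow>\<^sub>0 nat) \<Rightarrow> nat" where
  "mon_degree m = (\<Sum>j\<in>Poly_Mapping.keys m. Poly_Mapping.lookup m j)"

definition mpoly_ring :: "nat \<Rightarrow> ('k::comm_ring_1 mpoly) ring" where
  "mpoly_ring n =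
    \<lparr>carrier = {p. \<forall>m\<in>Poly_Mapping.keys p. Poly_Mapping.keys m \<subseteq> {..<n}},
     monoid.mult = (*), one = 1, ring.zero = 0, ring.add = (+)\<rparr>"

text \<open>The homogeneous part of degree \<open>i\<close>, including the zero polynomial.\<close>

definition forms :: "nat \<Rightarrow> nat \<Rightarrow> ('k::comm_ring_1 mpoly) set" where
  "forms n i = {p \<in> carrier (mpoly_ring n). \<forall>m\<in>Poly_Mapping.keys p. mon_degree m = i}"

definition homogeneous_ideal :: "nat \<Rightarrow> ('k::comm_ring_1 mpoly) set \<Rightarrow> bool" where
  "homogeneous_ideal n I \<longleftrightarrow>
    ideal I (mpoly_ring n) \<and> (\<exists>S. S \<subseteq> (\<Union>i. forms n i) \<and> I = Idl\<^bsub>mpoly_ring n\<^esub> S)"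

text \<open>
  Throughout, the pair \<open>n\<close>, \<open>I\<close> stands for the algebra \<open>A = K[x\<^sub>1,\<dots>,x\<^sub>n]/I\<close>, whose elements are the
  cosets of \<open>I\<close>. The coefficient field acts through its image \<open>scalars n I\<close> in \<open>A\<close>, a subfield as
  soon as \<open>I\<close> is a proper ideal; dimensions are taken over it.
\<close>

abbreviation quot_alg :: "nat \<Rightarrow> ('k::comm_ring_1 mpoly) set \<Rightarrow> ('k mpoly set) ring" where
  "quot_alg n I \<equiv> mpoly_ring n Quot I"

definition scalars :: "nat \<Rightarrow> ('k::comm_ring_1 mpoly) set \<Rightarrow> ('k mpoly set) set" where
  "scalars n I = range (\<lambda>c. I +>\<^bsub>mpoly_ring n\<^esub> Poly_Mapping.single 0 c)"

definition graded_part :: "nat \<Rightarrow> ('k::comm_ring_1 mpoly) set \<Rightarrow> nat \<Rightarrow> ('k mpoly set) set" where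
  "graded_part n I i = (\<lambda>p. I +>\<^bsub>mpoly_ring n\<^esub> p) ` forms n i"

text \<open>The zero algebra is excluded, since it has no socle degree.\<close>

definition artinian_graded :: "nat \<Rightarrow> ('k::field mpoly) set \<Rightarrow> bool" where
  "artinian_graded n I \<longleftrightarrow>
    homogeneous_ideal n I \<and> I \<noteq> carrier (mpoly_ring n) \<and>
    ring.finite_dimension (quot_alg n I) (scalars n I) (carrier (quot_alg n I))"

definition hilbert_function :: "nat \<Rightarrow> ('k::field mpoly) set \<Rightarrow> nat \<Rightarrow> nat" where
  "hilbert_function n I i = ring.dim (quot_alg n I) (scalars n I) (graded_part n I i)"

definition socle_degree :: "nat \<Rightarrow> ('k::field mpoly) set \<Rightarrow> nat" where
  "socle_degree n I = Max {i. graded_part n I i \<noteq> {\<zero>\<^bsub>quot_alg n I\<^esub>}}"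

definition h_vector :: "nat \<Rightarrow> ('k::field mpoly) set \<Rightarrow> nat list" where
  "h_vector n I = map (hilbert_function n I) [0..<Suc (socle_degree n I)]"

text \<open>The socle is the annihilator of the homogeneous maximal ideal.\<close>

definition socle :: "nat \<Rightarrow> ('k::field mpoly) set \<Rightarrow> ('k mpoly set) set" where
  "socle n I = {a \<in> carrier (quot_alg n I).
    \<forall>i\<ge>1. \<forall>b\<in>graded_part n I i. b \<otimes>\<^bsub>quot_alg n I\<^esub> a = \<zero>\<^bsub>quot_alg n I\<^esub>}"

definition artinian_gorenstein :: "nat \<Rightarrow> ('k::field mpoly) set \<Rightarrow> bool" where
  "artinian_gorenstein n I \<longleftrightarrow>
    artinian_graded n I \<and>
    ring.dimension (quot_alg n I) 1 (scalars n I) (socle n I) \<and>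
    socle n I \<subseteq> graded_part n I (socle_degree n I)"

definition weak_lefschetz :: "nat \<Rightarrow> ('k::field mpoly) set \<Rightarrow> bool" where
  "weak_lefschetz n I \<longleftrightarrow>
    (\<exists>l\<in>graded_part n I 1. \<forall>i.
      inj_on (\<lambda>a. l \<otimes>\<^bsub>quot_alg n I\<^esub> a) (graded_part n I i) \<or>
      (\<lambda>a. l \<otimes>\<^bsub>quot_alg n I\<^esub> a) ` graded_part n I i = graded_part n I (Suc i))"

text \<open>The type argument fixes the coefficient field, which the vector itself does not mention.\<close>

definition gorenstein_h_vector :: "'k::field itself \<Rightarrow> nat list \<Rightarrow> bool" where
  "gorenstein_h_vector _ h \<longleftrightarrow>
    (\<exists>n (I :: 'k mpoly set). artinian_gorenstein n I \<and> h_vector n I = h)"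

definition sperner_number :: "nat list \<Rightarrow> nat" where
  "sperner_number h = Max (set h)"

end

theory Submission
  imports Defs
begin

text \<open>
  Let \<open>A = K[x\<^sub>1,\<dots>,x\<^sub>n]/I\<close> be Gorenstein of socle degree \<open>d \<ge> 1\<close>, so that the products
  \<open>A\<^sub>i \<times> A\<^sub>d\<^sub>-\<^sub>i \<rightarrow> A\<^sub>d \<cong> K\<close> are perfect pairings. Write \<open>d = e + m\<close> with \<open>e = (d - 1) div 2 < m\<close>. If some
  linear form is injective on \<open>A\<^sub>e\<close>, then it is injective in all lower degrees, because a nonzero
  element of degree below \<open>d\<close> has a nonzero multiple one degree higher, and by duality it is
  surjective in all remaining degrees (\<open>weak_lefschetzI\<close>). So only the degree \<open>e\<close> matters.

  Suppose that no linear form is injective on \<open>A\<^sub>e\<close>, and choose for every linear form a nonzero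
  element of \<open>A\<^sub>e\<close> that it kills. The central step is that the Hilbert function is then at least
  \<open>d + 2\<close> in the degrees \<open>e,\<dots>,m\<close>. Assume that \<open>d + 2\<close> linear forms \<open>l + t\<^sub>k x\<close> on one line kill
  elements \<open>a\<^sub>k\<close> with \<open>x\<^sup>m a\<^sub>k \<noteq> 0\<close> in \<open>A\<^sub>d\<close>. A binary form \<open>q\<close> then acts on \<open>a\<^sub>k\<close> by
  \<open>q(l, x) a\<^sub>k = q(- t\<^sub>k, 1) x\<^sup>r a\<^sub>k\<close> with \<open>r = deg q\<close>, whereas \<open>x a\<^sub>j a\<^sub>k = 0\<close> for \<open>j \<noteq> k\<close>, since
  \<open>a\<^sub>j a\<^sub>k\<close> is killed by \<open>l + t\<^sub>j x\<close> and \<open>l + t\<^sub>k x\<close>. A linear relation in degree \<open>e + u\<close>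
  among \<open>x\<^sup>u a\<^sub>0,\<dots>,x\<^sup>u a\<^sub>m\<^sub>-\<^sub>u\<close> and the \<open>e + u + 1\<close> monomials in \<open>l\<close> and \<open>x\<close> can therefore be tested
  against the remaining \<open>a\<^sub>k\<close>, and interpolation shows that all its coefficients vanish
  (\<open>pencil_independent\<close>). This gives \<open>d + 2\<close> independent elements.

  It remains to find the line: the direction \<open>x\<close> has to be a good test form for elements that are
  only chosen together with the points of the line. In characteristic zero the \<open>m\<close>-th powers of
  finitely many linear forms span all forms of degree \<open>m\<close>, so finitely many directions detect every
  nonzero element of \<open>A\<^sub>e\<close> (\<open>linear_forms_detecting\<close>). Colour each point of the grid spanned by these
  directions with a direction that detects the element chosen for it. By the pigeonhole principle a
  large grid contains an axis-parallel line with \<open>d + 2\<close> points of its own colour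
  (\<open>monochromatic_axis_line\<close>).

  If the Sperner number is at most six and the weak Lefschetz property fails, then \<open>d \<le> 4\<close>. For
  \<open>d \<le> 2\<close> the degree \<open>e\<close> is zero and \<open>h\<^sub>0 = 1\<close> is too small. For \<open>d = 3\<close> and \<open>d = 4\<close> the symmetry of the
  Hilbert function and the bounds \<open>d + 2 \<le> h\<^sub>j \<le> 6\<close> leave the three exceptional vectors.

  Conversely, the form \<open>\<Sum>i\<le>k. x\<^sub>i u\<^sup>k\<^sup>-\<^sup>i v\<^sup>i\<close> is the Macaulay dual generator, for the contraction
  action, of a Gorenstein algebra with \<open>h\<close>-vector \<open>(1,5,5,1)\<close> for \<open>k = 2\<close> and \<open>(1,6,6,6,1)\<close> for
  \<open>k = 3\<close>, and adding \<open>z\<^sup>3\<close> in the case \<open>k = 2\<close> gives \<open>(1,6,6,1)\<close>. In these algebras a linear form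
  with coefficients \<open>\<alpha>\<close> at \<open>u\<close> and \<open>\<beta>\<close> at \<open>v\<close> kills every \<open>\<Sum>i\<le>k. a\<^sub>i x\<^sub>i\<close> with
  \<open>\<alpha> a\<^sub>i + \<beta> a\<^sub>i\<^sub>+\<^sub>1 = 0\<close> for all \<open>i < k\<close>, and such a nonzero element always exists.
\<close>

section \<open>Linear systems over a field\<close>

text \<open>
  Induction on the equations: one unknown that occurs in the equation \<open>e\<close> is eliminated from all
  others.
\<close>

lemma underdetermined_system:
  fixes f :: "'j \<Rightarrow> 'i \<Rightarrow> 'k::field"
  assumes "finite E" "finite J" "card E < card J"
  shows "\<exists>c. (\<exists>j\<in>J. c j \<noteq> 0) \<and> (\<forall>i\<in>E. (\<Sum>j\<in>J. c j * f j i) = 0)"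
  using assms
proof (induction E arbitrary: J f rule: finite_induct)
  case empty
  then have "J \<noteq> {}" by auto
  then show ?case by (intro exI[of _ "\<lambda>_. 1"]) auto
next
  case (insert e E)
  show ?case
  proof (cases "\<forall>j\<in>J. f j e = 0")
    case True
    from insert have "card E < card J" by simp
    from insert.IH[OF insert.prems(1) this, of f] True show ?thesis
      by auto
  next
    case False
    then obtain p where p: "p \<in> J" "f p e \<noteq> 0" by blast
    define J' where "J' = J - {p}"
    have J': "finite J'" "card E < card J'" "J = insert p J'" "p \<notin> J'"
      using insert p by (auto simp: J'_def)
    define g where "g = (\<lambda>j i. f j i - f j e / f p e * f p i)"
    from insert.IH[OF J'(1,2), of g] obtain c where
      c: "\<exists>j\<in>J'. c j \<noteq> 0" "\<And>i. i \<in> E \<Longrightarrow> (\<Sum>j\<in>J'. c j * g j i) = 0" by blast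
    define cp where "cp = - (\<Sum>j\<in>J'. c j * (f j e / f p e))"
    define c' where "c' = c(p := cp)"
    have sum': "(\<Sum>j\<in>J. c' j * f j i) = (\<Sum>j\<in>J'. c j * g j i)" for i
    proof -
      have "(\<Sum>j\<in>J. c' j * f j i) = cp * f p i + (\<Sum>j\<in>J'. c j * f j i)"
        unfolding J'(3) using J' by (simp add: c'_def) (rule sum.cong, auto)
      also have "\<dots> = (\<Sum>j\<in>J'. c j * g j i)"
        by (simp add: cp_def g_def sum_distrib_left sum_distrib_right algebra_simps sum_subtractf)
      finally show ?thesis .
    qed
    have "g j e = 0" for j using p by (simp add: g_def)
    then have "(\<Sum>j\<in>J. c' j * f j i) = 0" if "i \<in> insert e E" for i
      using that c(2) unfolding sum' by auto
    moreover have "\<exists>j\<in>J. c' j \<noteq> 0" using c(1) J'(3,4) by (auto simp: c'_def)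
    ultimately show ?thesis by blast
  qed
qed

text \<open>
  Induction on the generators \<open>f j\<close> of the row space. If \<open>v\<close> is not in the span of the old rows, a
  functional \<open>c\<close> witnesses this. Unless \<open>c\<close> also kills the new row \<open>f p\<close>, subtracting from \<open>v\<close> the
  multiple \<open>\<alpha>\<close> of \<open>f p\<close> that makes the value of \<open>c\<close> zero reduces the question to the old rows.
\<close>

lemma fredholm_alternative:
  fixes f :: "'j \<Rightarrow> 'i \<Rightarrow> 'k::field"
  assumes "finite J" "finite E"
  shows "(\<exists>a. \<forall>i\<in>E. (\<Sum>j\<in>J. a j * f j i) = v i) \<or>
    (\<exists>c. (\<forall>j\<in>J. (\<Sum>i\<in>E. f j i * c i) = 0) \<and> (\<Sum>i\<in>E. v i * c i) \<noteq> 0)"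
  using assms(1)
proof (induction J arbitrary: v rule: finite_induct)
  case empty
  show ?case
  proof (cases "\<forall>i\<in>E. v i = 0")
    case False
    then obtain i where i: "i \<in> E" "v i \<noteq> 0" by blast
    have "(\<Sum>i'\<in>E. v i' * (if i' = i then 1 else 0)) = v i"
      using assms(2) i by (simp add: if_distrib cong: if_cong)
    then show ?thesis using i by (intro disjI2 exI[of _ "\<lambda>i'. if i' = i then 1 else 0"]) simp
  qed auto
next
  case (insert p J)
  have extend: ?case if "\<forall>i\<in>E. (\<Sum>j\<in>J. a j * f j i) = v i - \<alpha> * f p i" for a \<alpha>
  proof -
    have "(\<Sum>j\<in>insert p J. (a(p := \<alpha>)) j * f j i) = v i" if "i \<in> E" for i
    proof -
      have "(\<Sum>j\<in>J. (a(p := \<alpha>)) j * f j i) = (\<Sum>j\<in>J. a j * f j i)"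
        using insert(2) by (intro sum.cong) auto
      then show ?thesis using insert(1,2) that \<open>\<forall>i\<in>E. _\<close> by simp
    qed
    then show ?thesis by blast
  qed
  consider (sol) a where "\<forall>i\<in>E. (\<Sum>j\<in>J. a j * f j i) = v i"
    | (obs) c where "\<forall>j\<in>J. (\<Sum>i\<in>E. f j i * c i) = 0" "(\<Sum>i\<in>E. v i * c i) \<noteq> 0"
    using insert.IH[of v] by blast
  then show ?case
  proof cases
    case sol
    then show ?thesis using extend[of a 0] by simp
  next
    case obs
    define s where "s = (\<Sum>i\<in>E. f p i * c i)"
    show ?thesis
    proof (cases "s = 0")
      case True
      then show ?thesis using obs by (intro disjI2 exI[of _ c]) (auto simp: s_def)
    next
      case False
      define \<alpha> where "\<alpha> = (\<Sum>i\<in>E. v i * c i) / s"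
      consider (sol) a where "\<forall>i\<in>E. (\<Sum>j\<in>J. a j * f j i) = v i - \<alpha> * f p i"
        | (obs') c' where "\<forall>j\<in>J. (\<Sum>i\<in>E. f j i * c' i) = 0"
            "(\<Sum>i\<in>E. (v i - \<alpha> * f p i) * c' i) \<noteq> 0"
        using insert.IH[of "\<lambda>i. v i - \<alpha> * f p i"] by blast
      then show ?thesis
      proof cases
        case sol
        then show ?thesis by (rule extend)
      next
        case obs'
        define \<beta> where "\<beta> = (\<Sum>i\<in>E. f p i * c' i) / s"
        define d where "d = (\<lambda>i. c' i - \<beta> * c i)"
        have split: "(\<Sum>i\<in>E. w i * d i) = (\<Sum>i\<in>E. w i * c' i) - \<beta> * (\<Sum>i\<in>E. w i * c i)" for w
          by (simp add: d_def algebra_simps sum_subtractf sum_distrib_left)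
        have "(\<Sum>i\<in>E. f p i * d i) = 0"
          using False unfolding split by (simp add: \<beta>_def s_def)
        moreover have "\<forall>j\<in>J. (\<Sum>i\<in>E. f j i * d i) = 0"
          using obs obs' unfolding split by simp
        moreover have "(\<Sum>i\<in>E. v i * d i) = (\<Sum>i\<in>E. (v i - \<alpha> * f p i) * c' i)"
          unfolding split using False
          by (simp add: \<beta>_def \<alpha>_def algebra_simps sum_subtractf sum_distrib_left sum_divide_distrib)
        ultimately show ?thesis using obs' by (intro disjI2 exI[of _ d]) auto
      qed
    qed
  qed
qed

lemma polynomial_zeros_imp_zero:
  fixes c :: "nat \<Rightarrow> 'k::field"
  assumes "finite T" "j < card T" "\<And>t. t \<in> T \<Longrightarrow> (\<Sum>i\<le>j. c i * t ^ i) = 0" "i \<le> j"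
  shows "c i = 0"
proof -
  define P where "P = (\<Sum>i\<le>j. Polynomial.monom (c i) i)"
  have poly: "poly P t = (\<Sum>i\<le>j. c i * t ^ i)" for t
    by (simp add: P_def poly_sum poly_monom)
  have coeff: "Polynomial.coeff P i = c i" using assms(4) by (simp add: P_def coeff_sum)
  have deg: "Polynomial.degree P \<le> j"
    unfolding P_def by (intro Polynomial.degree_sum_le) (auto intro: order_trans[OF Polynomial.degree_monom_le])
  have "P = 0"
  proof (rule ccontr)
    assume P: "P \<noteq> 0"
    have "card T \<le> card {t. poly P t = 0}"
      using assms(3) poly_roots_finite[OF P] by (intro card_mono) (auto simp: poly)
    also have "\<dots> \<le> Polynomial.degree P" by (rule card_poly_roots_bound[OF P])
    finally show False using deg assms(2) by simp
  qed
  then show ?thesis using coeff by simp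
qed

text \<open>
  Coefficients of a polynomial of degree at most \<open>s\<close> are linear combinations of its values at more
  than \<open>s\<close> points: an obstruction would be a nonzero polynomial with too many roots.
\<close>

lemma vandermonde_dual:
  fixes T :: "'k::field set"
  assumes "finite T" "s < card T" "i \<le> s"
  obtains w where "\<And>i'. i' \<le> s \<Longrightarrow> (\<Sum>t\<in>T. w t * t ^ i') = (if i' = i then 1 else 0)"
proof -
  have "\<not> (\<exists>c. (\<forall>t\<in>T. (\<Sum>i'\<le>s. t ^ i' * c i') = 0) \<and> (\<Sum>i'\<le>s. (if i' = i then 1 else 0) * c i') \<noteq> 0)"
  proof
    assume "\<exists>c. (\<forall>t\<in>T. (\<Sum>i'\<le>s. t ^ i' * c i') = 0) \<and> (\<Sum>i'\<le>s. (if i' = i then 1 else 0) * c i') \<noteq> 0"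
    then obtain c where c: "\<forall>t\<in>T. (\<Sum>i'\<le>s. t ^ i' * c i') = 0"
      "(\<Sum>i'\<le>s. (if i' = i then 1 else 0) * c i') \<noteq> 0" by blast
    have "c i' = 0" if "i' \<le> s" for i'
      using polynomial_zeros_imp_zero[OF assms(1,2), of c] c(1) that by (simp add: mult.commute)
    then show False using c(2) by simp
  qed
  then obtain w where "\<forall>i'\<in>{..s}. (\<Sum>t\<in>T. w t * t ^ i') = (if i' = i then 1 else 0)"
    using fredholm_alternative[OF assms(1), of "{..s}" "\<lambda>t i'. t ^ i'" "\<lambda>i'. if i' = i then 1 else 0"]
    by auto
  then show ?thesis using that[of w] by simp
qed

section \<open>A pigeonhole principle for grids\<close>

text \<open>
  In the grid with side length \<open>card D * N\<close>, a point is recorded by its projection along its own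
  colour and its position on that fibre. If no axis-parallel line had \<open>N\<close> points of its own colour, a
  direction could colour at most \<open>N - 1\<close> points on each of its lines, which is less than its share of
  the grid.
\<close>

lemma monochromatic_axis_line:
  fixes colour :: "('x \<Rightarrow> nat) \<Rightarrow> 'x"
  assumes "finite D" "\<And>g. colour g \<in> D"
  shows "\<exists>g x T. x \<in> D \<and> finite T \<and> card T = N \<and> (\<forall>t\<in>T. colour (g(x := t)) = x)"
proof (rule ccontr)
  assume no_line: "\<not> ?thesis"
  have "D \<noteq> {}" using assms(2) by blast
  then have D: "0 < card D" using assms(1) by (simp add: card_gt_0_iff)
  have N: "0 < N"
  proof (rule ccontr)
    assume "\<not> 0 < N"
    then show False using no_line assms(2)[of undefined]
      by (metis card.empty empty_iff finite.emptyI not_gr_zero)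
  qed
  define L where "L = card D * N"
  define G where "G = (D \<rightarrow>\<^sub>E {..<L})"
  have finG: "finite G" using assms(1) by (simp add: G_def finite_PiE)
  have cardG: "card G = L ^ card D" using assms(1) by (simp add: G_def card_PiE)
  \<comment> \<open>Each fibre over \<open>B\<close> is an axis-parallel line in direction \<open>x\<close>.\<close>
  have few: "card {g\<in>G. colour g = x} \<le> L ^ (card D - 1) * (N - 1)" if x: "x \<in> D" for x
  proof -
    define B where "B = (D - {x} \<rightarrow>\<^sub>E {..<L})"
    have finB: "finite B" using assms(1) by (simp add: B_def finite_PiE)
    have cardB: "card B = L ^ (card D - 1)" using assms(1) x by (simp add: B_def card_PiE)
    define F where "F = (\<lambda>b. {t. t < L \<and> colour (b(x := t)) = x})"
    have F: "finite (F b)" "card (F b) \<le> N - 1" for b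
    proof -
      show fin: "finite (F b)" by (simp add: F_def)
      show "card (F b) \<le> N - 1"
      proof (rule ccontr)
        assume "\<not> ?thesis"
        then have "N \<le> card (F b)" by simp
        then obtain T where "T \<subseteq> F b" "card T = N" "finite T"
          by (meson obtain_subset_with_card_n)
        moreover from this have "\<forall>t\<in>T. colour (b(x := t)) = x" by (auto simp: F_def)
        ultimately show False using no_line x by blast
      qed
    qed
    have "{g\<in>G. colour g = x} \<subseteq> (\<lambda>(b, t). b(x := t)) ` (SIGMA b:B. F b)"
    proof
      fix g assume g: "g \<in> {g\<in>G. colour g = x}"
      define b where "b = g(x := undefined)"
      have "b \<in> B" using g by (auto simp: b_def B_def G_def PiE_def extensional_def)
      moreover have "b(x := g x) = g" by (simp add: b_def)
      moreover have "g x \<in> F b" using g x \<open>b(x := g x) = g\<close> by (auto simp: F_def G_def)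
      ultimately show "g \<in> (\<lambda>(b, t). b(x := t)) ` (SIGMA b:B. F b)"
        by (intro image_eqI[of _ _ "(b, g x)"]) auto
    qed
    then have "card {g\<in>G. colour g = x} \<le> card (SIGMA b:B. F b)"
      by (rule surj_card_le[rotated]) (use finB F in auto)
    also have "\<dots> = (\<Sum>b\<in>B. card (F b))" using finB F by (simp add: card_SigmaI)
    also have "\<dots> \<le> card B * (N - 1)" using sum_bounded_above[of B "\<lambda>b. card (F b)" "N - 1"] F by simp
    finally show ?thesis by (simp add: cardB)
  qed
  have "G = (\<Union>x\<in>D. {g\<in>G. colour g = x})" using assms(2) by blast
  then have "L ^ card D \<le> (\<Sum>x\<in>D. card {g\<in>G. colour g = x})"
    using card_UN_le[OF assms(1), of "\<lambda>x. {g\<in>G. colour g = x}"] cardG by simp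
  also have "\<dots> \<le> card D * (L ^ (card D - 1) * (N - 1))"
    using sum_bounded_above[of D "\<lambda>x. card {g\<in>G. colour g = x}" "L ^ (card D - 1) * (N - 1)"] few by simp
  also have "\<dots> = L ^ (card D - 1) * (card D * (N - 1))" by simp
  also have "\<dots> < L ^ (card D - 1) * L"
    using D N by (intro mult_strict_left_mono) (auto simp: L_def)
  also have "\<dots> = L ^ card D" using D by (metis Suc_diff_1 mult.commute power_Suc)
  finally show False by simp
qed

section \<open>Polynomials and their homogeneous components\<close>

abbreviation cst :: "'k::zero \<Rightarrow> 'k mpoly" where
  "cst c \<equiv> Poly_Mapping.single 0 c"

abbreviation indet :: "nat \<Rightarrow> 'k::zero_neq_one mpoly" where
  "indet j \<equiv> Poly_Mapping.single (Poly_Mapping.single j 1) 1"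

lemma cst_mult: "cst (a * b) = cst a * cst (b :: 'k::comm_ring_1)"
  by (simp add: mult_single)

lemma cst_power: "cst (a ^ i) = cst (a :: 'k::comm_ring_1) ^ i"
  by (induction i) (simp_all add: cst_mult)

lemma cst_sum: "cst (\<Sum>j\<in>J. f j) = (\<Sum>j\<in>J. cst (f j :: 'k::comm_ring_1))"
  by (induction J rule: infinite_finite_induct) (simp_all add: single_add)

lemma poly_mapping_sum_monomials:
  "p = (\<Sum>m\<in>Poly_Mapping.keys p. Poly_Mapping.single m (Poly_Mapping.lookup p m))"
  by (rule poly_mapping_eqI) (auto simp: lookup_sum lookup_single when_def in_keys_iff)

lemma lookup_single_mult:
  fixes p :: "'k::comm_ring_1 mpoly"
  shows "Poly_Mapping.lookup (Poly_Mapping.single m c * p) (m + k) = c * Poly_Mapping.lookup p k"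
  by (simp add: lookup_mult lookup_single when_mult)

lemma lookup_cst_mult [simp]:
  fixes p :: "'k::comm_ring_1 mpoly"
  shows "Poly_Mapping.lookup (cst c * p) k = c * Poly_Mapping.lookup p k"
  using lookup_single_mult[of 0 c p k] by simp

text \<open>
  The degree of a monomial in the grading that gives the variable \<open>j\<close> degree \<open>w j\<close>. Weights are
  integers so that one variable can compensate another.
\<close>

definition weight :: "(nat \<Rightarrow> int) \<Rightarrow> (nat \<Rightarrow>\<^sub>0 nat) \<Rightarrow> int" where
  "weight w m = (\<Sum>j\<in>Poly_Mapping.keys m. int (Poly_Mapping.lookup m j) * w j)"

lemma weight_superset:
  assumes "finite S" "Poly_Mapping.keys m \<subseteq> S"
  shows "weight w m = (\<Sum>j\<in>S. int (Poly_Mapping.lookup m j) * w j)"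
  unfolding weight_def using assms by (intro sum.mono_neutral_left) (auto simp: in_keys_iff)

lemma weight_single [simp]: "weight w (Poly_Mapping.single j a) = int a * w j"
  by (simp add: weight_def)

lemma weight_add [simp]: "weight w (m + m') = weight w m + weight w m'"
proof -
  let ?S = "Poly_Mapping.keys m \<union> Poly_Mapping.keys m'"
  have "weight w (m + m') = (\<Sum>j\<in>?S. int (Poly_Mapping.lookup (m + m') j) * w j)"
    using keys_add[of m m'] by (intro weight_superset) auto
  also have "\<dots> = (\<Sum>j\<in>?S. int (Poly_Mapping.lookup m j) * w j) + (\<Sum>j\<in>?S. int (Poly_Mapping.lookup m' j) * w j)"
    by (simp add: lookup_add algebra_simps sum.distrib)
  also have "\<dots> = weight w m + weight w m'"
    by (simp add: weight_superset[of ?S])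
  finally show ?thesis .
qed

lemma int_mon_degree: "int (mon_degree m) = weight (\<lambda>_. 1) m"
  by (simp add: mon_degree_def weight_def)

lemma mon_degree_add [simp]: "mon_degree (m + m') = mon_degree m + mon_degree m'"
proof -
  have "int (mon_degree (m + m')) = int (mon_degree m + mon_degree m')"
    by (simp only: int_mon_degree weight_add of_nat_add)
  then show ?thesis by (simp only: of_nat_eq_iff)
qed

lemma mon_degree_zero [simp]: "mon_degree 0 = 0"
  and mon_degree_single [simp]: "mon_degree (Poly_Mapping.single j a) = a"
  by (simp_all add: mon_degree_def)

lemma mon_degree_eq_0_iff: "mon_degree m = 0 \<longleftrightarrow> m = 0"
proof
  assume "mon_degree m = 0"
  then have "Poly_Mapping.lookup m j = 0" for j by (auto simp: mon_degree_def in_keys_iff)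
  then show "m = 0" by (intro poly_mapping_eqI) simp
qed simp

lemma mon_degree_Suc_split:
  assumes "mon_degree m = Suc i"
  shows "\<exists>j m'. j \<in> Poly_Mapping.keys m \<and> m = Poly_Mapping.single j 1 + m' \<and> mon_degree m' = i \<and>
    Poly_Mapping.keys m' \<subseteq> Poly_Mapping.keys m"
proof -
  have "m \<noteq> 0" using assms by auto
  then obtain j where j: "j \<in> Poly_Mapping.keys m"
    using keys_eq_empty by blast
  define m' where "m' = m - Poly_Mapping.single j 1"
  have eq: "m = Poly_Mapping.single j 1 + m'"
    using j by (intro poly_mapping_eqI) (auto simp: m'_def lookup_add lookup_minus lookup_single when_def in_keys_iff)
  have "Suc i = 1 + mon_degree m'" using assms by (subst (asm) eq) simp
  moreover have "Poly_Mapping.keys m' \<subseteq> Poly_Mapping.keys m"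
    by (auto simp: m'_def in_keys_iff lookup_minus)
  ultimately show ?thesis using j eq by auto
qed

lemma finite_monomials_bounded:
  "finite {m. Poly_Mapping.keys m \<subseteq> {..<n} \<and> mon_degree m \<le> d}"
proof -
  let ?M = "{m. Poly_Mapping.keys m \<subseteq> {..<n} \<and> mon_degree m \<le> d}"
  have "(\<lambda>m. restrict (Poly_Mapping.lookup m) {..<n}) ` ?M \<subseteq> ({..<n} \<rightarrow>\<^sub>E {..d})"
  proof (rule image_subsetI)
    fix m assume m: "m \<in> ?M"
    have "Poly_Mapping.lookup m j \<le> d" for j
    proof (cases "j \<in> Poly_Mapping.keys m")
      case True
      then have "Poly_Mapping.lookup m j \<le> mon_degree m"
        unfolding mon_degree_def by (intro member_le_sum) auto
      then show ?thesis using m by simp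
    qed (simp add: in_keys_iff)
    then show "restrict (Poly_Mapping.lookup m) {..<n} \<in> {..<n} \<rightarrow>\<^sub>E {..d}"
      by simp
  qed
  moreover have "inj_on (\<lambda>m. restrict (Poly_Mapping.lookup m) {..<n}) ?M"
  proof (rule inj_onI)
    fix m m' assume a: "m \<in> ?M" "m' \<in> ?M"
      "restrict (Poly_Mapping.lookup m) {..<n} = restrict (Poly_Mapping.lookup m') {..<n}"
    show "m = m'"
    proof (rule poly_mapping_eqI)
      fix j
      show "Poly_Mapping.lookup m j = Poly_Mapping.lookup m' j"
      proof (cases "j < n")
        case True
        then show ?thesis using fun_cong[OF a(3), of j] by simp
      next
        case False
        then have "j \<notin> Poly_Mapping.keys m" "j \<notin> Poly_Mapping.keys m'" using a(1,2) by auto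
        then show ?thesis by (simp add: in_keys_iff)
      qed
    qed
  qed
  ultimately show ?thesis
    by (meson finite_PiE finite_atMost finite_imageD finite_lessThan finite_subset)
qed

lemma mpoly_ring_simps [simp]:
  "x \<otimes>\<^bsub>mpoly_ring n\<^esub> y = x * y" "x \<oplus>\<^bsub>mpoly_ring n\<^esub> y = x + y"
  "\<one>\<^bsub>mpoly_ring n\<^esub> = 1" "\<zero>\<^bsub>mpoly_ring n\<^esub> = 0"
  by (simp_all add: mpoly_ring_def)

lemma mem_carrier_iff:
  "p \<in> carrier (mpoly_ring n) \<longleftrightarrow> (\<forall>m\<in>Poly_Mapping.keys p. Poly_Mapping.keys m \<subseteq> {..<n})"
  by (simp add: mpoly_ring_def)

lemma carrier_add [intro]: "p \<in> carrier (mpoly_ring n) \<Longrightarrow> q \<in> carrier (mpoly_ring n) \<Longrightarrow> p + q \<in> carrier (mpoly_ring n)"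
  using keys_add[of p q] unfolding mem_carrier_iff by blast

lemma carrier_uminus [intro]: "p \<in> carrier (mpoly_ring n) \<Longrightarrow> - p \<in> carrier (mpoly_ring n)"
  unfolding mem_carrier_iff by (simp add: in_keys_iff)

lemma carrier_diff [intro]: "p \<in> carrier (mpoly_ring n) \<Longrightarrow> q \<in> carrier (mpoly_ring n) \<Longrightarrow> p - q \<in> carrier (mpoly_ring n)"
  using carrier_add[of p n "- q"] carrier_uminus[of q n] by simp

lemma carrier_mult [intro]:
  assumes "p \<in> carrier (mpoly_ring n)" "q \<in> carrier (mpoly_ring n)"
  shows "p * q \<in> carrier (mpoly_ring n)"
  unfolding mem_carrier_iff
proof
  fix m assume "m \<in> Poly_Mapping.keys (p * q)"
  then obtain a b where "m = a + b" "a \<in> Poly_Mapping.keys p" "b \<in> Poly_Mapping.keys q"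
    using keys_mult[of p q] by blast
  then show "Poly_Mapping.keys m \<subseteq> {..<n}"
    using assms keys_add[of a b] unfolding mem_carrier_iff by blast
qed

lemma carrier_zero [simp, intro]: "0 \<in> carrier (mpoly_ring n)"
  and carrier_cst [simp, intro]: "cst c \<in> carrier (mpoly_ring n)"
  and carrier_one [simp, intro]: "1 \<in> carrier (mpoly_ring n)"
  by (simp_all add: mem_carrier_iff)

lemma carrier_sum [intro]: "(\<And>j. j \<in> J \<Longrightarrow> f j \<in> carrier (mpoly_ring n)) \<Longrightarrow> (\<Sum>j\<in>J. f j) \<in> carrier (mpoly_ring n)"
  by (induction J rule: infinite_finite_induct) auto

lemma mpoly_ring_cring: "cring (mpoly_ring n :: 'k::comm_ring_1 mpoly ring)"
proof (rule cringI)
  show "abelian_group (mpoly_ring n :: 'k mpoly ring)"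
  proof (rule abelian_groupI)
    fix p :: "'k mpoly" assume "p \<in> carrier (mpoly_ring n)"
    then show "\<exists>q\<in>carrier (mpoly_ring n). q \<oplus>\<^bsub>mpoly_ring n\<^esub> p = \<zero>\<^bsub>mpoly_ring n\<^esub>"
      by (intro bexI[of _ "- p"]) auto
  qed (auto simp: algebra_simps)
  show "Group.comm_monoid (mpoly_ring n :: 'k mpoly ring)"
    by (rule Group.comm_monoidI) (auto simp: algebra_simps)
qed (auto simp: algebra_simps)

text \<open>
  Closure conditions in terms of the operations of the polynomial type, for use with the
  locale-based notion of a subgroup.
\<close>

lemma add_subgroupI:
  fixes V :: "'k::comm_ring_1 mpoly set"
  assumes "V \<subseteq> carrier (mpoly_ring n)" "0 \<in> V"
    and "\<And>p q. p \<in> V \<Longrightarrow> q \<in> V \<Longrightarrow> p + q \<in> V" "\<And>p. p \<in> V \<Longrightarrow> - p \<in> V"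
  shows "subgroup V (add_monoid (mpoly_ring n))"
proof -
  interpret R: cring "mpoly_ring n :: 'k mpoly ring" by (rule mpoly_ring_cring)
  show ?thesis
  proof (rule group.subgroupI)
    show "Group.group (add_monoid (mpoly_ring n :: 'k mpoly ring))"
      using R.add.is_group .
    show "V \<subseteq> carrier (add_monoid (mpoly_ring n))" "V \<noteq> {}" using assms(1,2) by auto
    fix p assume p: "p \<in> V"
    then have "inv\<^bsub>add_monoid (mpoly_ring n)\<^esub> p = - p"
      using R.minus_equality[of "- p" p] assms(1) unfolding a_inv_def by auto
    then show "inv\<^bsub>add_monoid (mpoly_ring n)\<^esub> p \<in> V" using assms(4) p by simp
    fix q assume "q \<in> V"
    then show "p \<otimes>\<^bsub>add_monoid (mpoly_ring n)\<^esub> q \<in> V" using p assms(3) by simp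
  qed
qed

lemma forms_carrier: "p \<in> forms n i \<Longrightarrow> p \<in> carrier (mpoly_ring n)"
  by (simp add: forms_def)

lemma forms_degree: "p \<in> forms n i \<Longrightarrow> m \<in> Poly_Mapping.keys p \<Longrightarrow> mon_degree m = i"
  by (simp add: forms_def)

lemma forms_zero [simp, intro]: "0 \<in> forms n i"
  by (simp add: forms_def)

lemma forms_cst [simp, intro]: "cst c \<in> forms n 0"
  by (simp add: forms_def)

lemma forms_monomial [intro]: "Poly_Mapping.keys m \<subseteq> {..<n} \<Longrightarrow> mon_degree m = i \<Longrightarrow> Poly_Mapping.single m c \<in> forms n i"
  by (auto simp: forms_def mem_carrier_iff)

lemma forms_indet [intro]: "j < n \<Longrightarrow> indet j \<in> forms n 1"
  by (rule forms_monomial) auto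

lemma forms_add [intro]: "p \<in> forms n i \<Longrightarrow> q \<in> forms n i \<Longrightarrow> p + q \<in> forms n i"
  using keys_add[of p q] unfolding forms_def by auto

lemma forms_uminus [intro]: "p \<in> forms n i \<Longrightarrow> - p \<in> forms n i"
  unfolding forms_def by (auto simp: in_keys_iff)

lemma forms_diff [intro]: "p \<in> forms n i \<Longrightarrow> q \<in> forms n i \<Longrightarrow> p - q \<in> forms n i"
  using forms_add[of p n i "- q"] forms_uminus[of q n i] by simp

lemma forms_sum [intro]: "(\<And>j. j \<in> J \<Longrightarrow> f j \<in> forms n i) \<Longrightarrow> (\<Sum>j\<in>J. f j) \<in> forms n i"
  by (induction J rule: infinite_finite_induct) auto

lemma forms_mult [intro]:
  assumes "p \<in> forms n i" "q \<in> forms n j"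
  shows "p * q \<in> forms n (i + j)"
proof -
  have "mon_degree m = i + j" if "m \<in> Poly_Mapping.keys (p * q)" for m
    using that keys_mult[of p q] assms by (force simp: forms_def)
  then show ?thesis using assms by (auto simp: forms_def)
qed

lemma forms_mult_eq: "p \<in> forms n i \<Longrightarrow> q \<in> forms n j \<Longrightarrow> i + j = k \<Longrightarrow> p * q \<in> forms n k"
  by auto

lemma forms_cst_mult [intro]: "p \<in> forms n i \<Longrightarrow> cst c * p \<in> forms n i"
  using forms_mult[OF forms_cst, of p n i c] by simp

lemma forms_power: "p \<in> forms n i \<Longrightarrow> p ^ k \<in> forms n (i * k)"
proof (induction k)
  case 0
  then show ?case using forms_cst[of 1 n] by simp
qed auto

lemma forms_power_1: "p \<in> forms n 1 \<Longrightarrow> p ^ k \<in> forms n k"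
  using forms_power[of p n 1 k] by simp

lemma forms_prod_1: "finite J \<Longrightarrow> (\<And>j. j \<in> J \<Longrightarrow> f j \<in> forms n 1) \<Longrightarrow> (\<Prod>j\<in>J. f j) \<in> forms n (card J)"
proof (induction J rule: finite_induct)
  case empty
  then show ?case using forms_cst[of 1 n] by simp
next
  case (insert j J)
  then show ?case by (auto intro!: forms_mult_eq[of _ n 1])
qed

lemma forms_0_cst: "p \<in> forms n 0 \<Longrightarrow> \<exists>c. p = cst c"
proof (intro exI[of _ "Poly_Mapping.lookup p 0"] poly_mapping_eqI)
  fix m assume "p \<in> forms n 0"
  then have "m \<in> Poly_Mapping.keys p \<Longrightarrow> m = 0"
    by (auto simp: forms_def mon_degree_eq_0_iff)
  then show "Poly_Mapping.lookup p m = Poly_Mapping.lookup (cst (Poly_Mapping.lookup p 0)) m"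
    by (auto simp: lookup_single in_keys_iff when_def)
qed

definition component :: "nat \<Rightarrow> 'k::comm_ring_1 mpoly \<Rightarrow> 'k mpoly" where
  "component i p = (\<Sum>m | m \<in> Poly_Mapping.keys p \<and> mon_degree m = i.
     Poly_Mapping.single m (Poly_Mapping.lookup p m))"

lemma lookup_component:
  "Poly_Mapping.lookup (component i p) m = (if mon_degree m = i then Poly_Mapping.lookup p m else 0)"
proof -
  have "Poly_Mapping.lookup (component i p) m =
    (\<Sum>m' | m' \<in> Poly_Mapping.keys p \<and> mon_degree m' = i. if m' = m then Poly_Mapping.lookup p m else 0)"
    unfolding component_def by (auto simp: lookup_sum lookup_single when_def intro!: sum.cong)
  also have "\<dots> = (if mon_degree m = i then Poly_Mapping.lookup p m else 0)"
    by (subst sum.delta) (auto simp: in_keys_iff)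
  finally show ?thesis .
qed

lemma component_forms [intro]: "p \<in> carrier (mpoly_ring n) \<Longrightarrow> component i p \<in> forms n i"
  by (auto simp: forms_def mem_carrier_iff in_keys_iff lookup_component split: if_splits)

lemma component_add: "component i (p + q) = component i p + component i q"
  by (rule poly_mapping_eqI) (simp add: lookup_component lookup_add)

lemma component_zero [simp]: "component i 0 = 0"
  by (rule poly_mapping_eqI) (simp add: lookup_component)

lemma component_sum: "component i (\<Sum>j\<in>J. f j) = (\<Sum>j\<in>J. component i (f j))"
  by (induction J rule: infinite_finite_induct) (simp_all add: component_add)

lemma component_uminus: "component i (- p) = - component i p"
  by (rule poly_mapping_eqI) (simp add: lookup_component)

lemma component_of_form: "p \<in> forms n j \<Longrightarrow> component i p = (if i = j then p else 0)"
  by (rule poly_mapping_eqI) (auto simp: lookup_component forms_def in_keys_iff)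

lemma sum_component: "\<exists>N. \<forall>N'\<ge>N. p = (\<Sum>i<N'. component i p)"
proof -
  define N where "N = Suc (Max (insert 0 (mon_degree ` Poly_Mapping.keys p)))"
  have "mon_degree m < N" if "m \<in> Poly_Mapping.keys p" for m
    using that by (auto simp: N_def less_Suc_eq_le)
  then have "Poly_Mapping.lookup (\<Sum>i<N'. component i p) m = Poly_Mapping.lookup p m" if "N' \<ge> N" for N' m
    using that by (auto simp: lookup_sum lookup_component in_keys_iff not_less) force
  then show ?thesis by (intro exI[of _ N] allI impI poly_mapping_eqI) simp
qed

lemma component_mult_form:
  assumes r: "r \<in> forms n j" and p: "p \<in> carrier (mpoly_ring n)"
  shows "component i (r * p) = (if j \<le> i then r * component (i - j) p else 0)"
proof -
  obtain N where N: "p = (\<Sum>k<N. component k p)" "N > i" using sum_component[of p] by (metis lessI max.cobounded1 max.strict_coboundedI2)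
  have "component i (r * p) = (\<Sum>k<N. component i (r * component k p))"
    by (subst N(1)) (simp add: sum_distrib_left component_sum)
  also have "\<dots> = (\<Sum>k<N. if k = i - j \<and> j \<le> i then r * component k p else 0)"
  proof (rule sum.cong)
    fix k
    have "r * component k p \<in> forms n (j + k)" using r p by auto
    from component_of_form[OF this, of i] show "component i (r * component k p) = (if k = i - j \<and> j \<le> i then r * component k p else 0)"
      by auto
  qed simp
  also have "\<dots> = (if j \<le> i then r * component (i - j) p else 0)"
    using N(2) by (cases "j \<le> i") (simp_all add: sum.delta)
  finally show ?thesis .
qed

section \<open>Homogeneous ideals and dimensions of graded pieces\<close>

locale homogeneous_quotient =
  fixes n :: nat and I :: "'k::field mpoly set"
  assumes homogeneous: "homogeneous_ideal n I"
    and proper: "I \<noteq> carrier (mpoly_ring n)"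
begin

abbreviation coset :: "'k mpoly \<Rightarrow> 'k mpoly set" where
  "coset p \<equiv> I +>\<^bsub>mpoly_ring n\<^esub> p"

sublocale I: ideal I "mpoly_ring n"
  using homogeneous by (simp add: homogeneous_ideal_def)

sublocale Q: cring "quot_alg n I"
  by (rule I.quotient_is_cring) (rule mpoly_ring_cring)

sublocale proj: ring_hom_ring "mpoly_ring n" "quot_alg n I" coset
  by (rule I.rcos_ring_hom_ring)

lemma I_zero [simp, intro]: "0 \<in> I"
  using additive_subgroup.zero_closed[OF I.additive_subgroup_axioms] by simp

lemma I_add [intro]: "p \<in> I \<Longrightarrow> q \<in> I \<Longrightarrow> p + q \<in> I"
  using additive_subgroup.a_closed[OF I.additive_subgroup_axioms, of p q] by simp

lemma I_mult [intro]: "p \<in> carrier (mpoly_ring n) \<Longrightarrow> q \<in> I \<Longrightarrow> p * q \<in> I"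
  using I.I_l_closed[of q p] by simp

lemma I_uminus [intro]: "p \<in> I \<Longrightarrow> - p \<in> I"
  using I_mult[OF carrier_cst, of p "- 1"] by (simp add: single_uminus)

lemma I_diff [intro]: "p \<in> I \<Longrightarrow> q \<in> I \<Longrightarrow> p - q \<in> I"
  using I_add[of p "- q"] by auto

lemma I_sum [intro]: "(\<And>j. j \<in> J \<Longrightarrow> f j \<in> I) \<Longrightarrow> (\<Sum>j\<in>J. f j) \<in> I"
  by (induction J rule: infinite_finite_induct) auto

lemma I_cst_mult_iff: "p \<in> carrier (mpoly_ring n) \<Longrightarrow> cst c * p \<in> I \<longleftrightarrow> c = 0 \<or> p \<in> I"
proof
  assume p: "p \<in> carrier (mpoly_ring n)" and "cst c * p \<in> I"
  then have "cst (inverse c) * (cst c * p) \<in> I" by auto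
  then show "c = 0 \<or> p \<in> I"
    by (cases "c = 0") (simp_all add: mult.assoc[symmetric] cst_mult[symmetric])
qed auto

lemma I_diff_cong: "p - q \<in> I \<Longrightarrow> p \<in> I \<longleftrightarrow> q \<in> I"
  using I_diff[of p "p - q"] I_add[of "p - q" q] by auto

lemma one_notin: "1 \<notin> I"
  using proper I.one_imp_carrier by auto

text \<open>
  The polynomials all of whose components lie in \<open>I\<close> form an ideal that contains the homogeneous
  generators of \<open>I\<close>.
\<close>

lemma component_in_ideal:
  assumes "p \<in> I"
  shows "component i p \<in> I"
proof -
  obtain S where S: "S \<subseteq> (\<Union>i. forms n i)" "I = Idl\<^bsub>mpoly_ring n\<^esub> S"
    using homogeneous by (auto simp: homogeneous_ideal_def)
  define J where "J = {p \<in> carrier (mpoly_ring n). \<forall>i. component i p \<in> I}"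
  have mult: "r * p \<in> J" if r: "r \<in> carrier (mpoly_ring n)" and p: "p \<in> J" for r p
  proof -
    have p': "p \<in> carrier (mpoly_ring n)" using p by (simp add: J_def)
    obtain N where N: "r = (\<Sum>k<N. component k r)" using sum_component[of r] by blast
    have "component i (r * p) \<in> I" for i
    proof -
      have "component i (r * p) = (\<Sum>k<N. component i (component k r * p))"
        by (subst N) (simp add: sum_distrib_right component_sum)
      also have "\<dots> \<in> I"
      proof (rule I_sum)
        fix k
        have "component i (component k r * p) = (if k \<le> i then component k r * component (i - k) p else 0)"
          using r p' by (intro component_mult_form) auto
        then show "component i (component k r * p) \<in> I"
          using p r by (auto simp: J_def intro!: I_mult forms_carrier[OF component_forms])
      qed
      finally show ?thesis .
    qed
    then show ?thesis using r p' by (auto simp: J_def)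
  qed
  have "ideal J (mpoly_ring n)"
  proof (rule idealI)
    show "ring (mpoly_ring n :: 'k mpoly ring)" using mpoly_ring_cring by (rule cring.axioms)
    show "subgroup J (add_monoid (mpoly_ring n))"
      by (rule add_subgroupI) (auto simp: J_def component_add component_uminus)
  next
    fix a x assume "a \<in> J" "x \<in> carrier (mpoly_ring n :: 'k mpoly ring)"
    then show "x \<otimes>\<^bsub>mpoly_ring n\<^esub> a \<in> J" "a \<otimes>\<^bsub>mpoly_ring n\<^esub> x \<in> J"
      using mult[of x a] by (simp_all add: mult.commute)
  qed
  moreover have "S \<subseteq> J"
  proof
    fix s assume s: "s \<in> S"
    then obtain j where j: "s \<in> forms n j" using S(1) by blast
    have "S \<subseteq> carrier (mpoly_ring n)" using S(1) by (auto intro: forms_carrier)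
    then have "s \<in> I" unfolding S(2) using s I.genideal_self by blast
    then show "s \<in> J" using j by (auto simp: J_def component_of_form forms_carrier)
  qed
  ultimately have "I \<subseteq> J" unfolding S(2) by (rule I.genideal_minimal)
  then show ?thesis using assms by (auto simp: J_def)
qed

lemma coset_eq_iff:
  assumes "p \<in> carrier (mpoly_ring n)" "q \<in> carrier (mpoly_ring n)"
  shows "coset p = coset q \<longleftrightarrow> p - q \<in> I"
proof -
  have "p \<ominus>\<^bsub>mpoly_ring n\<^esub> q = p - q"
  proof -
    have "\<ominus>\<^bsub>mpoly_ring n\<^esub> q = - q"
      using assms by (intro I.minus_equality) auto
    then show ?thesis by (simp add: a_minus_def)
  qed
  then show ?thesis
    using I.quotient_eq_iff_same_a_r_cos[OF I.ideal_axioms assms] by simp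
qed

lemma quot_zero: "\<zero>\<^bsub>quot_alg n I\<^esub> = coset 0"
  using proj.hom_zero by simp

lemma coset_eq_zero_iff: "p \<in> carrier (mpoly_ring n) \<Longrightarrow> coset p = \<zero>\<^bsub>quot_alg n I\<^esub> \<longleftrightarrow> p \<in> I"
  unfolding quot_zero using coset_eq_iff[of p 0] by simp

lemma coset_mult: "p \<in> carrier (mpoly_ring n) \<Longrightarrow> q \<in> carrier (mpoly_ring n) \<Longrightarrow>
    coset p \<otimes>\<^bsub>quot_alg n I\<^esub> coset q = coset (p * q)"
  using proj.hom_mult[of p q] by simp

lemma coset_add: "p \<in> carrier (mpoly_ring n) \<Longrightarrow> q \<in> carrier (mpoly_ring n) \<Longrightarrow>
    coset p \<oplus>\<^bsub>quot_alg n I\<^esub> coset q = coset (p + q)"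
  using proj.hom_add[of p q] by simp

lemma quot_carrier: "carrier (quot_alg n I) = coset ` carrier (mpoly_ring n)"
  by (auto simp: FactRing_def A_RCOSETS_def')

lemma scalars_subfield: "subfield (scalars n I) (quot_alg n I)"
proof -
  have "Group.comm_monoid (mpoly_ring n\<lparr>carrier := range cst\<rparr> :: 'k mpoly ring)"
    by (rule Group.comm_monoidI)
      (auto simp: algebra_simps cst_mult[symmetric] mpoly_ring_def intro: range_eqI[of _ cst 1])
  moreover have "abelian_group (mpoly_ring n\<lparr>carrier := range cst\<rparr> :: 'k mpoly ring)"
  proof (rule abelian_groupI)
    fix x assume "x \<in> carrier (mpoly_ring n\<lparr>carrier := range cst\<rparr> :: 'k mpoly ring)"
    then obtain c where "x = cst c" by auto
    then show "\<exists>y\<in>carrier (mpoly_ring n\<lparr>carrier := range cst\<rparr>).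
        y \<oplus>\<^bsub>mpoly_ring n\<lparr>carrier := range cst\<rparr>\<^esub> x = \<zero>\<^bsub>mpoly_ring n\<lparr>carrier := range cst\<rparr>\<^esub>"
      by (intro bexI[of _ "cst (- c)"]) (auto simp: single_add[symmetric] mpoly_ring_def)
  qed (auto simp: algebra_simps single_add[symmetric] mpoly_ring_def intro: range_eqI[of _ cst 0])
  ultimately have "cring (mpoly_ring n\<lparr>carrier := range cst\<rparr> :: 'k mpoly ring)"
    by (intro cringI) (auto simp: algebra_simps mpoly_ring_def)
  then have "field (mpoly_ring n\<lparr>carrier := range cst\<rparr> :: 'k mpoly ring)"
  proof (rule cring.cring_fieldI2)
    show "\<zero>\<^bsub>mpoly_ring n\<lparr>carrier := range cst\<rparr>\<^esub> \<noteq> (\<one>\<^bsub>mpoly_ring n\<lparr>carrier := range cst\<rparr>\<^esub> :: 'k mpoly)"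
      by (simp add: mpoly_ring_def)
    fix a assume "a \<in> carrier (mpoly_ring n\<lparr>carrier := range cst\<rparr> :: 'k mpoly ring)"
      "a \<noteq> \<zero>\<^bsub>mpoly_ring n\<lparr>carrier := range cst\<rparr>\<^esub>"
    moreover from this obtain c where c: "a = cst c" by auto
    ultimately have "c \<noteq> 0" by (auto simp: mpoly_ring_def)
    with c show "\<exists>b\<in>carrier (mpoly_ring n\<lparr>carrier := range cst\<rparr>).
        a \<otimes>\<^bsub>mpoly_ring n\<lparr>carrier := range cst\<rparr>\<^esub> b = \<one>\<^bsub>mpoly_ring n\<lparr>carrier := range cst\<rparr>\<^esub>"
      by (intro bexI[of _ "cst (inverse c)"]) (auto simp: cst_mult[symmetric] mpoly_ring_def)
  qed
  then have "subfield (range cst) (mpoly_ring n :: 'k mpoly ring)"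
    by (intro I.subfield_iff(1)) auto
  moreover have "\<one>\<^bsub>quot_alg n I\<^esub> \<noteq> \<zero>\<^bsub>quot_alg n I\<^esub>"
    using one_notin coset_eq_zero_iff[of 1] proj.hom_one by auto
  ultimately have "subfield (coset ` range cst) (quot_alg n I)"
    by (rule proj.img_is_subfield)
  then show ?thesis by (simp add: scalars_def image_image)
qed

text \<open>
  Linear algebra in the quotient is expressed by families of representatives: \<open>independent_mod\<close> and
  \<open>spanning_mod\<close> say that the cosets of \<open>b 0, \<dots>, b (N - 1)\<close> are independent over the image of \<open>K\<close>,
  respectively that their span contains the image of \<open>V\<close>. After \<open>dimension_iff_basis\<close>, dimensions can
  be handled without reference to cosets.
\<close>

definition independent_mod :: "(nat \<Rightarrow> 'k mpoly) \<Rightarrow> nat \<Rightarrow> bool" where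
  "independent_mod b N \<longleftrightarrow> (\<forall>c. (\<Sum>j<N. cst (c j) * b j) \<in> I \<longrightarrow> (\<forall>j<N. c j = 0))"

definition spanning_mod :: "'k mpoly set \<Rightarrow> (nat \<Rightarrow> 'k mpoly) \<Rightarrow> nat \<Rightarrow> bool" where
  "spanning_mod V b N \<longleftrightarrow> (\<forall>p\<in>V. \<exists>c. p - (\<Sum>j<N. cst (c j) * b j) \<in> I)"

lemma combine_coset:
  assumes "length cs = length bs" "set bs \<subseteq> carrier (mpoly_ring n)"
  shows "Q.combine (map (\<lambda>c. coset (cst c)) cs) (map coset bs) = coset (\<Sum>j<length bs. cst (cs ! j) * bs ! j)"
  using assms
proof (induction cs bs rule: list_induct2)
  case Nil
  then show ?case by (simp add: quot_zero)
next
  case (Cons c cs b bs)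
  have "(\<Sum>j<length bs. cst (cs ! j) * bs ! j) \<in> carrier (mpoly_ring n)"
    using Cons.prems by (intro carrier_sum carrier_mult) auto
  moreover have "(\<Sum>j<length (b # bs). cst ((c # cs) ! j) * (b # bs) ! j) =
      cst c * b + (\<Sum>j<length bs. cst (cs ! j) * bs ! j)"
    by (simp only: length_Cons sum.lessThan_Suc_shift) simp
  ultimately show ?case
    using Cons by (simp add: coset_mult coset_add carrier_mult)
qed

lemma sum_carrier:
  "(\<And>j. j < N \<Longrightarrow> b j \<in> carrier (mpoly_ring n)) \<Longrightarrow> (\<Sum>j<N. cst (c j) * b j) \<in> carrier (mpoly_ring n)"
  by (intro carrier_sum carrier_mult) auto

lemma independent_mod_iff:
  assumes b: "\<And>j. j < N \<Longrightarrow> b j \<in> carrier (mpoly_ring n)"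
  shows "independent_mod b N \<longleftrightarrow> Q.independent (scalars n I) (map (\<lambda>j. coset (b j)) [0..<N])"
proof -
  let ?Us = "map (\<lambda>j. coset (b j)) [0..<N]"
  have Us: "set ?Us \<subseteq> carrier (quot_alg n I)" using b by (auto simp: quot_carrier)
  have comb: "Q.combine (map (\<lambda>c. coset (cst c)) cs) ?Us = coset (\<Sum>j<N. cst (cs ! j) * b j)"
    if "length cs = N" for cs
    using combine_coset[of cs "map b [0..<N]"] that b by (simp add: comp_def image_subset_iff)
  show ?thesis
  proof
    assume ind: "independent_mod b N"
    show "Q.independent (scalars n I) ?Us"
    proof (rule Q.trivial_combine_imp_independent[OF scalars_subfield Us])
      fix Ks assume Ks: "set Ks \<subseteq> scalars n I" "Q.combine Ks ?Us = \<zero>\<^bsub>quot_alg n I\<^esub>"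
      have "set Ks \<subseteq> carrier (quot_alg n I)"
        using Ks(1) subfieldE(3)[OF scalars_subfield] by auto
      then obtain Ks' where Ks': "set (take (length ?Us) Ks) \<subseteq> set Ks'"
        "set Ks' \<subseteq> set (take (length ?Us) Ks) \<union> {\<zero>\<^bsub>quot_alg n I\<^esub>}"
        "length Ks' = length ?Us" "Q.combine Ks' ?Us = \<zero>\<^bsub>quot_alg n I\<^esub>"
        using Q.combine_normalize[OF _ Us Ks(2)] by metis
      have "\<forall>k\<in>set Ks'. \<exists>c. k = coset (cst c)"
      proof
        fix k assume "k \<in> set Ks'"
        then have "k \<in> scalars n I \<or> k = coset (cst 0)"
          using Ks'(2) Ks(1) set_take_subset[of N Ks] by (auto simp: quot_zero)
        then show "\<exists>c. k = coset (cst c)" unfolding scalars_def by blast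
      qed
      then obtain cs where cs: "Ks' = map (\<lambda>c. coset (cst c)) cs"
        using ex_map_conv by metis
      then have len: "length cs = N" using Ks'(3) by simp
      have "(\<Sum>j<N. cst (cs ! j) * b j) \<in> I"
        using Ks'(4) coset_eq_zero_iff[OF sum_carrier[of N b]] b unfolding cs comb[OF len] by auto
      then have "cs ! j = 0" if "j < N" for j using ind that by (auto simp: independent_mod_def)
      then have "set Ks' \<subseteq> {\<zero>\<^bsub>quot_alg n I\<^esub>}" using len by (auto simp: cs in_set_conv_nth quot_zero)
      then show "set (take (length ?Us) Ks) \<subseteq> {\<zero>\<^bsub>quot_alg n I\<^esub>}" using Ks'(1) by blast
    qed
  next
    assume ind: "Q.independent (scalars n I) ?Us"
    show "independent_mod b N"
      unfolding independent_mod_def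
    proof (intro allI impI)
      fix c j assume "(\<Sum>j<N. cst (c j) * b j) \<in> I" and j: "j < N"
      then have "Q.combine (map (\<lambda>c. coset (cst c)) (map c [0..<N])) ?Us = \<zero>\<^bsub>quot_alg n I\<^esub>"
        using coset_eq_zero_iff[OF sum_carrier[of N b]] b by (subst comb) auto
      from Q.independent_imp_trivial_combine[OF scalars_subfield ind _ this]
      have "set (map (\<lambda>c. coset (cst c)) (map c [0..<N])) \<subseteq> {\<zero>\<^bsub>quot_alg n I\<^esub>}"
        by (auto simp: scalars_def)
      then have "coset (cst (c j)) = \<zero>\<^bsub>quot_alg n I\<^esub>" using j by (simp add: image_subset_iff)
      then have "cst (c j) * 1 \<in> I" using coset_eq_zero_iff by simp
      then show "c j = 0" using one_notin I_cst_mult_iff by blast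
    qed
  qed
qed

lemma mem_Span_iff:
  assumes b: "\<And>j. j < N \<Longrightarrow> b j \<in> carrier (mpoly_ring n)" and p: "p \<in> carrier (mpoly_ring n)"
  shows "coset p \<in> Q.Span (scalars n I) (map (\<lambda>j. coset (b j)) [0..<N]) \<longleftrightarrow>
    (\<exists>c. p - (\<Sum>j<N. cst (c j) * b j) \<in> I)"
proof -
  let ?Us = "map (\<lambda>j. coset (b j)) [0..<N]"
  have Us: "set ?Us \<subseteq> carrier (quot_alg n I)" using b by (auto simp: quot_carrier)
  have comb: "Q.combine (map (\<lambda>c. coset (cst c)) cs) ?Us = coset (\<Sum>j<N. cst (cs ! j) * b j)"
    if "length cs = N" for cs
    using combine_coset[of cs "map b [0..<N]"] that b by (simp add: comp_def image_subset_iff)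
  show ?thesis
  proof
    assume "coset p \<in> Q.Span (scalars n I) ?Us"
    then obtain Ks where Ks: "set Ks \<subseteq> scalars n I" "length Ks = N" "coset p = Q.combine Ks ?Us"
      using Q.Span_mem_iff_length_version[OF scalars_subfield Us] by auto
    then have "\<forall>k\<in>set Ks. \<exists>c. k = coset (cst c)" by (auto simp: scalars_def)
    then obtain cs where cs: "Ks = map (\<lambda>c. coset (cst c)) cs" using ex_map_conv by metis
    then have "coset p = coset (\<Sum>j<N. cst (cs ! j) * b j)" using Ks comb by simp
    then have "p - (\<Sum>j<N. cst (cs ! j) * b j) \<in> I" using coset_eq_iff[OF p sum_carrier[of N b "\<lambda>j. cs ! j"]] b by simp
    then show "\<exists>c. p - (\<Sum>j<N. cst (c j) * b j) \<in> I" by (intro exI[of _ "\<lambda>j. cs ! j"])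
  next
    assume "\<exists>c. p - (\<Sum>j<N. cst (c j) * b j) \<in> I"
    then obtain c where "p - (\<Sum>j<N. cst (c j) * b j) \<in> I" by blast
    then have "coset p = coset (\<Sum>j<N. cst (c j) * b j)" using coset_eq_iff[OF p sum_carrier[of N b c]] b by simp
    also have "\<dots> = Q.combine (map (\<lambda>c. coset (cst c)) (map c [0..<N])) ?Us"
      by (subst comb) auto
    finally show "coset p \<in> Q.Span (scalars n I) ?Us"
      using Q.Span_mem_iff_length_version[OF scalars_subfield Us]
      by (auto simp: scalars_def intro!: exI[of _ "map (\<lambda>c. coset (cst c)) (map c [0..<N])"])
  qed
qed

lemma dimension_iff_basis:
  assumes V: "V \<subseteq> carrier (mpoly_ring n)"
    and lin: "\<And>(N::nat) b c. (\<And>j. j < N \<Longrightarrow> b j \<in> V) \<Longrightarrow> (\<Sum>j<N. cst (c j) * b j) \<in> V"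
  shows "Q.dimension N (scalars n I) (coset ` V) \<longleftrightarrow>
    (\<exists>b. (\<forall>j<N. b j \<in> V) \<and> independent_mod b N \<and> spanning_mod V b N)"
proof
  assume "Q.dimension N (scalars n I) (coset ` V)"
  then obtain Vs where Vs: "set Vs \<subseteq> carrier (quot_alg n I)" "Q.independent (scalars n I) Vs"
    "length Vs = N" "Q.Span (scalars n I) Vs = coset ` V"
    using Q.exists_base[OF scalars_subfield] by blast
  have "set Vs \<subseteq> coset ` V" using Q.Span_base_incl[OF scalars_subfield Vs(1)] Vs(4) by simp
  then have "\<forall>v\<in>set Vs. \<exists>p. p \<in> V \<and> v = coset p" by blast
  then obtain rep where rep: "\<forall>v\<in>set Vs. rep v \<in> V \<and> v = coset (rep v)" by metis
  define b where "b = (\<lambda>j. rep (Vs ! j))"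
  have bV: "b j \<in> V" if "j < N" for j using rep that Vs(3) by (auto simp: b_def)
  then have bc: "b j \<in> carrier (mpoly_ring n)" if "j < N" for j using that V by blast
  have eq: "map (\<lambda>j. coset (b j)) [0..<N] = Vs"
    using Vs(3) rep by (intro nth_equalityI) (auto simp: b_def)
  have "independent_mod b N" using independent_mod_iff[of N b, OF bc] Vs(2) eq by simp
  moreover have "spanning_mod V b N"
    unfolding spanning_mod_def using mem_Span_iff[of N b, OF bc] V Vs(4) eq by (auto simp del: Q.Span.simps)
  ultimately show "\<exists>b. (\<forall>j<N. b j \<in> V) \<and> independent_mod b N \<and> spanning_mod V b N" using bV by blast
next
  assume "\<exists>b. (\<forall>j<N. b j \<in> V) \<and> independent_mod b N \<and> spanning_mod V b N"
  then obtain b where b: "\<And>j. j < N \<Longrightarrow> b j \<in> V" "independent_mod b N" "spanning_mod V b N" by blast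
  then have bc: "b j \<in> carrier (mpoly_ring n)" if "j < N" for j using that V by blast
  let ?Us = "map (\<lambda>j. coset (b j)) [0..<N]"
  have Us: "set ?Us \<subseteq> carrier (quot_alg n I)" using bc by (auto simp: quot_carrier)
  have "Q.Span (scalars n I) ?Us = coset ` V"
  proof (intro subset_antisym subsetI)
    fix x assume x: "x \<in> Q.Span (scalars n I) ?Us"
    then have "x \<in> carrier (quot_alg n I)"
      using Q.Span_subgroup_props(1)[OF scalars_subfield Us] by blast
    then obtain p where p: "x = coset p" "p \<in> carrier (mpoly_ring n)" by (auto simp: quot_carrier)
    with x obtain c where "p - (\<Sum>j<N. cst (c j) * b j) \<in> I" using mem_Span_iff[of N b p, OF bc] by auto
    then have "x = coset (\<Sum>j<N. cst (c j) * b j)" using coset_eq_iff[OF p(2) sum_carrier[of N b c]] bc p by simp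
    then show "x \<in> coset ` V" using lin[of N b c, OF b(1)] by (rule image_eqI)
  next
    fix x assume "x \<in> coset ` V"
    then show "x \<in> Q.Span (scalars n I) ?Us"
      using b(3) mem_Span_iff[of N b, OF bc] V by (auto simp: spanning_mod_def)
  qed
  then show "Q.dimension N (scalars n I) (coset ` V)"
    using Q.dimensionI[OF scalars_subfield] independent_mod_iff[of N b, OF bc] b(2) by fastforce
qed

lemma forms_lincomb: "(\<And>j. j < N \<Longrightarrow> b j \<in> forms n i) \<Longrightarrow> (\<Sum>j<N. cst (c j) * b j) \<in> forms n i"
  by auto

lemma dimension_graded_part_iff:
  "Q.dimension N (scalars n I) (graded_part n I i) \<longleftrightarrow>
    (\<exists>b. (\<forall>j<N. b j \<in> forms n i) \<and> independent_mod b N \<and> spanning_mod (forms n i) b N)"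
  unfolding graded_part_def
  by (rule dimension_iff_basis) (auto intro: forms_carrier)

lemma independent_length_le:
  assumes "spanning_mod V b N" "\<And>j. j < N \<Longrightarrow> b j \<in> carrier (mpoly_ring n)"
    and "independent_mod b' M" "\<And>j. j < M \<Longrightarrow> b' j \<in> V"
  shows "M \<le> N"
proof (rule ccontr)
  assume "\<not> M \<le> N"
  then have card: "card {..<N} < card {..<M}" by simp
  have "\<exists>f. \<forall>j<M. b' j - (\<Sum>k<N. cst (f j k) * b k) \<in> I"
 (is "\<exists>f. \<forall>j<M. ?P j (f j)")
  proof -
    have "\<forall>j\<in>{..<M}. \<exists>c. ?P j c" using assms(1,4) unfolding spanning_mod_def by blast
    from bchoice[OF this] show ?thesis by auto
  qed
  then obtain f where f: "\<And>j. j < M \<Longrightarrow> b' j - (\<Sum>k<N. cst (f j k) * b k) \<in> I" by blast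
  obtain c where c: "\<exists>j\<in>{..<M}. c j \<noteq> 0" "\<forall>k\<in>{..<N}. (\<Sum>j<M. c j * f j k) = 0"
    using underdetermined_system[OF _ _ card, of f] by auto
  have "(\<Sum>j<M. cst (c j) * b' j) = (\<Sum>j<M. cst (c j) * (b' j - (\<Sum>k<N. cst (f j k) * b k)))
      + (\<Sum>k<N. cst (\<Sum>j<M. c j * f j k) * b k)"
  proof -
    have "(\<Sum>k<N. cst (\<Sum>j<M. c j * f j k) * b k) = (\<Sum>k<N. \<Sum>j<M. cst (c j) * (cst (f j k) * b k))"
      by (simp add: cst_sum cst_mult sum_distrib_right mult.assoc)
    also have "\<dots> = (\<Sum>j<M. cst (c j) * (\<Sum>k<N. cst (f j k) * b k))"
      by (subst sum.swap) (simp add: sum_distrib_left)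
    finally show ?thesis by (simp add: right_diff_distrib sum_subtractf)
  qed
  also have "\<dots> \<in> I" using f c(2) by (intro I_add I_sum) auto
  finally show False using assms(3) c(1) by (auto simp: independent_mod_def)
qed

end

locale artinian_quotient = homogeneous_quotient n I for n and I :: "'k::field mpoly set" +
  assumes finite_dimension: "Q.finite_dimension (scalars n I) (carrier (quot_alg n I))"
begin

lemma hilbert_function_basis:
  obtains b where "\<And>j. j < hilbert_function n I i \<Longrightarrow> b j \<in> forms n i"
    "independent_mod b (hilbert_function n I i)" "spanning_mod (forms n i) b (hilbert_function n I i)"
proof -
  have sub: "subgroup (graded_part n I i) (add_monoid (quot_alg n I))"
    unfolding graded_part_def
    by (intro proj.img_is_add_subgroup add_subgroupI) (auto intro: forms_carrier)
  have "subalgebra (scalars n I) (graded_part n I i) (quot_alg n I)"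
  proof (rule subalgebra.intro[OF sub], unfold_locales)
    fix k v assume "k \<in> scalars n I" "v \<in> graded_part n I i"
    then obtain c p where "k = coset (cst c)" "v = coset p" "p \<in> forms n i"
      by (auto simp: scalars_def graded_part_def)
    then show "k \<otimes>\<^bsub>quot_alg n I\<^esub> v \<in> graded_part n I i"
      by (auto simp: coset_mult forms_carrier graded_part_def)
  qed
  then have "Q.finite_dimension (scalars n I) (graded_part n I i)"
    using Q.subalbegra_incl_imp_finite_dimension[OF scalars_subfield finite_dimension]
      subgroup.subset[OF sub] by simp
  then have "Q.dimension (hilbert_function n I i) (scalars n I) (graded_part n I i)"
    using Q.finite_dimensionE[OF scalars_subfield] by (simp add: hilbert_function_def over_def)
  then show ?thesis using that unfolding dimension_graded_part_iff by blast
qed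

lemma hilbert_function_eqI:
  assumes "\<And>j. j < N \<Longrightarrow> b j \<in> forms n i" "independent_mod b N" "spanning_mod (forms n i) b N"
  shows "hilbert_function n I i = N"
proof -
  have "Q.dimension N (scalars n I) (graded_part n I i)"
    unfolding dimension_graded_part_iff using assms by blast
  then show ?thesis
    using Q.dimI[OF scalars_subfield] by (simp add: hilbert_function_def over_def)
qed

lemma hilbert_function_geI:
  assumes "\<And>j. j < N \<Longrightarrow> b j \<in> forms n i" "independent_mod b N"
  shows "N \<le> hilbert_function n I i"
proof -
  obtain b' where b': "\<And>j. j < hilbert_function n I i \<Longrightarrow> b' j \<in> forms n i"
    "spanning_mod (forms n i) b' (hilbert_function n I i)"
    using hilbert_function_basis[of i] by blast
  then show ?thesis
    using independent_length_le[OF b'(2) _ assms(2)] assms(1) forms_carrier by blast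
qed

lemma hilbert_function_leI:
  fixes F :: "nat \<Rightarrow> 'k mpoly \<Rightarrow> 'k"
  assumes lin: "\<And>k (N::nat) b c. k < M \<Longrightarrow> (\<And>j. j < N \<Longrightarrow> b j \<in> forms n i) \<Longrightarrow>
      F k (\<Sum>j<N. cst (c j) * b j) = (\<Sum>j<N. c j * F k (b j))"
    and separating: "\<And>p. p \<in> forms n i \<Longrightarrow> (\<And>k. k < M \<Longrightarrow> F k p = 0) \<Longrightarrow> p \<in> I"
  shows "hilbert_function n I i \<le> M"
proof (rule ccontr)
  let ?N = "hilbert_function n I i"
  assume "\<not> ?N \<le> M"
  then have card: "card {..<M} < card {..<?N}" by simp
  obtain b where b: "\<And>j. j < ?N \<Longrightarrow> b j \<in> forms n i" "independent_mod b ?N"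
    using hilbert_function_basis[of i] by blast
  obtain c where c: "\<exists>j\<in>{..<?N}. c j \<noteq> 0" "\<forall>k\<in>{..<M}. (\<Sum>j<?N. c j * F k (b j)) = 0"
    using underdetermined_system[OF _ _ card, of "\<lambda>j k. F k (b j)"] by auto
  have "(\<Sum>j<?N. cst (c j) * b j) \<in> I"
  proof (rule separating)
    show "(\<Sum>j<?N. cst (c j) * b j) \<in> forms n i" using b(1) by (rule forms_lincomb)
    show "F k (\<Sum>j<?N. cst (c j) * b j) = 0" if "k < M" for k
      using lin[OF that b(1)] c(2) that by simp
  qed
  then show False using b(2) c(1) by (auto simp: independent_mod_def)
qed

lemma hilbert_function_0: "hilbert_function n I 0 = 1"
proof (rule hilbert_function_eqI[of _ "\<lambda>_. 1"])
  show "independent_mod (\<lambda>_. 1) 1"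
    using I_cst_mult_iff[of 1] one_notin by (auto simp: independent_mod_def)
  show "spanning_mod (forms n 0) (\<lambda>_. 1) 1"
    unfolding spanning_mod_def
  proof
    fix p :: "'k mpoly" assume "p \<in> forms n 0"
    then obtain c where "p = cst c" using forms_0_cst by blast
    then show "\<exists>c. p - (\<Sum>j<(1::nat). cst (c j) * 1) \<in> I" by (intro exI[of _ "\<lambda>_. c"]) simp
  qed
qed (use forms_cst[of 1 n] in simp)

end

lemma (in homogeneous_quotient) graded_part_trivial_iff:
  "graded_part n I i = {\<zero>\<^bsub>quot_alg n I\<^esub>} \<longleftrightarrow> forms n i \<subseteq> I"
proof -
  have image_singleton: "f ` A = {z} \<longleftrightarrow> (\<forall>x\<in>A. f x = z)" if "A \<noteq> {}" for f :: "'k mpoly \<Rightarrow> 'k mpoly set" and A z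
    using that by blast
  have "graded_part n I i = {\<zero>\<^bsub>quot_alg n I\<^esub>} \<longleftrightarrow> (\<forall>p\<in>forms n i. coset p = \<zero>\<^bsub>quot_alg n I\<^esub>)"
    unfolding graded_part_def using forms_zero[of n i] by (intro image_singleton) blast
  also have "\<dots> \<longleftrightarrow> (\<forall>p\<in>forms n i. p \<in> I)"
    by (intro ball_cong refl coset_eq_zero_iff forms_carrier)
  finally show ?thesis by blast
qed

text \<open>
  Forms of positive degree are sums of products of a variable and a form of one degree less.
\<close>

lemma form_induct_step:
  fixes p :: "'k::comm_ring_1 mpoly"
  assumes p: "p \<in> forms n (Suc i)"
    and sum: "\<And>f (J :: (nat \<Rightarrow>\<^sub>0 nat) set). finite J \<Longrightarrow> (\<And>j. j \<in> J \<Longrightarrow> P (f j)) \<Longrightarrow> P (\<Sum>j\<in>J. f j)"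
    and step: "\<And>j q. j < n \<Longrightarrow> q \<in> forms n i \<Longrightarrow> P (indet j * q)"
  shows "P p"
proof -
  have "P (Poly_Mapping.single m (Poly_Mapping.lookup p m))" if m: "m \<in> Poly_Mapping.keys p" for m
  proof -
    obtain j m' where jm: "j \<in> Poly_Mapping.keys m" "m = Poly_Mapping.single j 1 + m'"
      "mon_degree m' = i" "Poly_Mapping.keys m' \<subseteq> Poly_Mapping.keys m"
      using mon_degree_Suc_split forms_degree[OF p m] by blast
    have "Poly_Mapping.keys m \<subseteq> {..<n}" using forms_carrier[OF p] m by (simp add: mem_carrier_iff)
    then have "P (indet j * Poly_Mapping.single m' (Poly_Mapping.lookup p m))"
      using jm by (intro step forms_monomial) auto
    moreover have "indet j * Poly_Mapping.single m' (Poly_Mapping.lookup p m) = Poly_Mapping.single m (Poly_Mapping.lookup p m)"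
      unfolding mult_single jm(2)[symmetric] by simp
    ultimately show ?thesis by simp
  qed
  then have "P (\<Sum>m\<in>Poly_Mapping.keys p. Poly_Mapping.single m (Poly_Mapping.lookup p m))"
    by (intro sum) auto
  then show ?thesis by (simp add: poly_mapping_sum_monomials[symmetric])
qed

context homogeneous_quotient
begin

lemma forms_Suc_subset:
  assumes "forms n i \<subseteq> I" shows "forms n (Suc i) \<subseteq> I"
proof
  fix p :: "'k mpoly" assume "p \<in> forms n (Suc i)"
  then show "p \<in> I"
    by (rule form_induct_step[where P = "\<lambda>p. p \<in> I"])
      (use assms in \<open>auto intro: forms_carrier[OF forms_indet[unfolded One_nat_def]]\<close>)
qed

lemma forms_subset_mono: "i \<le> j \<Longrightarrow> forms n i \<subseteq> I \<Longrightarrow> forms n j \<subseteq> I"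
  by (induction j rule: dec_induct) (auto dest: forms_Suc_subset)

end

text \<open>
  Nonzero elements of different degrees are independent, so a finite-dimensional graded algebra has
  only finitely many nonzero graded parts. Without this the maximum in the definition of the socle
  degree would say nothing.
\<close>

lemma (in artinian_quotient) forms_eventually_in_ideal: "\<exists>N. forms n N \<subseteq> I"
proof (rule ccontr)
  assume none: "\<not> ?thesis"
  then have "\<forall>i. \<exists>p. p \<in> forms n i \<and> p \<notin> I" by blast
  then obtain f where f: "\<And>i. f i \<in> forms n i" "\<And>i. f i \<notin> I" by metis
  obtain D where "Q.dimension D (scalars n I) (carrier (quot_alg n I))"
    using finite_dimension by blast
  then obtain b where b: "\<forall>j<D. b j \<in> carrier (mpoly_ring n)" "spanning_mod (carrier (mpoly_ring n)) b D"
    using dimension_iff_basis[of "carrier (mpoly_ring n)" D] sum_carrier by (auto simp: quot_carrier)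
  have "independent_mod f (Suc D)"
    unfolding independent_mod_def
  proof (intro allI impI)
    fix c j assume *: "(\<Sum>i<Suc D. cst (c i) * f i) \<in> I" and j: "j < Suc D"
    have "component j (\<Sum>i<Suc D. cst (c i) * f i) = (\<Sum>i<Suc D. component j (cst (c i) * f i))"
      by (rule component_sum)
    also have "\<dots> = (\<Sum>i<Suc D. if i = j then cst (c i) * f i else 0)"
      using f(1) by (intro sum.cong refl) (subst component_of_form[OF forms_cst_mult], auto)
    also have "\<dots> = cst (c j) * f j" using j by simp
    finally have "cst (c j) * f j \<in> I" using component_in_ideal[OF *, of j] by simp
    then show "c j = 0" using I_cst_mult_iff[OF forms_carrier[OF f(1)]] f(2) by blast
  qed
  then have "Suc D \<le> D"
    using independent_length_le[OF b(2)] b(1) forms_carrier[OF f(1)] by blast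
  then show False by simp
qed

section \<open>Gorenstein algebras\<close>

locale gorenstein_quotient = artinian_quotient n I for n and I :: "'k::field mpoly set" +
  assumes socle_dimension: "Q.dimension 1 (scalars n I) (socle n I)"
    and socle_top: "socle n I \<subseteq> graded_part n I (socle_degree n I)"

lemma artinian_gorenstein_iff: "artinian_gorenstein n I \<longleftrightarrow> gorenstein_quotient n I"
  unfolding artinian_gorenstein_def artinian_graded_def gorenstein_quotient_def
    gorenstein_quotient_axioms_def artinian_quotient_def artinian_quotient_axioms_def
    homogeneous_quotient_def by blast

lemma (in homogeneous_quotient) mem_socle_iff:
  assumes "p \<in> carrier (mpoly_ring n)"
  shows "coset p \<in> socle n I \<longleftrightarrow> (\<forall>i\<ge>1. \<forall>q\<in>forms n i. q * p \<in> I)"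
proof -
  have "coset q \<otimes>\<^bsub>quot_alg n I\<^esub> coset p = \<zero>\<^bsub>quot_alg n I\<^esub> \<longleftrightarrow> q * p \<in> I" if "q \<in> forms n i" for q i
    using that assms coset_mult coset_eq_zero_iff carrier_mult forms_carrier by metis
  then show ?thesis
    using assms by (simp add: socle_def quot_carrier graded_part_def)
qed

lemma (in artinian_quotient) forms_subset_iff: "forms n i \<subseteq> I \<longleftrightarrow> socle_degree n I < i"
proof -
  let ?D = "{i. \<not> forms n i \<subseteq> I}"
  have deg: "socle_degree n I = Max ?D"
    by (simp add: socle_degree_def graded_part_trivial_iff)
  obtain N where "forms n N \<subseteq> I" using forms_eventually_in_ideal by blast
  then have "?D \<subseteq> {..<N}" using forms_subset_mono[of N] by (auto simp: not_less[symmetric])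
  then have fin: "finite ?D" using finite_subset by blast
  have "0 \<in> ?D" using one_notin forms_cst[of 1 n] by auto
  then have "Max ?D \<in> ?D" using fin by (intro Max_in) auto
  then have top: "\<not> forms n (Max ?D) \<subseteq> I" by blast
  have "forms n i \<subseteq> I" if "Max ?D < i"
  proof (rule ccontr)
    assume "\<not> forms n i \<subseteq> I"
    then have "i \<le> Max ?D" using fin by (intro Max_ge) auto
    then show False using that by simp
  qed
  moreover have "Max ?D < i" if "forms n i \<subseteq> I"
    using top forms_subset_mono[OF _ that, of "Max ?D"] by (meson not_le)
  ultimately show ?thesis unfolding deg by blast
qed

context gorenstein_quotient
begin

abbreviation "d \<equiv> socle_degree n I"

text \<open>
  The graded part of top degree always lies in the socle, so the Gorenstein condition forces it to be
  the whole socle, and in particular one-dimensional.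
\<close>

lemma socle_eq: "socle n I = graded_part n I d"
proof (rule subset_antisym[OF socle_top], rule subsetI)
  fix x assume "x \<in> graded_part n I d"
  then obtain p where p: "x = coset p" "p \<in> forms n d" by (auto simp: graded_part_def)
  have "q * p \<in> I" if "i \<ge> 1" "q \<in> forms n i" for q i
    using forms_mult[OF that(2) p(2)] forms_subset_iff[of "i + d"] that(1) by auto
  then show "x \<in> socle n I" using p by (simp add: mem_socle_iff forms_carrier)
qed

lemma top_generator:
  obtains b where "b \<in> forms n d" "b \<notin> I" "\<And>p. p \<in> forms n d \<Longrightarrow> \<exists>c. p - cst c * b \<in> I"
proof -
  obtain b where b: "b 0 \<in> forms n d" "independent_mod b 1" "spanning_mod (forms n d) b 1"
    using socle_dimension unfolding socle_eq dimension_graded_part_iff by auto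
  have "b 0 \<notin> I"
    using b(2)[unfolded independent_mod_def, rule_format, of "\<lambda>_. 1" 0] by auto
  moreover have "\<exists>c. p - cst c * b 0 \<in> I" if p: "p \<in> forms n d" for p
  proof -
    obtain c where "p - (\<Sum>j<(1::nat). cst (c j) * b j) \<in> I"
      using b(3) p unfolding spanning_mod_def by blast
    then show ?thesis by (intro exI[of _ "c 0"]) simp
  qed
  ultimately show ?thesis using that b(1) by blast
qed

lemma hilbert_function_top: "hilbert_function n I d = 1"
proof -
  have "Q.dimension 1 (scalars n I) (graded_part n I d)" using socle_dimension by (simp add: socle_eq)
  then show ?thesis
    using Q.dimI[OF scalars_subfield] by (simp add: hilbert_function_def over_def)
qed

text \<open>
  The functional \<open>\<phi>\<close> is the coordinate on the one-dimensional space \<open>A\<^sub>d\<close>; all pairings below are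
  multiplication followed by \<open>\<phi>\<close>.
\<close>

lemma top_functional:
  obtains \<phi> where "\<And>(N::nat) b c. (\<And>j. j < N \<Longrightarrow> b j \<in> forms n d) \<Longrightarrow>
      \<phi> (\<Sum>j<N. cst (c j) * b j) = (\<Sum>j<N. c j * \<phi> (b j))"
    "\<And>p. p \<in> forms n d \<Longrightarrow> \<phi> p = (0 :: 'k) \<longleftrightarrow> p \<in> I"
proof -
  obtain g where g: "g \<in> forms n d" "g \<notin> I" "\<And>p. p \<in> forms n d \<Longrightarrow> \<exists>c. p - cst c * g \<in> I"
    using top_generator by blast
  have "\<forall>p\<in>forms n d. \<exists>c. p - cst c * g \<in> I" using g(3) by blast
  from bchoice[OF this] obtain \<phi> where \<phi>: "\<And>p. p \<in> forms n d \<Longrightarrow> p - cst (\<phi> p) * g \<in> I"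
    by blast
  have uniq: "c = \<phi> p" if "p \<in> forms n d" "p - cst c * g \<in> I" for p c
  proof -
    have "(p - cst c * g) - (p - cst (\<phi> p) * g) \<in> I" using I_diff[OF that(2) \<phi>[OF that(1)]] .
    then have "cst (\<phi> p - c) * g \<in> I" by (simp add: algebra_simps single_diff)
    then show ?thesis using I_cst_mult_iff[OF forms_carrier[OF g(1)]] g(2) by simp
  qed
  show ?thesis
  proof
    fix N :: nat and b :: "nat \<Rightarrow> 'k mpoly" and c assume b: "\<And>j. j < N \<Longrightarrow> b j \<in> forms n d"
    have "(\<Sum>j<N. cst (c j) * b j) - cst (\<Sum>j<N. c j * \<phi> (b j)) * g
        = (\<Sum>j<N. cst (c j) * (b j - cst (\<phi> (b j)) * g))"
      by (simp add: cst_sum cst_mult sum_distrib_right right_diff_distrib sum_subtractf mult.assoc)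
    also have "\<dots> \<in> I" using b \<phi> by (intro I_sum I_mult) auto
    finally have mem: "(\<Sum>j<N. cst (c j) * b j) - cst (\<Sum>j<N. c j * \<phi> (b j)) * g \<in> I" .
    have "(\<Sum>j<N. cst (c j) * b j) \<in> forms n d" using b by (rule forms_lincomb)
    from uniq[OF this mem] show "\<phi> (\<Sum>j<N. cst (c j) * b j) = (\<Sum>j<N. c j * \<phi> (b j))" by (rule sym)
  next
    fix p :: "'k mpoly" assume p: "p \<in> forms n d"
    show "\<phi> p = 0 \<longleftrightarrow> p \<in> I" using uniq[OF p, of 0] \<phi>[OF p] by auto
  qed
qed

text \<open>
  A nonzero element below the top degree is not in the socle, so it has a nonzero multiple of larger
  degree; iterating this reaches degree \<open>d\<close>.
\<close>

lemma pairing_nondegenerate: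
  assumes "p \<in> forms n i" "p \<notin> I"
  shows "\<exists>q\<in>forms n (d - i). q * p \<notin> I"
  using assms
proof (induction "d - i" arbitrary: i p rule: less_induct)
  case less
  then have "i \<le> d" using forms_subset_iff[of i] by force
  show ?case
  proof (cases "i = d")
    case True
    then show ?thesis using less.prems forms_cst[of 1 n] by (intro bexI[of _ 1]) auto
  next
    case False
    have "coset p \<notin> socle n I"
    proof
      assume "coset p \<in> socle n I"
      then obtain p' where p': "p' \<in> forms n d" "coset p = coset p'"
        unfolding socle_eq graded_part_def by blast
      then have "p - p' \<in> I" using less.prems coset_eq_iff forms_carrier by blast
      then have "component i (p + - p') \<in> I" using component_in_ideal by simp
      moreover have "component i (p + - p') = p"
        using False component_of_form[OF less.prems(1), of i] component_of_form[OF p'(1), of i]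
        by (simp only: component_add component_uminus) simp
      ultimately show False using less.prems(2) by simp
    qed
    then obtain j b where b: "j \<ge> 1" "b \<in> forms n j" "b * p \<notin> I"
      using mem_socle_iff forms_carrier less.prems(1) by blast
    have bp: "b * p \<in> forms n (i + j)" using b less.prems by (auto intro: forms_mult_eq)
    then have "i + j \<le> d" using b(3) forms_subset_iff[of "i + j"] by force
    then obtain q where q: "q \<in> forms n (d - (i + j))" "q * (b * p) \<notin> I"
      using less.hyps[of "i + j" "b * p"] bp b \<open>i \<le> d\<close> by fastforce
    then show ?thesis
      using b \<open>i + j \<le> d\<close> by (intro bexI[of _ "q * b"]) (auto simp: mult.assoc intro: forms_mult_eq)
  qed
qed

text \<open>
  A basis of \<open>A\<^sub>d\<^sub>-\<^sub>i\<close> yields, by the nondegenerate pairing, as many functionals separating \<open>A\<^sub>i\<close>.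
\<close>

lemma hilbert_function_symmetric:
  assumes "i \<le> d"
  shows "hilbert_function n I (d - i) = hilbert_function n I i"
proof -
  obtain \<phi> where lin: "\<And>(N::nat) b c. (\<And>j. j < N \<Longrightarrow> b j \<in> forms n d) \<Longrightarrow>
      \<phi> (\<Sum>j<N. cst (c j) * b j) = (\<Sum>j<N. c j * \<phi> (b j))"
    and zero: "\<And>p. p \<in> forms n d \<Longrightarrow> \<phi> p = (0 :: 'k) \<longleftrightarrow> p \<in> I"
    using top_functional by blast
  have le: "hilbert_function n I i \<le> hilbert_function n I (d - i)" if i: "i \<le> d" for i
  proof -
    let ?M = "hilbert_function n I (d - i)"
    obtain b where b: "\<And>j. j < ?M \<Longrightarrow> b j \<in> forms n (d - i)"
      "spanning_mod (forms n (d - i)) b ?M"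
      using hilbert_function_basis[of "d - i"] by blast
    show ?thesis
    proof (rule hilbert_function_leI[of _ _ "\<lambda>k p. \<phi> (p * b k)"])
      fix k and N :: nat and b' :: "nat \<Rightarrow> 'k mpoly" and c
      assume "k < ?M" and b': "\<And>j. j < N \<Longrightarrow> b' j \<in> forms n i"
      then have "b' j * b k \<in> forms n d" if "j < N" for j
        using b(1) i that by (intro forms_mult_eq) auto
      from lin[OF this, of N "\<lambda>j. j" c]
      show "\<phi> ((\<Sum>j<N. cst (c j) * b' j) * b k) = (\<Sum>j<N. c j * \<phi> (b' j * b k))"
        by (simp add: sum_distrib_right mult.assoc)
    next
      fix p :: "'k mpoly" assume p: "p \<in> forms n i" "\<And>k. k < ?M \<Longrightarrow> \<phi> (p * b k) = 0"
      have pb: "p * b k \<in> I" if "k < ?M" for k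
        using p(2)[OF that] zero[OF forms_mult_eq[OF p(1) b(1)[OF that]]] i by simp
      show "p \<in> I"
      proof (rule ccontr)
        assume "p \<notin> I"
        then obtain q where q: "q \<in> forms n (d - i)" "q * p \<notin> I"
          using pairing_nondegenerate p(1) by blast
        obtain c where c: "q - (\<Sum>j<?M. cst (c j) * b j) \<in> I"
          using q(1) b(2) unfolding spanning_mod_def by blast
        have "q * p = p * (q - (\<Sum>j<?M. cst (c j) * b j)) + (\<Sum>j<?M. cst (c j) * (p * b j))"
          by (simp add: algebra_simps sum_distrib_left)
        also have "\<dots> \<in> I"
        proof (intro I_add I_sum)
          show "p * (q - (\<Sum>j<?M. cst (c j) * b j)) \<in> I" using c p(1) forms_carrier by auto
          show "cst (c j) * (p * b j) \<in> I" if "j \<in> {..<?M}" for j using pb that by auto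
        qed
        finally show False using q(2) by simp
      qed
    qed
  qed
  show ?thesis using le[of i] le[of "d - i"] assms by simp
qed

end

section \<open>The weak Lefschetz property\<close>

context homogeneous_quotient
begin

definition injective_at :: "'k mpoly \<Rightarrow> nat \<Rightarrow> bool" where
  "injective_at l i \<longleftrightarrow> (\<forall>a\<in>forms n i. l * a \<in> I \<longrightarrow> a \<in> I)"

definition surjective_at :: "'k mpoly \<Rightarrow> nat \<Rightarrow> bool" where
  "surjective_at l i \<longleftrightarrow> (\<forall>p\<in>forms n (Suc i). \<exists>a\<in>forms n i. p - l * a \<in> I)"

lemma weak_lefschetz_iff:
  "weak_lefschetz n I \<longleftrightarrow> (\<exists>l\<in>forms n 1. \<forall>i. injective_at l i \<or> surjective_at l i)"
proof -
  have inj: "inj_on (\<lambda>a. coset l \<otimes>\<^bsub>quot_alg n I\<^esub> a) (graded_part n I i) \<longleftrightarrow> injective_at l i"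
    if l: "l \<in> forms n 1" for l i
  proof
    assume inj: "inj_on (\<lambda>a. coset l \<otimes>\<^bsub>quot_alg n I\<^esub> a) (graded_part n I i)"
    show "injective_at l i"
      unfolding injective_at_def
    proof (intro ballI impI)
      fix a :: "'k mpoly" assume a: "a \<in> forms n i" "l * a \<in> I"
      have carr: "l \<in> carrier (mpoly_ring n)" "a \<in> carrier (mpoly_ring n)"
        using l a(1) by (auto intro: forms_carrier)
      have "coset (l * a) = coset (l * 0)"
        using a(2) carr by (subst coset_eq_iff) auto
      then have "coset l \<otimes>\<^bsub>quot_alg n I\<^esub> coset a = coset l \<otimes>\<^bsub>quot_alg n I\<^esub> coset 0"
        using carr by (simp only: coset_mult carrier_zero)
      moreover have "coset a \<in> graded_part n I i" "coset 0 \<in> graded_part n I i"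
        unfolding graded_part_def using a(1) by (simp_all only: imageI forms_zero)
      ultimately have "coset a = coset 0" by (rule inj_onD[OF inj])
      then show "a \<in> I" using coset_eq_iff[of a 0] carr by simp
    qed
  next
    assume inj: "injective_at l i"
    show "inj_on (\<lambda>a. coset l \<otimes>\<^bsub>quot_alg n I\<^esub> a) (graded_part n I i)"
    proof (rule inj_onI)
      fix x y assume xy: "x \<in> graded_part n I i" "y \<in> graded_part n I i"
        and eq: "coset l \<otimes>\<^bsub>quot_alg n I\<^esub> x = coset l \<otimes>\<^bsub>quot_alg n I\<^esub> y"
      then obtain a b where ab: "a \<in> forms n i" "b \<in> forms n i" "x = coset a" "y = coset b"
        by (auto simp: graded_part_def)
      then have "l * a - l * b \<in> I"
        using eq l coset_eq_iff[of "l * a" "l * b"] by (simp add: coset_mult forms_carrier carrier_mult)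
      then have "l * (a - b) \<in> I" by (simp add: right_diff_distrib)
      then have "a - b \<in> I" using inj ab by (auto simp: injective_at_def)
      then show "x = y" using ab by (simp add: coset_eq_iff forms_carrier)
    qed
  qed
  have surj: "(\<lambda>a. coset l \<otimes>\<^bsub>quot_alg n I\<^esub> a) ` graded_part n I i = graded_part n I (Suc i) \<longleftrightarrow> surjective_at l i"
    if l: "l \<in> forms n 1" for l i
  proof -
    have la: "l * a \<in> forms n (Suc i)" if "a \<in> forms n i" for a
      using l that by (intro forms_mult_eq) auto
    have "(\<lambda>a. coset l \<otimes>\<^bsub>quot_alg n I\<^esub> a) ` graded_part n I i = (\<lambda>a. coset (l * a)) ` forms n i"
      unfolding graded_part_def image_image using l by (intro image_cong refl) (simp add: coset_mult forms_carrier)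
    moreover have "(\<lambda>a. coset (l * a)) ` forms n i \<subseteq> graded_part n I (Suc i)"
      using la by (auto simp: graded_part_def)
    moreover have "A = f ` B \<longleftrightarrow> (\<forall>p\<in>B. f p \<in> A)" if "A \<subseteq> f ` B"
      for A and B and f :: "'k mpoly \<Rightarrow> 'k mpoly set"
      using that by blast
    ultimately have "(\<lambda>a. coset l \<otimes>\<^bsub>quot_alg n I\<^esub> a) ` graded_part n I i = graded_part n I (Suc i) \<longleftrightarrow>
        (\<forall>p\<in>forms n (Suc i). coset p \<in> (\<lambda>a. coset (l * a)) ` forms n i)"
      unfolding graded_part_def[of n I "Suc i"] by simp
    also have "\<dots> \<longleftrightarrow> (\<forall>p\<in>forms n (Suc i). \<exists>a\<in>forms n i. coset p = coset (l * a))"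
      by (simp only: image_iff)
    also have "\<dots> \<longleftrightarrow> surjective_at l i"
      unfolding surjective_at_def
      by (intro ball_cong bex_cong refl coset_eq_iff) (auto intro: forms_carrier la)
    finally show ?thesis .
  qed
  have "weak_lefschetz n I \<longleftrightarrow> (\<exists>l\<in>forms n 1. \<forall>i.
      inj_on (\<lambda>a. coset l \<otimes>\<^bsub>quot_alg n I\<^esub> a) (graded_part n I i) \<or>
      (\<lambda>a. coset l \<otimes>\<^bsub>quot_alg n I\<^esub> a) ` graded_part n I i = graded_part n I (Suc i))"
    unfolding weak_lefschetz_def graded_part_def[of n I 1] by (simp only: bex_simps)
  also have "\<dots> \<longleftrightarrow> (\<exists>l\<in>forms n 1. \<forall>i. injective_at l i \<or> surjective_at l i)"
    by (intro bex_cong refl) (simp only: inj surj)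
  finally show ?thesis .
qed

end

context gorenstein_quotient
begin

lemma exists_indet_mult_notin:
  assumes a: "a \<in> forms n i" "a \<notin> I" and i: "i < d"
  shows "\<exists>j<n. indet j * a \<notin> I"
proof (rule ccontr)
  assume none: "\<not> ?thesis"
  obtain q where q: "q \<in> forms n (d - i)" "q * a \<notin> I" using pairing_nondegenerate a by blast
  have "q * a \<in> I"
  proof (rule form_induct_step[where P = "\<lambda>q. q * a \<in> I"])
    show "q \<in> forms n (Suc (d - i - 1))" using q(1) i by (simp add: Suc_diff_Suc)
    show "(\<Sum>j\<in>J. f j) * a \<in> I" if "\<And>j. j \<in> J \<Longrightarrow> f j * a \<in> I"
      for f :: "_ \<Rightarrow> 'k mpoly" and J :: "(nat \<Rightarrow>\<^sub>0 nat) set"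
      using that by (simp add: sum_distrib_right I_sum)
    show "indet j * r * a \<in> I" if "j < n" "r \<in> forms n (d - i - 1)" for j and r :: "'k mpoly"
    proof -
      have "r * (indet j * a) \<in> I" using that none by (blast intro: forms_carrier)
      then show ?thesis by (simp add: ac_simps)
    qed
  qed
  then show False using q(2) by blast
qed

text \<open>
  If \<open>l\<close> kills \<open>a\<close> it kills all multiples of \<open>a\<close>, and below the top degree some multiple of \<open>a\<close> by a
  variable is again nonzero.
\<close>

lemma injective_at_mono:
  assumes l: "l \<in> forms n 1" and "injective_at l e" "i \<le> e" "e \<le> d"
  shows "injective_at l i"
  using assms(3,2,4)
proof (induction e rule: dec_induct)
  case (step e)
  have "injective_at l e"
    unfolding injective_at_def
  proof (intro ballI impI)
    fix a :: "'k mpoly" assume a: "a \<in> forms n e" "l * a \<in> I"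
    show "a \<in> I"
    proof (rule ccontr)
      assume "a \<notin> I"
      then obtain j where j: "j < n" "indet j * a \<notin> I"
        using exists_indet_mult_notin[OF a(1)] Suc_le_lessD[OF step.prems(2)] by blast
      have "indet j * (l * a) \<in> I" using a(2) forms_carrier[OF forms_indet[OF j(1)]] by blast
      then have "l * (indet j * a) \<in> I" by (simp add: ac_simps)
      moreover have "indet j * a \<in> forms n (Suc e)"
        using j(1) a(1) by (intro forms_mult_eq[OF forms_indet]) auto
      ultimately show False using step.prems(1) j(2) by (auto simp: injective_at_def)
    qed
  qed
  then show ?case using step by simp
qed

text \<open>
  Multiplication by \<open>l\<close> from degree \<open>i\<close> is adjoint to multiplication by \<open>l\<close> from degree \<open>d - i - 1\<close>.
  Solving \<open>p = l a\<close> amounts to prescribing the values of \<open>\<phi> (l a b)\<close> on a basis of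
  \<open>A\<^sub>d\<^sub>-\<^sub>i\<^sub>-\<^sub>1\<close>.
\<close>

lemma surjective_at_dual:
  assumes l: "l \<in> forms n 1" and i: "i < d" and inj: "injective_at l (d - Suc i)"
  shows "surjective_at l i"
  unfolding surjective_at_def
proof
  fix p :: "'k mpoly" assume p: "p \<in> forms n (Suc i)"
  obtain \<phi> where lin: "\<And>(N::nat) b c. (\<And>j. j < N \<Longrightarrow> b j \<in> forms n d) \<Longrightarrow>
      \<phi> (\<Sum>j<N. cst (c j) * b j) = (\<Sum>j<N. c j * \<phi> (b j))"
    and zero: "\<And>p. p \<in> forms n d \<Longrightarrow> \<phi> p = (0 :: 'k) \<longleftrightarrow> p \<in> I"
    using top_functional by blast
  let ?N = "hilbert_function n I i" and ?M = "hilbert_function n I (d - Suc i)"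
  obtain u where u: "\<And>j. j < ?N \<Longrightarrow> u j \<in> forms n i" "spanning_mod (forms n i) u ?N"
    using hilbert_function_basis[of i] by blast
  obtain b where b: "\<And>j. j < ?M \<Longrightarrow> b j \<in> forms n (d - Suc i)" "independent_mod b ?M"
      "spanning_mod (forms n (d - Suc i)) b ?M"
    using hilbert_function_basis[of "d - Suc i"] by blast
  have lu: "l * u j \<in> forms n (Suc i)" if "j < ?N" for j
    using l u(1)[OF that] by (intro forms_mult_eq) auto
  have top: "r * q \<in> forms n d" if "r \<in> forms n (Suc i)" "q \<in> forms n (d - Suc i)" for r q :: "'k mpoly"
    using that i by (intro forms_mult_eq) auto
  have lin_right: "\<phi> (r * (\<Sum>k<?M. cst (c k) * b k)) = (\<Sum>k<?M. \<phi> (r * b k) * c k)"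
    if r: "r \<in> forms n (Suc i)" for r c
  proof -
    have "r * (\<Sum>k<?M. cst (c k) * b k) = (\<Sum>k<?M. cst (c k) * (r * b k))"
      by (simp add: sum_distrib_left ac_simps)
    then show ?thesis using lin[of ?M "\<lambda>k. r * b k" c] top[OF r b(1)] by (simp add: mult.commute)
  qed
  \<comment> \<open>An obstruction to solving for a preimage would be an element killed by \<open>l\<close>.\<close>
  consider (sol) a where "\<forall>k\<in>{..<?M}. (\<Sum>j<?N. a j * \<phi> (l * u j * b k)) = \<phi> (p * b k)"
    | (obs) c where "\<forall>j\<in>{..<?N}. (\<Sum>k<?M. \<phi> (l * u j * b k) * c k) = 0"
        "(\<Sum>k<?M. \<phi> (p * b k) * c k) \<noteq> 0"
    using fredholm_alternative[of "{..<?N}" "{..<?M}" "\<lambda>j k. \<phi> (l * u j * b k)" "\<lambda>k. \<phi> (p * b k)"]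
    by auto
  then show "\<exists>a\<in>forms n i. p - l * a \<in> I"
  proof cases
    case obs
    define q where "q = (\<Sum>k<?M. cst (c k) * b k)"
    have q: "q \<in> forms n (d - Suc i)" unfolding q_def using b(1) by (rule forms_lincomb)
    have luq: "u j * (l * q) \<in> I" if j: "j < ?N" for j
    proof -
      have "\<phi> (l * u j * q) = 0"
        unfolding q_def lin_right[OF lu[OF j]] using obs(1) j by simp
      then have "l * u j * q \<in> I" using zero[OF top[OF lu[OF j] q]] by simp
      then show ?thesis by (simp add: ac_simps)
    qed
    have lq: "l * q \<in> forms n (d - i)" using l q i by (intro forms_mult_eq) auto
    have "l * q \<in> I"
    proof (rule ccontr)
      assume "l * q \<notin> I"
      then obtain r where r: "r \<in> forms n (d - (d - i))" "r * (l * q) \<notin> I"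
        using pairing_nondegenerate lq by blast
      then have "r \<in> forms n i" using i by simp
      then obtain c' where c': "r - (\<Sum>j<?N. cst (c' j) * u j) \<in> I"
        using u(2) unfolding spanning_mod_def by blast
      have "r * (l * q) = (l * q) * (r - (\<Sum>j<?N. cst (c' j) * u j)) + (\<Sum>j<?N. cst (c' j) * (u j * (l * q)))"
        by (simp add: algebra_simps sum_distrib_left)
      also have "\<dots> \<in> I"
      proof (intro I_add I_sum)
        show "(l * q) * (r - (\<Sum>j<?N. cst (c' j) * u j)) \<in> I" using c' lq forms_carrier by blast
        show "cst (c' j) * (u j * (l * q)) \<in> I" if "j \<in> {..<?N}" for j using luq that by auto
      qed
      finally show False using r(2) by simp
    qed
    then have "q \<in> I" using inj q by (auto simp: injective_at_def)
    then have "p * q \<in> I" using p forms_carrier by blast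
    then have "(\<Sum>k<?M. \<phi> (p * b k) * c k) = 0"
      using zero[OF top[OF p q]] lin_right[OF p, of c] by (simp add: q_def)
    then show ?thesis using obs(2) by simp
  next
    case sol
    define a' where "a' = (\<Sum>j<?N. cst (a j) * u j)"
    have a': "a' \<in> forms n i" unfolding a'_def using u(1) by (rule forms_lincomb)
    have la': "l * a' \<in> forms n (Suc i)" using l a' by (intro forms_mult_eq) auto
    have pb: "b k * (p - l * a') \<in> I" if k: "k < ?M" for k
    proof -
      have "l * a' * b k = (\<Sum>j<?N. cst (a j) * (l * u j * b k))"
        by (simp add: a'_def sum_distrib_left sum_distrib_right ac_simps)
      moreover have "\<phi> \<dots> = (\<Sum>j<?N. a j * \<phi> (l * u j * b k))"
        using top[OF lu b(1)[OF k]] by (intro lin)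
      ultimately have eq: "\<phi> (l * a' * b k) = \<phi> (p * b k)" using sol k by simp
      have "\<phi> (\<Sum>j<(2::nat). cst (if j = 0 then 1 else -1) * (if j = 0 then p * b k else l * a' * b k)) = 0"
        using eq top[OF p b(1)[OF k]] top[OF la' b(1)[OF k]] by (subst lin) (auto simp: numeral_2_eq_2)
      then have "\<phi> (p * b k - l * a' * b k) = 0" by (simp add: numeral_2_eq_2 single_uminus)
      moreover have "p * b k - l * a' * b k \<in> forms n d"
        using top[OF p b(1)[OF k]] top[OF la' b(1)[OF k]] by blast
      ultimately have "p * b k - l * a' * b k \<in> I" using zero by blast
      then show ?thesis by (simp add: algebra_simps)
    qed
    have "p - l * a' \<in> I"
    proof (rule ccontr)
      assume "p - l * a' \<notin> I"
      then obtain q where q: "q \<in> forms n (d - Suc i)" "q * (p - l * a') \<notin> I"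
        using pairing_nondegenerate p la' by blast
      then obtain c where c: "q - (\<Sum>k<?M. cst (c k) * b k) \<in> I"
        using b(3) unfolding spanning_mod_def by blast
      have "q * (p - l * a') = (p - l * a') * (q - (\<Sum>k<?M. cst (c k) * b k)) + (\<Sum>k<?M. cst (c k) * (b k * (p - l * a')))"
        by (simp add: algebra_simps sum_distrib_left sum_subtractf)
      also have "\<dots> \<in> I"
      proof (intro I_add I_sum)
        show "(p - l * a') * (q - (\<Sum>k<?M. cst (c k) * b k)) \<in> I"
          using c p la' forms_carrier by blast
        show "cst (c k) * (b k * (p - l * a')) \<in> I" if "k \<in> {..<?M}" for k using pb that by auto
      qed
      finally show False using q(2) by simp
    qed
    then show ?thesis using a' by blast
  qed
qed

text \<open>
  The other half of the adjunction: if every \<open>q\<close> of degree \<open>i + 1\<close> is a multiple of \<open>l\<close>, then an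
  element killed by \<open>l\<close> pairs to zero with all of them.
\<close>

lemma injective_at_of_surjective:
  assumes l: "l \<in> forms n 1" and surj: "surjective_at l i" and i: "i < d"
  shows "injective_at l (d - Suc i)"
  unfolding injective_at_def
proof (intro ballI impI, rule ccontr)
  fix a assume a: "a \<in> forms n (d - Suc i)" "l * a \<in> I" "a \<notin> I"
  then obtain q where q: "q \<in> forms n (d - (d - Suc i))" "q * a \<notin> I"
    using pairing_nondegenerate by blast
  then have "q \<in> forms n (Suc i)" using i by simp
  then obtain b where b: "b \<in> forms n i" "q - l * b \<in> I"
    using surj unfolding surjective_at_def by blast
  have "q * a = a * (q - l * b) + b * (l * a)" by (simp add: algebra_simps)
  also have "\<dots> \<in> I"
    using I_mult[OF forms_carrier[OF a(1)] b(2)] I_mult[OF forms_carrier[OF b(1)] a(2)] by (rule I_add)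
  finally show False using q(2) by blast
qed

text \<open>
  The bound \<open>d \<le> 2 * e + 2\<close> makes the degrees up to \<open>e\<close> and the degrees dual to them cover
  everything.
\<close>

lemma weak_lefschetzI:
  assumes l: "l \<in> forms n 1" and inj: "injective_at l e" and e: "e \<le> d" "d \<le> 2 * e + 2"
  shows "weak_lefschetz n I"
  unfolding weak_lefschetz_iff
proof (intro bexI[OF _ l] allI)
  fix i
  show "injective_at l i \<or> surjective_at l i"
  proof (cases "i \<le> e")
    case True
    then show ?thesis using injective_at_mono[OF l inj _ e(1)] by blast
  next
    case False
    show ?thesis
    proof (cases "i < d")
      case True
      have "injective_at l (d - Suc i)"
        using False e by (intro injective_at_mono[OF l inj]) auto
      then show ?thesis using surjective_at_dual[OF l True] by blast
    next
      case False
      then have "p - l * 0 \<in> I" if "p \<in> forms n (Suc i)" for p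
        using forms_subset_iff[of "Suc i"] that by auto
      then show ?thesis unfolding surjective_at_def by blast
    qed
  qed
qed

end

section \<open>Zero divisors along a pencil of linear forms\<close>

context homogeneous_quotient
begin

text \<open>
  Where \<open>l - s x\<close> acts as zero, \<open>l\<close> acts as \<open>s x\<close>.
\<close>

lemma pencil_power:
  assumes l: "l \<in> carrier (mpoly_ring n)" and x: "x \<in> carrier (mpoly_ring n)"
    and a: "a \<in> carrier (mpoly_ring n)" and la: "(l - cst s * x) * a \<in> I"
    and b: "b \<in> carrier (mpoly_ring n)"
  shows "l ^ i * b * a - cst (s ^ i) * x ^ i * b * a \<in> I"
proof (induction i)
  case (Suc i)
  have pow: "x ^ i \<in> carrier (mpoly_ring n)"
    using x by (induction i) auto
  have "l ^ Suc i * b * a - cst (s ^ Suc i) * x ^ Suc i * b * a =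
      l * (l ^ i * b * a - cst (s ^ i) * x ^ i * b * a) + (cst (s ^ i) * x ^ i * b) * ((l - cst s * x) * a)"
    by (simp add: algebra_simps cst_mult)
  also have "\<dots> \<in> I"
    using Suc l x a b la pow by (intro I_add I_mult[of l] I_mult[of "cst (s ^ i) * x ^ i * b"]) auto
  finally show ?case .
qed simp

lemma pencil_prod:
  assumes l: "l \<in> carrier (mpoly_ring n)" and x: "x \<in> carrier (mpoly_ring n)"
    and a: "a \<in> carrier (mpoly_ring n)" and la: "(l + cst s * x) * a \<in> I"
    and b: "b \<in> carrier (mpoly_ring n)" and J: "finite J"
  shows "(\<Prod>k\<in>J. l + cst (t k) * x) * b * a - cst (\<Prod>k\<in>J. t k - s) * x ^ card J * b * a \<in> I"
  using J
proof (induction J rule: finite_induct)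
  case (insert k J)
  have pow: "x ^ i \<in> carrier (mpoly_ring n)" for i
    using x by (induction i) auto
  let ?P = "\<Prod>k\<in>J. l + cst (t k) * x" and ?c = "\<Prod>k\<in>J. t k - s" and ?i = "card J"
  have "(\<Prod>k\<in>insert k J. l + cst (t k) * x) * b * a - cst (\<Prod>k\<in>insert k J. t k - s) * x ^ card (insert k J) * b * a =
      (l + cst (t k) * x) * (?P * b * a - cst ?c * x ^ ?i * b * a) + (cst ?c * x ^ ?i * b) * ((l + cst s * x) * a)"
    using insert(1,2) by (simp add: algebra_simps cst_mult single_diff)
  also have "\<dots> \<in> I"
    using insert l x a b la pow
    by (intro I_add I_mult[of "l + cst (t k) * x"] I_mult[of "cst ?c * x ^ ?i * b"]) auto
  finally show ?case .
qed simp

text \<open>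
  Both \<open>l + s x\<close> and \<open>l + s' x\<close> kill \<open>a a'\<close>, hence so does their difference, a multiple of \<open>x\<close>.
\<close>

lemma pencil_product_vanishes:
  assumes "l \<in> carrier (mpoly_ring n)" "x \<in> carrier (mpoly_ring n)"
    and "a \<in> carrier (mpoly_ring n)" "a' \<in> carrier (mpoly_ring n)"
    and "(l + cst s * x) * a \<in> I" "(l + cst s' * x) * a' \<in> I" "s \<noteq> s'"
  shows "x * (a * a') \<in> I"
proof -
  have "cst (s - s') * (x * (a * a')) = a' * ((l + cst s * x) * a) - a * ((l + cst s' * x) * a')"
    by (simp add: algebra_simps single_diff)
  also have "\<dots> \<in> I" using I_mult[OF assms(4,5)] I_mult[OF assms(3,6)] by (rule I_diff)
  finally show ?thesis using assms I_cst_mult_iff[of "x * (a * a')" "s - s'"] by auto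
qed

text \<open>
  Given a relation \<open>Z + q = 0\<close>, with \<open>Z\<close> the part in the \<open>x\<^sup>u a\<^sub>k\<close> for \<open>k < M\<close> and \<open>q\<close> a binary form of
  degree \<open>e + u\<close> in \<open>l\<close> and \<open>x\<close>, multiply it by \<open>x\<^sup>m\<^sup>-\<^sup>e\<^sup>-\<^sup>u a\<^sub>k\<close> for one of the \<open>e + u + 1\<close> remaining indices
  \<open>k \<ge> M\<close>. The part \<open>Z\<close> disappears, because \<open>e < m\<close> leaves a factor \<open>x\<close> next to each product of two
  of the \<open>a\<close>s, and \<open>q\<close> becomes its value at \<open>- t\<^sub>k\<close> times \<open>x\<^sup>m a\<^sub>k \<noteq> 0\<close>. So \<open>q\<close> has more roots than
  its degree allows. Multiplying \<open>Z\<close> by all but one of the forms \<open>l + t\<^sub>k x\<close> with \<open>k < M\<close> then isolates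
  each of its coefficients.
\<close>

lemma pencil_independent:
  assumes l: "l \<in> forms n 1" and x: "x \<in> forms n 1"
    and a: "\<And>k. k < e + m + 2 \<Longrightarrow> a k \<in> forms n e"
    and la: "\<And>k. k < e + m + 2 \<Longrightarrow> (l + cst (t k) * x) * a k \<in> I"
    and xa: "\<And>k. k < e + m + 2 \<Longrightarrow> x ^ m * a k \<notin> I"
    and t: "inj_on t {..<e + m + 2}"
    and e: "e < m" and u: "e + u \<le> m"
  defines "M \<equiv> m - u + 1"
  shows "independent_mod (\<lambda>k. if k < M then x ^ u * a k else l ^ (k - M) * x ^ (e + u - (k - M))) (e + m + 2)"
  unfolding independent_mod_def
proof (intro allI impI)
  let ?N = "e + m + 2" and ?j = "e + u"
  let ?y = "\<lambda>k. if k < M then x ^ u * a k else l ^ (k - M) * x ^ (?j - (k - M))"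
  fix c k0 assume rel: "(\<Sum>k<?N. cst (c k) * ?y k) \<in> I" and k0: "k0 < ?N"
  have lc: "l \<in> carrier (mpoly_ring n)" and xc: "x \<in> carrier (mpoly_ring n)"
    using l x by (auto intro: forms_carrier)
  have ac: "a k \<in> carrier (mpoly_ring n)" if "k < ?N" for k using a[OF that] by (rule forms_carrier)
  have xpow: "x ^ i \<in> carrier (mpoly_ring n)" for i
    using forms_power_1[OF x] by (rule forms_carrier)
  have N: "?N = M + Suc ?j" using e u by (simp add: M_def)
  define Z where "Z = (\<Sum>k<M. cst (c k) * (x ^ u * a k))"
  define q where "q = (\<Sum>i\<le>?j. cst (c (M + i)) * (l ^ i * x ^ (?j - i)))"
  have "(\<Sum>k<?N. cst (c k) * ?y k) = (\<Sum>k=0..<M. cst (c k) * ?y k) + (\<Sum>k=M..<M + Suc ?j. cst (c k) * ?y k)"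
    unfolding N lessThan_atLeast0 by (rule sum.atLeastLessThan_concat[symmetric]) auto
  also have "(\<Sum>k=0..<M. cst (c k) * ?y k) = Z"
    by (simp add: Z_def lessThan_atLeast0)
  also have "(\<Sum>k=M..<M + Suc ?j. cst (c k) * ?y k) = q"
    by (subst sum.atLeastLessThan_shift_0) (simp add: q_def lessThan_atLeast0[symmetric] lessThan_Suc_atMost)
  finally have Zq: "Z + q \<in> I" using rel by simp
  \<comment> \<open>Distinct \<open>a\<close>s lie in the kernels of distinct members of the pencil.\<close>
  have x_aa: "x ^ Suc i * (a k * a k') \<in> I" if "k < ?N" "k' < ?N" "k \<noteq> k'" for i k k'
  proof -
    have "t k \<noteq> t k'" using t that by (auto dest: inj_onD)
    then have "x * (a k * a k') \<in> I"
      using pencil_product_vanishes[OF lc xc ac ac la la] that by blast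
    then have "x ^ i * (x * (a k * a k')) \<in> I" using xpow by blast
    then show ?thesis by (simp add: ac_simps)
  qed
  have q_root: "(\<Sum>i\<le>?j. c (M + i) * (- t k) ^ i) = 0" if k: "M \<le> k" "k < ?N" for k
  proof -
    let ?b = "x ^ (m - e - u) * a k"
    have bc: "?b \<in> carrier (mpoly_ring n)" using xpow ac[OF k(2)] by blast
    have "?b * Z = (\<Sum>k'<M. cst (c k') * (x ^ Suc (m - e - 1) * (a k * a k')))"
    proof -
      have "x ^ (m - e - u) * x ^ u = x ^ Suc (m - e - 1)"
      proof -
        have "m - e - u + u = Suc (m - e - 1)" using e u by simp
        then show ?thesis by (simp only: power_add[symmetric])
      qed
      then show ?thesis
        unfolding Z_def sum_distrib_left
        by (intro sum.cong refl) (simp add: ac_simps)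
    qed
    also have "\<dots> \<in> I" using k N by (intro I_sum I_mult x_aa) auto
    finally have "?b * Z \<in> I" .
    moreover have "?b * (Z + q) \<in> I" using bc Zq by blast
    ultimately have bq: "?b * q \<in> I" using I_diff[of "?b * (Z + q)" "?b * Z"] by (simp add: algebra_simps)
    \<comment> \<open>Modulo \<open>I\<close>, \<open>l\<close> acts on \<open>a k\<close> as \<open>- t k * x\<close>.\<close>
    have "?b * q - cst (\<Sum>i\<le>?j. c (M + i) * (- t k) ^ i) * (x ^ m * a k) =
        (\<Sum>i\<le>?j. cst (c (M + i)) * (l ^ i * x ^ (m - i) * a k - cst ((- t k) ^ i) * x ^ i * x ^ (m - i) * a k))"
    proof -
      have "x ^ (m - e - u) * x ^ (?j - i) = x ^ (m - i)" if "i \<le> ?j" for i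
        using that u by (simp only: power_add[symmetric]) simp
      then have t1: "?b * (cst (c (M + i)) * (l ^ i * x ^ (?j - i))) = cst (c (M + i)) * (l ^ i * x ^ (m - i) * a k)"
        if "i \<le> ?j" for i using that by (simp add: ac_simps)
      have t2: "cst (c (M + i) * (- t k) ^ i) * (x ^ m * a k) =
          cst (c (M + i)) * (cst ((- t k) ^ i) * x ^ i * x ^ (m - i) * a k)" if "i \<le> ?j" for i
      proof -
        have "x ^ m = x ^ i * x ^ (m - i)" using that u by (simp only: power_add[symmetric]) simp
        then show ?thesis by (simp add: cst_mult ac_simps)
      qed
      show ?thesis
        unfolding q_def cst_sum sum_distrib_left sum_distrib_right right_diff_distrib sum_subtractf
        by (intro arg_cong2[of _ _ _ _ minus] sum.cong refl) (simp_all only: atMost_iff t1 t2)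
    qed
    also have "\<dots> \<in> I"
    proof (rule I_sum, rule I_mult[OF carrier_cst], rule pencil_power[OF lc xc ac[OF k(2)] _ xpow])
      show "(l - cst (- t k) * x) * a k \<in> I" using la[OF k(2)] by (simp add: single_uminus)
    qed
    finally have "cst (\<Sum>i\<le>?j. c (M + i) * (- t k) ^ i) * (x ^ m * a k) \<in> I"
      using bq I_diff_cong by blast
    then show ?thesis
      using I_cst_mult_iff[OF carrier_mult[OF xpow ac[OF k(2)]]] xa[OF k(2)] by blast
  qed
  have high: "c (M + i) = 0" if "i \<le> ?j" for i
  proof (rule polynomial_zeros_imp_zero[where T = "(\<lambda>k. - t k) ` {M..<?N}" and j = ?j and c = "\<lambda>i. c (M + i)"])
    have "inj_on (\<lambda>k. - t k) {M..<?N}" using t by (auto simp: inj_on_def)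
    then show "?j < card ((\<lambda>k. - t k) ` {M..<?N})" using N by (simp add: card_image)
  qed (use q_root that in auto)
  \<comment> \<open>Only the part in the \<open>a k\<close> with \<open>k < M\<close> is left.\<close>
  then have "q = 0" by (simp add: q_def)
  then have Z: "Z \<in> I" using Zq by simp
  have low: "c k = 0" if k: "k < M" for k
  proof -
    let ?J = "{..<M} - {k}"
    let ?P = "\<Prod>k\<in>?J. l + cst (t k) * x"
    have kN: "k < ?N" using k N by simp
    have Pc: "?P \<in> carrier (mpoly_ring n)"
      using l x by (intro forms_carrier[OF forms_prod_1]) auto
    have PZ: "?P * Z = (\<Sum>k'\<in>?J. ?P * (cst (c k') * (x ^ u * a k'))) + ?P * (cst (c k) * (x ^ u * a k))"
      unfolding sum_distrib_left[symmetric] distrib_left[symmetric]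
      using k by (simp add: Z_def sum.remove[of "{..<M}" k] add.commute)
    have rest: "(\<Sum>k'\<in>?J. ?P * (cst (c k') * (x ^ u * a k'))) \<in> I"
    proof (rule I_sum)
      fix k' assume k': "k' \<in> ?J"
      then have k'N: "k' < ?N" using N by simp
      let ?P' = "\<Prod>k\<in>?J - {k'}. l + cst (t k) * x"
      have "?P' \<in> carrier (mpoly_ring n)"
        using l x by (intro forms_carrier[OF forms_prod_1]) auto
      then have "?P' * cst (c k') * x ^ u \<in> carrier (mpoly_ring n)" using xpow by blast
      from I_mult[OF this la[OF k'N]]
      have "(?P' * cst (c k') * x ^ u) * ((l + cst (t k') * x) * a k') \<in> I" .
      moreover have "?P = (l + cst (t k') * x) * ?P'"
        using k' by (intro prod.remove) auto
      ultimately show "?P * (cst (c k') * (x ^ u * a k')) \<in> I" by (simp add: ac_simps)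
    qed
    have "?P * Z \<in> I" using Pc Z by blast
    from I_diff[OF this rest] have "?P * (cst (c k) * (x ^ u * a k)) \<in> I"
      unfolding PZ by simp
    then have "cst (c k) * (?P * x ^ u * a k) \<in> I" by (simp add: ac_simps)
    moreover have "?P * x ^ u * a k - cst (\<Prod>k'\<in>?J. t k' - t k) * x ^ card ?J * x ^ u * a k \<in> I"
      using pencil_prod[OF lc xc ac[OF kN] la[OF kN] xpow] by blast
    then have "cst (c k) * (?P * x ^ u * a k - cst (\<Prod>k'\<in>?J. t k' - t k) * x ^ card ?J * x ^ u * a k) \<in> I"
      by blast
    then have "cst (c k) * (?P * x ^ u * a k) - cst (c k * (\<Prod>k'\<in>?J. t k' - t k)) * (x ^ (card ?J + u) * a k) \<in> I"
      by (simp add: algebra_simps cst_mult power_add)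
    ultimately have "cst (c k * (\<Prod>k'\<in>?J. t k' - t k)) * (x ^ (card ?J + u) * a k) \<in> I"
      using I_diff_cong by blast
    moreover have "card ?J + u = m" using k u e by (simp add: M_def)
    ultimately have "c k * (\<Prod>k'\<in>?J. t k' - t k) = 0"
      using I_cst_mult_iff[OF carrier_mult[OF xpow ac[OF kN]]] xa[OF kN] by metis
    moreover have "(\<Prod>k'\<in>?J. t k' - t k) \<noteq> 0"
      using t kN N by (auto dest: inj_onD)
    ultimately show ?thesis by simp
  qed
  show "c k0 = 0"
    using low[of k0] high[of "k0 - M"] k0 N by (cases "k0 < M") auto
qed

end

section \<open>Failure of the weak Lefschetz property\<close>

context homogeneous_quotient
begin

text \<open>
  As over a field, each coefficient \<open>v i\<close> is a combination of the values.
\<close>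

lemma vandermonde_mod:
  assumes T: "finite T" "s < card T"
    and v: "\<And>t. t \<in> T \<Longrightarrow> (\<Sum>i\<le>s. cst (t ^ i) * v i) \<in> I" and i: "i \<le> s"
  shows "v i \<in> I"
proof -
  obtain w where w: "\<And>i'. i' \<le> s \<Longrightarrow> (\<Sum>t\<in>T. w t * t ^ i') = (if i' = i then 1 else 0)"
    using vandermonde_dual[OF T i] by blast
  have "(\<Sum>t\<in>T. cst (w t) * (\<Sum>i'\<le>s. cst (t ^ i') * v i')) = (\<Sum>i'\<le>s. cst (\<Sum>t\<in>T. w t * t ^ i') * v i')"
    by (simp add: cst_sum cst_mult sum_distrib_left sum_distrib_right mult.assoc) (rule sum.swap)
  also have "\<dots> = (\<Sum>i'\<le>s. if i' = i then v i else 0)"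
    using w by (intro sum.cong) auto
  also have "\<dots> = v i" using i by simp
  finally show ?thesis using I_sum[of T "\<lambda>t. cst (w t) * (\<Sum>i'\<le>s. cst (t ^ i') * v i')"] v by auto
qed

text \<open>
  Monomials of degree \<open>s\<close> in \<open>r\<close> variables are combinations of \<open>s\<close>-th powers of linear forms with
  coefficients in \<open>{0..m}\<close>, stated through their action on \<open>b\<close>. In the induction on \<open>r\<close>, the
  expansion of \<open>(t Y + y)\<^sup>s\<close> in the last variable \<open>Y\<close>, for enough values of \<open>t\<close>, separates the terms
  \<open>Y\<^sup>i y\<^sup>s\<^sup>-\<^sup>i\<close> up to a binomial coefficient, which characteristic zero makes invertible.
\<close>

lemma polarization:
  assumes char: "\<And>k::nat. k > 0 \<Longrightarrow> (of_nat k :: 'k) \<noteq> 0"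
    and r: "r \<le> n" and s: "s \<le> m" and b: "b \<in> carrier (mpoly_ring n)"
    and pow: "\<And>k :: nat \<Rightarrow> nat. (\<And>j. j < r \<Longrightarrow> k j \<le> m) \<Longrightarrow> (\<Sum>j<r. cst (of_nat (k j)) * indet j) ^ s * b \<in> I"
    and \<mu>: "Poly_Mapping.keys \<mu> \<subseteq> {..<r}" "mon_degree \<mu> = s"
  shows "Poly_Mapping.single \<mu> 1 * b \<in> I"
  using r s b pow \<mu>
proof (induction r arbitrary: s b \<mu>)
  case 0
  then have "\<mu> = 0" by simp
  with 0 show ?case by simp
next
  case (Suc r)
  let ?Y = "indet r :: 'k mpoly"
  define i where "i = Poly_Mapping.lookup \<mu> r"
  define \<nu> where "\<nu> = \<mu> - Poly_Mapping.single r i"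
  have \<mu>: "\<mu> = \<nu> + Poly_Mapping.single r i"
    by (rule poly_mapping_eqI) (auto simp: \<nu>_def i_def lookup_add lookup_minus lookup_single when_def)
  have keys: "Poly_Mapping.keys \<nu> \<subseteq> {..<r}"
  proof
    fix j assume "j \<in> Poly_Mapping.keys \<nu>"
    then have j: "Poly_Mapping.lookup \<mu> j - Poly_Mapping.lookup (Poly_Mapping.single r i) j \<noteq> 0"
      by (simp add: \<nu>_def in_keys_iff lookup_minus)
    then have "j \<in> Poly_Mapping.keys \<mu>" by (simp add: in_keys_iff)
    then have "j < Suc r" using Suc.prems(5) by auto
    moreover have "j \<noteq> r" using j by (auto simp: i_def)
    ultimately show "j \<in> {..<r}" by simp
  qed
  have deg: "mon_degree \<nu> + i = s" using Suc.prems(6) unfolding \<mu> by simp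
  have Yc: "?Y ^ i \<in> carrier (mpoly_ring n)" for i
    using Suc.prems(1) forms_power_1[OF forms_indet, of r n i] by (auto intro: forms_carrier)
  have mono: "Poly_Mapping.single (Poly_Mapping.single r i) 1 = ?Y ^ i" for i
  proof (induction i)
    case (Suc i)
    have "?Y ^ Suc i = ?Y * Poly_Mapping.single (Poly_Mapping.single r i) 1" using Suc by simp
    also have "\<dots> = Poly_Mapping.single (Poly_Mapping.single r (Suc i)) 1"
      by (simp add: mult_single single_add[symmetric])
    finally show ?case by simp
  qed simp
  have "Poly_Mapping.single \<nu> 1 * (?Y ^ i * b) \<in> I"
  proof (rule Suc.IH[of "s - i"])
    show "r \<le> n" "s - i \<le> m" using Suc.prems by auto
    show "?Y ^ i * b \<in> carrier (mpoly_ring n)" using Yc Suc.prems(3) by blast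
    show "Poly_Mapping.keys \<nu> \<subseteq> {..<r}" "mon_degree \<nu> = s - i" using keys deg by auto
    fix k :: "nat \<Rightarrow> nat" assume k: "\<And>j. j < r \<Longrightarrow> k j \<le> m"
    let ?y = "\<Sum>j<r. cst (of_nat (k j)) * indet j :: 'k mpoly"
    have yc: "?y \<in> carrier (mpoly_ring n)"
      using Suc.prems(1) by (intro carrier_sum carrier_mult carrier_cst forms_carrier[OF forms_indet]) simp
    have ypow: "?y ^ j \<in> carrier (mpoly_ring n)" for j using yc by (induction j) auto
    have inj: "inj_on (of_nat :: nat \<Rightarrow> 'k) {..m}"
    proof (rule linorder_inj_onI)
      fix x y :: nat assume "x < y"
      then have "(of_nat (y - x) :: 'k) \<noteq> 0" by (intro char) simp
      then show "(of_nat x :: 'k) \<noteq> of_nat y" using \<open>x < y\<close> by (simp add: of_nat_diff)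
    qed auto
    have "of_nat (s choose i') * (?Y ^ i' * ?y ^ (s - i') * b) \<in> I" if "i' \<le> s" for i'
    proof (rule vandermonde_mod[where T = "of_nat ` {..m}" and s = s and v = "\<lambda>i'. of_nat (s choose i') * (?Y ^ i' * ?y ^ (s - i') * b)"])
      show "s < card ((of_nat :: nat \<Rightarrow> 'k) ` {..m})" using Suc.prems(2) by (simp add: card_image[OF inj])
      fix t :: 'k assume "t \<in> of_nat ` {..m}"
      then obtain t' where t': "t = of_nat t'" "t' \<le> m" by auto
      have "(\<Sum>j<Suc r. cst (of_nat ((k(r := t')) j)) * indet j) ^ s * b \<in> I"
        using k t' by (intro Suc.prems(4)) (auto simp: less_Suc_eq)
      also have "(\<Sum>j<Suc r. cst (of_nat ((k(r := t')) j)) * indet j) = cst t * ?Y + ?y"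
        by (simp add: t')
      also have "(cst t * ?Y + ?y) ^ s * b = (\<Sum>i\<le>s. cst (t ^ i) * (of_nat (s choose i) * (?Y ^ i * ?y ^ (s - i) * b)))"
        by (subst binomial_ring) (simp add: sum_distrib_left sum_distrib_right power_mult_distrib cst_power ac_simps)
      finally show "(\<Sum>i\<le>s. cst (t ^ i) * (of_nat (s choose i) * (?Y ^ i * ?y ^ (s - i) * b))) \<in> I" .
    qed (use that in auto)
    from this[of i] have "cst (of_nat (s choose i)) * (?Y ^ i * ?y ^ (s - i) * b) \<in> I"
      using deg by simp
    moreover have "(of_nat (s choose i) :: 'k) \<noteq> 0" using deg by (intro char) simp
    ultimately have "?Y ^ i * ?y ^ (s - i) * b \<in> I"
      using I_cst_mult_iff[OF carrier_mult[OF carrier_mult[OF Yc ypow] Suc.prems(3)]] by blast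
    then show "?y ^ (s - i) * (?Y ^ i * b) \<in> I" by (simp add: ac_simps)
  qed
  moreover have "Poly_Mapping.single \<mu> 1 = Poly_Mapping.single \<nu> 1 * ?Y ^ i"
    unfolding mono[symmetric] mult_single \<mu> by simp
  ultimately show ?case by (simp add: mult.assoc)
qed

end

text \<open>
  The set \<open>S\<close> does not depend on \<open>a\<close>. This uniformity is what the pigeonhole argument needs.
\<close>

lemma (in gorenstein_quotient) linear_forms_detecting:
  assumes char: "\<And>k::nat. k > 0 \<Longrightarrow> (of_nat k :: 'k) \<noteq> 0"
  obtains S where "finite S" "S \<subseteq> forms n 1"
    "\<And>a. a \<in> forms n e \<Longrightarrow> a \<notin> I \<Longrightarrow> \<exists>x\<in>S. x ^ (d - e) * a \<notin> I"
proof
  let ?lin = "\<lambda>k :: nat \<Rightarrow> nat. \<Sum>j<n. cst (of_nat (k j)) * indet j :: 'k mpoly"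
  let ?S = "?lin ` ({..<n} \<rightarrow>\<^sub>E {..d - e})"
  show "finite ?S" by (intro finite_imageI finite_PiE) auto
  show "?S \<subseteq> forms n 1"
    by (intro image_subsetI forms_sum forms_cst_mult forms_indet) simp
  fix a :: "'k mpoly" assume a: "a \<in> forms n e" "a \<notin> I"
  show "\<exists>x\<in>?S. x ^ (d - e) * a \<notin> I"
  proof (rule ccontr)
    assume none: "\<not> ?thesis"
    obtain q where q: "q \<in> forms n (d - e)" "q * a \<notin> I" using pairing_nondegenerate a by blast
    have "Poly_Mapping.single \<mu> 1 * a \<in> I" if \<mu>: "\<mu> \<in> Poly_Mapping.keys q" for \<mu>
    proof (rule polarization[OF char order_refl order_refl forms_carrier[OF a(1)]])
      show "Poly_Mapping.keys \<mu> \<subseteq> {..<n}" using forms_carrier[OF q(1)] \<mu> by (simp add: mem_carrier_iff)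
      show "mon_degree \<mu> = d - e" using forms_degree[OF q(1) \<mu>] .
      fix k :: "nat \<Rightarrow> nat" assume k: "\<And>j. j < n \<Longrightarrow> k j \<le> d - e"
      have "?lin k = ?lin (restrict k {..<n})" by (intro sum.cong) auto
      then have "?lin k \<in> ?S" using k by (intro image_eqI[of _ _ "restrict k {..<n}"]) auto
      then show "?lin k ^ (d - e) * a \<in> I" using none by blast
    qed
    then have "cst (Poly_Mapping.lookup q \<mu>) * (Poly_Mapping.single \<mu> 1 * a) \<in> I" if "\<mu> \<in> Poly_Mapping.keys q" for \<mu>
      using that by blast
    then have "(\<Sum>\<mu>\<in>Poly_Mapping.keys q. cst (Poly_Mapping.lookup q \<mu>) * (Poly_Mapping.single \<mu> 1 * a)) \<in> I"
      by (rule I_sum)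
    also have "(\<Sum>\<mu>\<in>Poly_Mapping.keys q. cst (Poly_Mapping.lookup q \<mu>) * (Poly_Mapping.single \<mu> 1 * a)) = q * a"
      by (subst (3) poly_mapping_sum_monomials[of q])
        (simp add: sum_distrib_right mult_single mult.assoc[symmetric])
    finally show False using q(2) by blast
  qed
qed

text \<open>
  The points of the grid are the linear forms \<open>pt g\<close>, and \<open>z\<close> assigns to each of them a nonzero
  element of \<open>A\<^sub>e\<close> that it kills. A point has as colour a direction detecting this element, so a line with
  \<open>d + 2\<close> points of its own colour is exactly the input of \<open>pencil_independent\<close>.
\<close>

lemma (in gorenstein_quotient) hilbert_function_ge_of_no_injection:
  assumes char: "\<And>k::nat. k > 0 \<Longrightarrow> (of_nat k :: 'k) \<noteq> 0"
    and d: "e + m = d" and e: "e < m"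
    and no_inj: "\<And>l. l \<in> forms n 1 \<Longrightarrow> \<not> injective_at l e"
    and j: "e \<le> j" "j \<le> m"
  shows "d + 2 \<le> hilbert_function n I j"
proof -
  have "\<forall>l\<in>forms n 1. \<exists>a. a \<in> forms n e \<and> l * a \<in> I \<and> a \<notin> I"
    using no_inj by (auto simp: injective_at_def)
  from bchoice[OF this] obtain z where z: "\<And>l. l \<in> forms n 1 \<Longrightarrow> z l \<in> forms n e"
    "\<And>l. l \<in> forms n 1 \<Longrightarrow> l * z l \<in> I" "\<And>l. l \<in> forms n 1 \<Longrightarrow> z l \<notin> I" by blast
  obtain S where S: "finite S" "S \<subseteq> forms n 1"
    and "\<And>a. a \<in> forms n e \<Longrightarrow> a \<notin> I \<Longrightarrow> \<exists>x\<in>S. x ^ (d - e) * a \<notin> I"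
    using linear_forms_detecting[OF char, of e] by blast
  then have detect: "\<exists>x\<in>S. x ^ m * z l \<notin> I" if "l \<in> forms n 1" for l
    using z(1,3)[OF that] d by (metis add_diff_cancel_left')
  define pt where "pt = (\<lambda>g :: 'k mpoly \<Rightarrow> nat. \<Sum>x\<in>S. cst (of_nat (g x)) * x)"
  have pt: "pt g \<in> forms n 1" for g
    unfolding pt_def using S(2) by (intro forms_sum forms_cst_mult) blast
  define colour where "colour = (\<lambda>g. SOME x. x \<in> S \<and> x ^ m * z (pt g) \<notin> I)"
  have colour: "colour g \<in> S" "colour g ^ m * z (pt g) \<notin> I" for g
  proof -
    have "\<exists>x. x \<in> S \<and> x ^ m * z (pt g) \<notin> I" using detect[OF pt] by blast
    from someI_ex[OF this] show "colour g \<in> S" "colour g ^ m * z (pt g) \<notin> I"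
      by (auto simp: colour_def)
  qed
  obtain g x T where T: "x \<in> S" "finite T" "card T = e + m + 2" "\<forall>t\<in>T. colour (g(x := t)) = x"
    using monochromatic_axis_line[of S colour "e + m + 2", OF S(1) colour(1)]
    by (elim exE conjE) (rule that)
  obtain \<tau> where \<tau>: "bij_betw \<tau> {..<e + m + 2} T"
    using ex_bij_betw_nat_finite[OF T(2)] T(3) by (auto simp: lessThan_atLeast0)
  define l where "l = pt (g(x := 0))"
  \<comment> \<open>Moving along the axis \<open>x\<close> of the grid adds multiples of \<open>x\<close> to the linear form.\<close>
  have line: "pt (g(x := t)) = l + cst (of_nat t) * x" for t
  proof -
    have "pt (g(x := t)) = cst (of_nat t) * x + (\<Sum>y\<in>S - {x}. cst (of_nat (g y)) * y)" for t
      using S(1) T(1) by (simp add: pt_def sum.remove[of S x])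
    from this[of t] this[of 0] show ?thesis by (simp add: l_def)
  qed
  define a where "a = (\<lambda>k. z (pt (g(x := \<tau> k))))"
  have x: "x \<in> forms n 1" using S(2) T(1) by blast
  have l: "l \<in> forms n 1" unfolding l_def by (rule pt)
  let ?u = "j - e"
  let ?b = "\<lambda>k. if k < m - ?u + 1 then x ^ ?u * a k
      else l ^ (k - (m - ?u + 1)) * x ^ (e + ?u - (k - (m - ?u + 1)))"
  have "independent_mod ?b (e + m + 2)"
  proof (rule pencil_independent[where t = "\<lambda>k. of_nat (\<tau> k)", OF l x _ _ _ _ e])
    fix k assume "k < e + m + 2"
    then have "\<tau> k \<in> T" using \<tau> by (auto simp: bij_betw_def)
    then have "colour (g(x := \<tau> k)) = x" using T(4) by blast
    then show "x ^ m * a k \<notin> I" using colour(2)[of "g(x := \<tau> k)"] by (simp add: a_def)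
    show "a k \<in> forms n e" unfolding a_def by (intro z pt)
    show "(l + cst (of_nat (\<tau> k)) * x) * a k \<in> I"
      using z(2)[OF pt[of "g(x := \<tau> k)"]] by (simp add: a_def line)
  next
    have "inj_on (of_nat :: nat \<Rightarrow> 'k) UNIV"
    proof (rule linorder_inj_onI)
      fix x y :: nat assume "x < y"
      then have "(of_nat (y - x) :: 'k) \<noteq> 0" by (intro char) simp
      then show "(of_nat x :: 'k) \<noteq> of_nat y" using \<open>x < y\<close> by (simp add: of_nat_diff)
    qed auto
    then show "inj_on (\<lambda>k. of_nat (\<tau> k) :: 'k) {..<e + m + 2}"
      using \<tau> unfolding bij_betw_def inj_on_def by blast
  qed (use j in simp)
  moreover have "?b k \<in> forms n j" if k: "k < e + m + 2" for k
  proof (cases "k < m - ?u + 1")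
    case True
    have "a k \<in> forms n e" unfolding a_def by (intro z pt)
    then have "x ^ ?u * a k \<in> forms n j"
      by (rule forms_mult_eq[OF forms_power_1[OF x]]) (use j in simp)
    then show ?thesis using True by simp
  next
    case False
    have "l ^ (k - (m - ?u + 1)) * x ^ (e + ?u - (k - (m - ?u + 1))) \<in> forms n j"
      by (rule forms_mult_eq[OF forms_power_1[OF l] forms_power_1[OF x]]) (use j k False in auto)
    then show ?thesis using False by simp
  qed
  ultimately have "e + m + 2 \<le> hilbert_function n I j" by (intro hilbert_function_geI)
  then show ?thesis using d by simp
qed

text \<open>
  Failure gives \<open>d + 2 \<le> h\<^sub>j \<le> 6\<close> for \<open>e \<le> j \<le> m\<close>. This contradicts \<open>h\<^sub>0 = 1\<close> if \<open>e = 0\<close>, confines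
  \<open>h\<^sub>1 = h\<^sub>2\<close> to 5 and 6 if \<open>d = 3\<close>, and forces \<open>h\<^sub>1 = h\<^sub>2 = h\<^sub>3 = 6\<close> if \<open>d = 4\<close>.
\<close>

lemma (in gorenstein_quotient) weak_lefschetz_or_exceptional:
  assumes char: "\<And>k::nat. k > 0 \<Longrightarrow> (of_nat k :: 'k) \<noteq> 0"
    and sperner: "sperner_number (h_vector n I) \<le> 6"
  shows "weak_lefschetz n I \<or> h_vector n I \<in> {[1, 5, 5, 1], [1, 6, 6, 1], [1, 6, 6, 6, 1]}"
proof (rule disjCI)
  assume exc: "h_vector n I \<notin> {[1, 5, 5, 1], [1, 6, 6, 1], [1, 6, 6, 6, 1]}"
  let ?h = "hilbert_function n I"
  have h_le: "?h i \<le> 6" if "i \<le> d" for i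
  proof -
    have "?h i \<in> set (h_vector n I)" unfolding h_vector_def set_map set_upt using that by (intro imageI) simp
    then have "?h i \<le> Max (set (h_vector n I))" by (intro Max_ge) auto
    then show ?thesis using sperner by (simp add: sperner_number_def)
  qed
  show "weak_lefschetz n I"
  proof (cases "d = 0")
    case True
    \<comment> \<open>The algebra is \<open>K\<close>, and every map has target zero.\<close>
    have "surjective_at 0 i" for i
      unfolding surjective_at_def
    proof
      fix p :: "'k mpoly" assume "p \<in> forms n (Suc i)"
      then have "p - 0 * 0 \<in> I" using forms_subset_iff[of "Suc i"] True by auto
      then show "\<exists>a\<in>forms n i. p - 0 * a \<in> I" by blast
    qed
    then show ?thesis unfolding weak_lefschetz_iff by blast
  next
    case False
    define e where "e = (d - 1) div 2"
    define m where "m = d - e"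
    have em: "e + m = d" "e < m" "e \<le> d" "d \<le> 2 * e + 2" using False by (auto simp: e_def m_def)
    show ?thesis
    proof (rule ccontr)
      assume no_wlp: "\<not> weak_lefschetz n I"
      have ge: "d + 2 \<le> ?h j" if "e \<le> j" "j \<le> m" for j
        using hilbert_function_ge_of_no_injection[OF char em(1,2) _ that]
          weak_lefschetzI em(3,4) no_wlp by blast
      have "d + 2 \<le> 6" using ge[of e] h_le[of e] em by linarith
      then consider "d = 1" | "d = 2" | "d = 3" | "d = 4" using False by linarith
      then show False
      proof cases
        assume d: "d = 1"
        then have "e = 0" "m = 1" by (simp_all add: e_def m_def)
        then show False using ge[of 0] hilbert_function_0 d by simp
      next
        assume d: "d = 2"
        then have "e = 0" "m = 2" by (simp_all add: e_def m_def)
        then show False using ge[of 0] hilbert_function_0 d by simp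
      next
        assume d: "d = 3"
        then have "e = 1" "m = 2" by (simp_all add: e_def m_def)
        then have "?h 1 \<in> {5, 6}" using ge[of 1] h_le[of 1] d by auto
        moreover have "?h 2 = ?h 1" using hilbert_function_symmetric[of 1] d by simp
        moreover have "?h 3 = 1" using hilbert_function_top d by simp
        ultimately show False
          using exc hilbert_function_0 d by (auto simp: h_vector_def upt_rec numeral_2_eq_2 numeral_3_eq_3)
      next
        assume d: "d = 4"
        then have "e = 1" "m = 3" by (simp_all add: e_def m_def)
        then have "?h 1 = 6" "?h 2 = 6" "?h 3 = 6"
          using ge[of 1] ge[of 2] ge[of 3] h_le[of 1] h_le[of 2] h_le[of 3] d by auto
        moreover have "?h 4 = 1" using hilbert_function_top d by simp
        ultimately have "map ?h [0, 1, 2, 3, 4] = [1, 6, 6, 6, 1]"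
          using hilbert_function_0 by simp
        moreover have "[0..<Suc d] = [0, 1, 2, 3, 4]" using d by (simp add: upt_rec)
        ultimately show False using exc unfolding h_vector_def by (metis insertI1 insert_commute)
      qed
    qed
  qed
qed

section \<open>Gorenstein algebras from a dual form\<close>

text \<open>
  A function \<open>G\<close> on monomials stands for a functional on polynomials, or equivalently for a power
  series in dual variables; this is the constant term of the contraction of \<open>G\<close> by \<open>p\<close>.
\<close>

definition contract :: "((nat \<Rightarrow>\<^sub>0 nat) \<Rightarrow> 'k) \<Rightarrow> 'k::comm_ring_1 mpoly \<Rightarrow> 'k" where
  "contract G p = (\<Sum>m\<in>Poly_Mapping.keys p. G m * Poly_Mapping.lookup p m)"

lemma contract_superset:
  assumes "finite A" "Poly_Mapping.keys p \<subseteq> A"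
  shows "contract G p = (\<Sum>m\<in>A. G m * Poly_Mapping.lookup p m)"
  unfolding contract_def using assms by (intro sum.mono_neutral_left) (auto simp: in_keys_iff)

lemma contract_add: "contract G (p + q) = contract G p + contract G q"
proof -
  let ?A = "Poly_Mapping.keys p \<union> Poly_Mapping.keys q"
  have "contract G (p + q) = (\<Sum>m\<in>?A. G m * Poly_Mapping.lookup (p + q) m)"
    using keys_add[of p q] by (intro contract_superset) auto
  also have "\<dots> = contract G p + contract G q"
    by (simp add: contract_superset[of ?A] lookup_add distrib_left sum.distrib)
  finally show ?thesis .
qed

lemma contract_zero [simp]: "contract G 0 = 0"
  by (simp add: contract_def)

lemma contract_sum: "contract G (\<Sum>j\<in>J. f j) = (\<Sum>j\<in>J. contract G (f j))"
  by (induction J rule: infinite_finite_induct) (simp_all add: contract_add)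

lemma contract_single [simp]: "contract G (Poly_Mapping.single m c) = G m * c"
  by (simp add: contract_def)

lemma contract_cst_mult: "contract G (cst c * p) = c * contract G p"
proof -
  have "Poly_Mapping.keys (cst c * p) \<subseteq> Poly_Mapping.keys p" by (auto simp: in_keys_iff)
  then have "contract G (cst c * p) = (\<Sum>m\<in>Poly_Mapping.keys p. G m * Poly_Mapping.lookup (cst c * p) m)"
    by (intro contract_superset) auto
  then show ?thesis by (simp add: contract_def sum_distrib_left mult.left_commute)
qed

lemma contract_single_mult: "contract G (Poly_Mapping.single q 1 * p) = contract (\<lambda>m. G (q + m)) p"
proof -
  have "Poly_Mapping.single q 1 * p = (\<Sum>m\<in>Poly_Mapping.keys p. Poly_Mapping.single (q + m) (Poly_Mapping.lookup p m))"
    by (subst poly_mapping_sum_monomials[of p]) (simp add: sum_distrib_left mult_single)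
  then show ?thesis by (simp add: contract_sum) (simp add: contract_def)
qed

locale dual_form =
  fixes n d :: nat and F :: "(nat \<Rightarrow>\<^sub>0 nat) \<Rightarrow> 'k::field"
  assumes nonzero: "\<exists>m. Poly_Mapping.keys m \<subseteq> {..<n} \<and> mon_degree m = d \<and> F m \<noteq> 0"
begin

definition value_at :: "'k mpoly \<Rightarrow> 'k" where
  "value_at = contract (\<lambda>m. if mon_degree m = d then F m else 0)"

text \<open>
  The ideal of the polynomials that contract the degree \<open>d\<close> form with coefficients \<open>F\<close> to zero
  (Macaulay's inverse system).
\<close>

definition annihilator :: "'k mpoly set" where
  "annihilator = {p \<in> carrier (mpoly_ring n). \<forall>q\<in>carrier (mpoly_ring n). value_at (q * p) = 0}"

lemma value_at_add: "value_at (p + q) = value_at p + value_at q"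
  and value_at_zero [simp]: "value_at 0 = 0"
  and value_at_sum: "value_at (\<Sum>j\<in>J. f j) = (\<Sum>j\<in>J. value_at (f j))"
  and value_at_single: "value_at (Poly_Mapping.single m c) = (if mon_degree m = d then F m * c else 0)"
  and value_at_cst_mult: "value_at (cst c * p) = c * value_at p"
  by (simp_all add: value_at_def contract_add contract_sum contract_cst_mult)

lemma value_at_uminus: "value_at (- p) = - value_at p"
  using value_at_add[of p "- p"] by (simp add: eq_neg_iff_add_eq_0 add.commute)

lemma value_at_component: "value_at (component d p) = value_at p"
proof -
  have "Poly_Mapping.keys (component d p) \<subseteq> Poly_Mapping.keys p"
    by (auto simp: in_keys_iff lookup_component split: if_splits)
  then show ?thesis
    unfolding value_at_def contract_def[of _ p]
    by (subst contract_superset[of "Poly_Mapping.keys p"]) (auto simp: lookup_component intro!: sum.cong)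
qed

lemma value_at_form: "p \<in> forms n i \<Longrightarrow> i \<noteq> d \<Longrightarrow> value_at p = 0"
  unfolding value_at_def contract_def by (intro sum.neutral) (auto dest: forms_degree)

lemma mem_annihilatorI:
  assumes p: "p \<in> carrier (mpoly_ring n)"
    and mon: "\<And>m. Poly_Mapping.keys m \<subseteq> {..<n} \<Longrightarrow> value_at (Poly_Mapping.single m 1 * p) = 0"
  shows "p \<in> annihilator"
  unfolding annihilator_def
proof (intro CollectI conjI ballI p)
  fix q :: "'k mpoly" assume q: "q \<in> carrier (mpoly_ring n)"
  have "q * p = (\<Sum>m\<in>Poly_Mapping.keys q. Poly_Mapping.single m (Poly_Mapping.lookup q m) * p)"
    by (subst poly_mapping_sum_monomials[of q]) (simp add: sum_distrib_right)
  also have "\<dots> = (\<Sum>m\<in>Poly_Mapping.keys q. cst (Poly_Mapping.lookup q m) * (Poly_Mapping.single m 1 * p))"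
    by (simp add: mult_single mult.assoc[symmetric])
  finally show "value_at (q * p) = 0"
    using q mon by (simp add: value_at_sum value_at_cst_mult mem_carrier_iff)
qed

lemma annihilatorD: "p \<in> annihilator \<Longrightarrow> q \<in> carrier (mpoly_ring n) \<Longrightarrow> value_at (q * p) = 0"
  and annihilator_carrier: "p \<in> annihilator \<Longrightarrow> p \<in> carrier (mpoly_ring n)"
  by (simp_all add: annihilator_def)

text \<open>
  For a form of degree \<open>i\<close> only multiples of degree exactly \<open>d\<close> can have a nonzero value.
\<close>

lemma form_in_annihilatorI:
  assumes p: "p \<in> forms n i"
    and mon: "\<And>m. Poly_Mapping.keys m \<subseteq> {..<n} \<Longrightarrow> mon_degree m + i = d \<Longrightarrow>
      value_at (Poly_Mapping.single m 1 * p) = 0"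
  shows "p \<in> annihilator"
proof (rule mem_annihilatorI[OF forms_carrier[OF p]])
  fix m :: "nat \<Rightarrow>\<^sub>0 nat" assume m: "Poly_Mapping.keys m \<subseteq> {..<n}"
  show "value_at (Poly_Mapping.single m 1 * p) = 0"
  proof (cases "mon_degree m + i = d")
    case False
    have "Poly_Mapping.single m 1 * p \<in> forms n (mon_degree m + i)"
      using m p by auto
    then show ?thesis using False by (rule value_at_form)
  qed (use mon m in blast)
qed

lemma component_annihilator:
  assumes p: "p \<in> annihilator"
  shows "component i p \<in> annihilator"
proof (rule form_in_annihilatorI)
  show "component i p \<in> forms n i" using annihilator_carrier[OF p] by auto
  fix m :: "nat \<Rightarrow>\<^sub>0 nat" assume m: "Poly_Mapping.keys m \<subseteq> {..<n}" "mon_degree m + i = d"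
  have mf: "Poly_Mapping.single m 1 \<in> forms n (mon_degree m)" using m by auto
  have "component d (Poly_Mapping.single m 1 * p) = Poly_Mapping.single m 1 * component i p"
    using component_mult_form[OF mf annihilator_carrier[OF p], of d] m(2) by auto
  then show "value_at (Poly_Mapping.single m 1 * component i p) = 0"
    using value_at_component[of "Poly_Mapping.single m 1 * p"] annihilatorD[OF p forms_carrier[OF mf]] by simp
qed

lemma ideal_annihilator: "ideal annihilator (mpoly_ring n)"
proof (rule idealI)
  show "ring (mpoly_ring n :: 'k mpoly ring)" using mpoly_ring_cring by (rule cring.axioms)
  show "subgroup annihilator (add_monoid (mpoly_ring n))"
    by (rule add_subgroupI)
      (auto simp: annihilator_def value_at_add value_at_uminus algebra_simps)
next
  fix a x :: "'k mpoly" assume a: "a \<in> annihilator" and x: "x \<in> carrier (mpoly_ring n)"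
  have "value_at (q * (x * a)) = 0" if "q \<in> carrier (mpoly_ring n)" for q
    using annihilatorD[OF a carrier_mult[OF that x]] by (simp add: mult.assoc)
  then have "x * a \<in> annihilator" using a x by (auto simp: annihilator_def)
  then show "x \<otimes>\<^bsub>mpoly_ring n\<^esub> a \<in> annihilator" "a \<otimes>\<^bsub>mpoly_ring n\<^esub> x \<in> annihilator"
    by (simp_all add: mult.commute)
qed

lemma top_monomial:
  obtains m where "Poly_Mapping.keys m \<subseteq> {..<n}" "mon_degree m = d" "F m \<noteq> 0"
    "Poly_Mapping.single m 1 \<notin> annihilator"
proof -
  obtain m where m: "Poly_Mapping.keys m \<subseteq> {..<n}" "mon_degree m = d" "F m \<noteq> 0" using nonzero by blast
  have "value_at (1 * Poly_Mapping.single m 1) \<noteq> 0" using m by (simp add: value_at_single)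
  then have "Poly_Mapping.single m 1 \<notin> annihilator" using annihilatorD[of _ 1] by blast
  then show ?thesis using that m by blast
qed

lemma homogeneous_annihilator: "homogeneous_ideal n annihilator"
  unfolding homogeneous_ideal_def
proof (intro conjI exI)
  interpret J: ideal annihilator "mpoly_ring n" by (rule ideal_annihilator)
  let ?S = "annihilator \<inter> (\<Union>i. forms n i)"
  show "ideal annihilator (mpoly_ring n)" by (rule ideal_annihilator)
  show "?S \<subseteq> (\<Union>i. forms n i)" by blast
  have S: "?S \<subseteq> carrier (mpoly_ring n)" using annihilator_carrier by blast
  interpret G: ideal "Idl\<^bsub>mpoly_ring n\<^esub> ?S" "mpoly_ring n" by (rule J.genideal_ideal[OF S])
  show "annihilator = Idl\<^bsub>mpoly_ring n\<^esub> ?S"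
  proof
    show "Idl\<^bsub>mpoly_ring n\<^esub> ?S \<subseteq> annihilator"
      by (rule J.genideal_minimal[OF ideal_annihilator]) blast
    show "annihilator \<subseteq> Idl\<^bsub>mpoly_ring n\<^esub> ?S"
    proof
      fix p assume p: "p \<in> annihilator"
      have sum: "(\<Sum>i<N. component i p) \<in> Idl\<^bsub>mpoly_ring n\<^esub> ?S" for N :: nat
      proof (induction N)
        case 0
        then show ?case using additive_subgroup.zero_closed[OF G.additive_subgroup_axioms] by simp
      next
        case (Suc N)
        have "component N p \<in> ?S" using component_annihilator[OF p] annihilator_carrier[OF p] by blast
        then have "component N p \<in> Idl\<^bsub>mpoly_ring n\<^esub> ?S" using J.genideal_self[OF S] by blast
        from additive_subgroup.a_closed[OF G.additive_subgroup_axioms Suc this] show ?case by simp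
      qed
      obtain N where "p = (\<Sum>i<N. component i p)" using sum_component[of p] by blast
      then show "p \<in> Idl\<^bsub>mpoly_ring n\<^esub> ?S" using sum[of N] by simp
    qed
  qed
qed

sublocale homogeneous_quotient n annihilator
proof
  show "homogeneous_ideal n annihilator" by (rule homogeneous_annihilator)
  obtain m where "Poly_Mapping.keys m \<subseteq> {..<n}" "Poly_Mapping.single m 1 \<notin> annihilator"
    using top_monomial by blast
  then show "annihilator \<noteq> carrier (mpoly_ring n)" using forms_carrier[OF forms_monomial] by blast
qed

lemma high_degree_in_annihilator:
  assumes p: "p \<in> carrier (mpoly_ring n)" and deg: "\<And>m. m \<in> Poly_Mapping.keys p \<Longrightarrow> d < mon_degree m"
  shows "p \<in> annihilator"
proof (rule mem_annihilatorI[OF p])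
  fix m :: "nat \<Rightarrow>\<^sub>0 nat"
  have "mon_degree m' \<noteq> d" if m': "m' \<in> Poly_Mapping.keys (Poly_Mapping.single m 1 * p)" for m'
  proof -
    obtain a b where "m' = a + b" "b \<in> Poly_Mapping.keys p"
      using keys_mult[of "Poly_Mapping.single m 1" p] m' by blast
    then show ?thesis using deg[of b] by simp
  qed
  then show "value_at (Poly_Mapping.single m 1 * p) = 0"
    unfolding value_at_def contract_def by (intro sum.neutral) auto
qed

lemma finite_dimension_quotient: "Q.finite_dimension (scalars n annihilator) (carrier (quot_alg n annihilator))"
proof -
  let ?M = "{m. Poly_Mapping.keys m \<subseteq> {..<n} \<and> mon_degree m \<le> d}"
  have fin: "finite ?M" by (rule finite_monomials_bounded)
  obtain \<mu> where \<mu>: "bij_betw \<mu> {..<card ?M} ?M"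
    using ex_bij_betw_nat_finite[OF fin] by (auto simp: lessThan_atLeast0)
  let ?b = "\<lambda>j. Poly_Mapping.single (\<mu> j) 1 :: 'k mpoly"
  let ?Us = "map (\<lambda>j. coset (?b j)) [0..<card ?M]"
  have b: "?b j \<in> carrier (mpoly_ring n)" if "j < card ?M" for j
    using \<mu> that by (intro forms_carrier[OF forms_monomial]) (auto simp: bij_betw_def)
  have Us: "set ?Us \<subseteq> carrier (quot_alg n annihilator)" using b by (auto simp: quot_carrier)
  have "coset p \<in> Q.Span (scalars n annihilator) ?Us" if p: "p \<in> carrier (mpoly_ring n)" for p
  proof -
    let ?s = "\<Sum>j<card ?M. cst (Poly_Mapping.lookup p (\<mu> j)) * ?b j"
    have "?s = (\<Sum>m\<in>?M. Poly_Mapping.single m (Poly_Mapping.lookup p m))"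
      using sum.reindex_bij_betw[OF \<mu>, of "\<lambda>m. Poly_Mapping.single m (Poly_Mapping.lookup p m)"]
      by (simp add: mult_single)
    then have look: "Poly_Mapping.lookup ?s m = (if m \<in> ?M then Poly_Mapping.lookup p m else 0)" for m
      using fin by (simp add: lookup_sum lookup_single when_def)
    have sc: "?s \<in> carrier (mpoly_ring n)" by (rule sum_carrier[OF b])
    have "p - ?s \<in> annihilator"
    proof (rule high_degree_in_annihilator)
      show pc: "p - ?s \<in> carrier (mpoly_ring n)" using p sc by blast
      fix m :: "nat \<Rightarrow>\<^sub>0 nat" assume m: "m \<in> Poly_Mapping.keys (p - ?s)"
      then have "m \<notin> ?M" by (auto simp: in_keys_iff lookup_minus look)
      moreover have "Poly_Mapping.keys m \<subseteq> {..<n}" using pc m unfolding mem_carrier_iff by (rule bspec)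
      ultimately show "d < mon_degree m" by simp
    qed
    then have "\<exists>c. p - (\<Sum>j<card ?M. cst (c j) * ?b j) \<in> annihilator"
      by (rule exI[of _ "\<lambda>j. Poly_Mapping.lookup p (\<mu> j)"])
    moreover have "coset p \<in> Q.Span (scalars n annihilator) ?Us \<longleftrightarrow>
        (\<exists>c. p - (\<Sum>j<card ?M. cst (c j) * ?b j) \<in> annihilator)"
      by (rule mem_Span_iff[OF b p])
    ultimately show ?thesis by (rule iffD2[rotated])
  qed
  then have "carrier (quot_alg n annihilator) = Q.Span (scalars n annihilator) ?Us"
    using Q.Span_subgroup_props(1)[OF scalars_subfield Us] by (auto simp: quot_carrier)
  then show ?thesis using Q.Span_finite_dimension[OF scalars_subfield Us] by simp
qed

sublocale artinian_quotient n annihilator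
  by unfold_locales (rule finite_dimension_quotient)

lemma socle_degree_annihilator: "socle_degree n annihilator = d"
proof -
  obtain m where m: "Poly_Mapping.keys m \<subseteq> {..<n}" "mon_degree m = d" "Poly_Mapping.single m 1 \<notin> annihilator"
    using top_monomial by blast
  have "Poly_Mapping.single m 1 \<in> forms n d" using m by blast
  then have "\<not> forms n d \<subseteq> annihilator" using m(3) by blast
  moreover have "forms n (Suc d) \<subseteq> annihilator"
  proof
    fix p :: "'k mpoly" assume p: "p \<in> forms n (Suc d)"
    show "p \<in> annihilator"
      by (rule high_degree_in_annihilator[OF forms_carrier[OF p]]) (simp add: forms_degree[OF p])
  qed
  ultimately show ?thesis using forms_subset_iff by (metis less_Suc_eq_le not_less order_antisym)
qed

lemma annihilator_top_iff:
  assumes "p \<in> forms n d" shows "p \<in> annihilator \<longleftrightarrow> value_at p = 0"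
proof
  assume "p \<in> annihilator"
  from annihilatorD[OF this carrier_one] show "value_at p = 0" by simp
next
  assume "value_at p = 0"
  then show "p \<in> annihilator"
    by (intro form_in_annihilatorI[OF assms]) (simp add: mon_degree_eq_0_iff)
qed

lemma dimension_top: "Q.dimension 1 (scalars n annihilator) (graded_part n annihilator d)"
proof -
  obtain m where m: "Poly_Mapping.keys m \<subseteq> {..<n}" "mon_degree m = d" "F m \<noteq> 0"
    "Poly_Mapping.single m 1 \<notin> annihilator" using top_monomial by blast
  let ?b = "Poly_Mapping.single m 1 :: 'k mpoly"
  have b: "?b \<in> forms n d" using m by blast
  have "independent_mod (\<lambda>_. ?b) 1"
    using I_cst_mult_iff[OF forms_carrier[OF b]] m(4) by (simp add: independent_mod_def)
  moreover have "spanning_mod (forms n d) (\<lambda>_. ?b) 1"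
    unfolding spanning_mod_def
  proof
    fix p :: "'k mpoly" assume p: "p \<in> forms n d"
    let ?c = "value_at p / F m"
    have "p + - (cst ?c * ?b) \<in> annihilator"
      using p b m(2,3) annihilator_top_iff[of "p + - (cst ?c * ?b)"]
      by (simp only: value_at_add value_at_uminus value_at_cst_mult value_at_single) auto
    then show "\<exists>c. p - (\<Sum>j<(1::nat). cst (c j) * ?b) \<in> annihilator"
      by (intro exI[of _ "\<lambda>_. ?c"]) simp
  qed
  ultimately show ?thesis
    unfolding dimension_graded_part_iff using b by (intro exI[of _ "\<lambda>_. ?b"]) simp
qed

text \<open>
  An element \<open>p\<close> of the socle pairs to zero with everything of positive degree, and so does its
  component of degree \<open>d\<close>. Both pair equally with constants, so they agree in the quotient.
\<close>

lemma socle_annihilator: "socle n annihilator = graded_part n annihilator d"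
proof -
  show ?thesis
  proof
    show "graded_part n annihilator d \<subseteq> socle n annihilator"
    proof
      fix x assume "x \<in> graded_part n annihilator d"
      then obtain p where p: "x = coset p" "p \<in> forms n d" by (auto simp: graded_part_def)
      have "q * p \<in> annihilator" if "i \<ge> 1" "q \<in> forms n i" for q i
        using forms_mult[OF that(2) p(2)] forms_subset_iff[of "i + d"] that(1)
        by (auto simp: socle_degree_annihilator)
      then show "x \<in> socle n annihilator" using p by (simp add: mem_socle_iff forms_carrier)
    qed
    show "socle n annihilator \<subseteq> graded_part n annihilator d"
    proof
      fix x assume x: "x \<in> socle n annihilator"
      then have "x \<in> carrier (quot_alg n annihilator)" by (simp add: socle_def)
      then obtain p where p: "x = coset p" "p \<in> carrier (mpoly_ring n)" by (auto simp: quot_carrier)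
      have kill: "q * p \<in> annihilator" if "i \<ge> 1" "q \<in> forms n i" for q i
        using x mem_socle_iff[OF p(2)] that unfolding p(1) by blast
      \<comment> \<open>The component of degree \<open>d\<close> is the representative sought.\<close>
      have "p - component d p \<in> annihilator"
      proof (rule mem_annihilatorI)
        show "p - component d p \<in> carrier (mpoly_ring n)" using p(2) forms_carrier[OF component_forms] by blast
        fix m :: "nat \<Rightarrow>\<^sub>0 nat" assume m: "Poly_Mapping.keys m \<subseteq> {..<n}"
        let ?q = "Poly_Mapping.single m 1 :: 'k mpoly"
        have q: "?q \<in> forms n (mon_degree m)" using m by blast
        have split: "value_at (?q * (p - component d p)) = value_at (?q * p) - value_at (?q * component d p)"
          using value_at_add[of "?q * p" "- (?q * component d p)"]
          by (simp add: value_at_uminus right_diff_distrib)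
        show "value_at (?q * (p - component d p)) = 0"
        proof (cases "m = 0")
          case True
          then show ?thesis unfolding split by (simp add: value_at_component)
        next
          case False
          then have "mon_degree m \<ge> 1" using mon_degree_eq_0_iff[of m] by linarith
          then have "value_at (1 * (?q * p)) = 0" using kill[OF _ q] by (intro annihilatorD) auto
          moreover have "value_at (?q * component d p) = 0"
            using forms_mult[OF q component_forms[OF p(2)]] \<open>mon_degree m \<ge> 1\<close>
            by (intro value_at_form) auto
          ultimately show ?thesis unfolding split by simp
        qed
      qed
      then have "x = coset (component d p)"
        using p coset_eq_iff[OF p(2) forms_carrier[OF component_forms[OF p(2)]]] by blast
      then show "x \<in> graded_part n annihilator d"
        unfolding graded_part_def using component_forms[OF p(2)] by blast
    qed
  qed
qed

sublocale gorenstein_quotient n annihilator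
  using dimension_top by unfold_locales (simp_all add: socle_annihilator socle_degree_annihilator)

end

section \<open>Three algebras without the weak Lefschetz property\<close>

lemma weight_mono: "(\<And>j. w j \<le> w' j) \<Longrightarrow> weight w m \<le> weight w' m"
  unfolding weight_def by (intro sum_mono mult_left_mono) auto

lemma weight_scale: "weight (\<lambda>j. c * w j) m = c * weight w m"
  by (simp add: weight_def sum_distrib_left ac_simps)

text \<open>
  The variables are \<open>u\<close> (index 0), \<open>v\<close> (index 1), \<open>x\<^sub>0,\<dots>,x\<^sub>k\<close> (indices \<open>2,\<dots>,k + 2\<close>) and possibly \<open>z\<close>
  (index \<open>k + 3\<close>). Giving \<open>x\<^sub>i\<close> the balance \<open>i\<close> and \<open>v\<close> the balance \<open>- 1\<close> singles out the monomials
  \<open>x\<^sub>i u\<^sup>k\<^sup>-\<^sup>i v\<^sup>i\<close> among those of degree \<open>k + 1\<close>: they are linear in the \<open>x\<^sub>i\<close>, free of \<open>z\<close>, and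
  balanced. Contraction thus only depends on degrees, which keeps the computations short.
\<close>

definition xdeg :: "nat \<Rightarrow> (nat \<Rightarrow>\<^sub>0 nat) \<Rightarrow> int" where
  "xdeg k = weight (\<lambda>j. if 2 \<le> j \<and> j \<le> k + 2 then 1 else 0)"

definition balance :: "nat \<Rightarrow> (nat \<Rightarrow>\<^sub>0 nat) \<Rightarrow> int" where
  "balance k = weight (\<lambda>j. if j = 1 then - 1 else if 2 \<le> j \<and> j \<le> k + 2 then int j - 2 else 0)"

definition zdeg :: "nat \<Rightarrow> (nat \<Rightarrow>\<^sub>0 nat) \<Rightarrow> int" where
  "zdeg k = weight (\<lambda>j. if j = k + 3 then 1 else 0)"

lemmas grading_defs = xdeg_def balance_def zdeg_def

definition perazzo_form :: "nat \<Rightarrow> (nat \<Rightarrow>\<^sub>0 nat) \<Rightarrow> 'k::field" where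
  "perazzo_form k m = of_bool (xdeg k m = 1 \<and> balance k m = 0 \<and> zdeg k m = 0 \<or> zdeg k m = int (k + 1))"

lemma xdeg_nonneg: "0 \<le> xdeg k m"
  using weight_mono[of "\<lambda>_. 0" "\<lambda>j. if 2 \<le> j \<and> j \<le> k + 2 then 1 else 0" m]
  by (simp add: xdeg_def weight_def)

lemma zdeg_nonneg: "0 \<le> zdeg k m"
  using weight_mono[of "\<lambda>_. 0" "\<lambda>j. if j = k + 3 then 1 else 0" m]
  by (simp add: zdeg_def weight_def)

lemma zdeg_le: "zdeg k m \<le> int (mon_degree m)"
  unfolding int_mon_degree zdeg_def by (intro weight_mono) auto

lemma balance_ge: "- int (mon_degree m) \<le> balance k m"
  using weight_mono[of "\<lambda>_. - 1 * 1" "\<lambda>j. if j = 1 then - 1 else if 2 \<le> j \<and> j \<le> k + 2 then int j - 2 else 0" m]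
  unfolding weight_scale int_mon_degree balance_def by auto

lemma balance_le: "balance k m \<le> int k * xdeg k m"
  unfolding xdeg_def balance_def weight_scale[symmetric] by (intro weight_mono) auto

lemma linear_form_expand:
  fixes p :: "'k::comm_ring_1 mpoly"
  assumes p: "p \<in> forms n 1"
  shows "p = (\<Sum>j<n. cst (Poly_Mapping.lookup p (Poly_Mapping.single j 1)) * indet j)"
proof (rule poly_mapping_eqI)
  fix m
  have rhs: "Poly_Mapping.lookup (\<Sum>j<n. cst (Poly_Mapping.lookup p (Poly_Mapping.single j 1)) * indet j) m =
      (\<Sum>j<n. if Poly_Mapping.single j 1 = m then Poly_Mapping.lookup p m else 0)"
    unfolding lookup_sum by (intro sum.cong) (auto simp: lookup_single when_def mult_single)
  show "Poly_Mapping.lookup p m = Poly_Mapping.lookup (\<Sum>j<n. cst (Poly_Mapping.lookup p (Poly_Mapping.single j 1)) * indet j) m"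
  proof (cases "m \<in> Poly_Mapping.keys p")
    case True
    obtain j m' where j: "j \<in> Poly_Mapping.keys m" "m = Poly_Mapping.single j 1 + m'" "mon_degree m' = 0"
      using mon_degree_Suc_split[of m 0] forms_degree[OF p True] by auto
    then have m: "m = Poly_Mapping.single j 1" by (simp add: mon_degree_eq_0_iff)
    have "j < n" using forms_carrier[OF p] True j(1) by (auto simp: mem_carrier_iff)
    moreover have "Poly_Mapping.single i 1 = m \<longleftrightarrow> i = j" for i
      unfolding m by (metis lookup_single_eq lookup_single_not_eq one_neq_zero)
    ultimately show ?thesis unfolding rhs by simp
  next
    case False
    then have "Poly_Mapping.lookup p m = 0" by (simp add: in_keys_iff)
    then show ?thesis unfolding rhs by (simp only: if_cancel sum.neutral_const)
  qed
qed

locale perazzo =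
  fixes n k :: nat and ty :: "'k::field itself"
  assumes k: "1 \<le> k" and n: "k + 3 \<le> n" "n \<le> k + 4"
begin

abbreviation form :: "(nat \<Rightarrow>\<^sub>0 nat) \<Rightarrow> 'k" where "form \<equiv> perazzo_form k"

sublocale dual_form n "Suc k" form
proof
  let ?m = "Poly_Mapping.single 2 1 + Poly_Mapping.single 0 k :: nat \<Rightarrow>\<^sub>0 nat"
  have "Poly_Mapping.keys ?m \<subseteq> {..<n}"
    using keys_add[of "Poly_Mapping.single 2 1" "Poly_Mapping.single 0 k"] n by (auto split: if_splits)
  moreover have "form ?m = 1"
    by (simp add: perazzo_form_def grading_defs)
  ultimately show "\<exists>m. Poly_Mapping.keys m \<subseteq> {..<n} \<and> mon_degree m = Suc k \<and> form m \<noteq> 0"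
    by (intro exI[of _ ?m]) auto
qed

text \<open>
  The partner of the variable \<open>i\<close>: their product occurs in the dual form, whereas no other variable
  has this property.
\<close>

definition test_monomial :: "nat \<Rightarrow> (nat \<Rightarrow>\<^sub>0 nat)" where
  "test_monomial i =
    (if i = 0 then Poly_Mapping.single 2 1 + Poly_Mapping.single 0 (k - 1)
     else if i = 1 then Poly_Mapping.single 3 1 + Poly_Mapping.single 0 (k - 1)
     else if i \<le> k + 2 then Poly_Mapping.single 0 (k - (i - 2)) + Poly_Mapping.single 1 (i - 2)
     else Poly_Mapping.single i k)"

lemma test_monomial:
  assumes i: "i < n"
  shows "Poly_Mapping.keys (test_monomial i) \<subseteq> {..<n}" "mon_degree (test_monomial i) = k"
    and "j < n \<Longrightarrow> form (test_monomial i + Poly_Mapping.single j 1) = of_bool (j = i)"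
proof -
  show "Poly_Mapping.keys (test_monomial i) \<subseteq> {..<n}"
    using i n k by (auto simp: test_monomial_def dest!: subsetD[OF keys_add] split: if_splits)
  show "mon_degree (test_monomial i) = k"
    using k by (auto simp: test_monomial_def)
  show "form (test_monomial i + Poly_Mapping.single j 1) = of_bool (j = i)" if "j < n"
  proof -
    consider "i = 0" | "i = 1" | "2 \<le> i" "i \<le> k + 2" | "i = k + 3" using i n by linarith
    then show ?thesis
      by cases (use that k n in \<open>auto simp: perazzo_form_def grading_defs test_monomial_def\<close>)
  qed
qed

lemma independent_indets: "independent_mod indet n"
  unfolding independent_mod_def
proof (intro allI impI)
  fix c :: "nat \<Rightarrow> 'k" and i assume mem: "(\<Sum>j<n. cst (c j) * indet j) \<in> annihilator" and i: "i < n"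
  let ?t = "Poly_Mapping.single (test_monomial i) 1 :: 'k mpoly"
  have "?t \<in> carrier (mpoly_ring n)" using test_monomial[OF i] by (intro forms_carrier[OF forms_monomial]) auto
  from annihilatorD[OF mem this]
  have "0 = value_at (?t * (\<Sum>j<n. cst (c j) * indet j))" by (rule sym)
  also have "?t * (\<Sum>j<n. cst (c j) * indet j) =
      (\<Sum>j<n. cst (c j) * Poly_Mapping.single (test_monomial i + Poly_Mapping.single j 1) 1)"
    unfolding sum_distrib_left by (intro sum.cong refl) (simp add: mult_single)
  also have "value_at \<dots> = (\<Sum>j<n. c j * value_at (Poly_Mapping.single (test_monomial i + Poly_Mapping.single j 1) 1))"
    by (simp only: value_at_sum value_at_cst_mult)
  also have "\<dots> = (\<Sum>j<n. if j = i then c j else 0)"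
    using test_monomial[OF i] by (intro sum.cong) (auto simp: value_at_single)
  also have "\<dots> = c i" using i by simp
  finally show "c i = 0" by simp
qed

lemma hilbert_function_1: "hilbert_function n annihilator 1 = n"
proof (rule hilbert_function_eqI[OF _ independent_indets])
  show "indet j \<in> forms n 1" if "j < n" for j using that by (rule forms_indet)
  show "spanning_mod (forms n 1) indet n"
    unfolding spanning_mod_def
  proof
    fix p :: "'k mpoly" assume "p \<in> forms n 1"
    have "p - (\<Sum>j<n. cst (Poly_Mapping.lookup p (Poly_Mapping.single j 1)) * indet j) \<in> annihilator"
      unfolding linear_form_expand[OF \<open>p \<in> forms n 1\<close>, symmetric] by simp
    then show "\<exists>c. p - (\<Sum>j<n. cst (c j) * indet j) \<in> annihilator"
      by (rule exI[of _ "\<lambda>j. Poly_Mapping.lookup p (Poly_Mapping.single j 1)"])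
  qed
qed

text \<open>
  The solution is \<open>a i = \<beta>\<^sup>k\<^sup>-\<^sup>i (- \<alpha>)\<^sup>i\<close> up to scaling, unless \<open>\<alpha>\<close> and \<open>\<beta>\<close> both vanish and every
  sequence is a solution.
\<close>

lemma kernel_coefficients:
  fixes \<alpha> \<beta> :: 'k
  obtains a i where "\<And>i. i < k \<Longrightarrow> \<alpha> * a i + \<beta> * a (Suc i) = 0" "i \<le> k" "a i \<noteq> 0"
proof (cases "\<alpha> = 0 \<and> \<beta> = 0")
  case True
  then show ?thesis using that[of "\<lambda>_. 1" 0] by simp
next
  case False
  let ?a = "\<lambda>i. \<beta> ^ (k - i) * (- \<alpha>) ^ i"
  have "\<alpha> * ?a i + \<beta> * ?a (Suc i) = 0" if "i < k" for i
  proof -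
    have "\<beta> ^ (k - i) = \<beta> * \<beta> ^ (k - Suc i)" using that by (simp add: Suc_diff_Suc flip: power_Suc)
    then show ?thesis by simp
  qed
  moreover have "?a 0 \<noteq> 0 \<or> ?a k \<noteq> 0" using False by auto
  ultimately show ?thesis using that[of ?a 0] that[of ?a k] by blast
qed

text \<open>
  The element killed by \<open>l\<close> is a combination of the \<open>x\<^sub>i\<close>. Multiples of \<open>x\<^sub>i x\<^sub>j\<close> and of \<open>x\<^sub>i z\<close> have
  value zero, so only the coefficients \<open>w 0\<close> of \<open>u\<close> and \<open>w 1\<close> of \<open>v\<close> matter. Contracting with a
  monomial \<open>q\<close> of balance \<open>- s\<close> picks out the index \<open>i = s\<close> for \<open>u\<close> and \<open>i = s + 1\<close> for \<open>v\<close>.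
\<close>

lemma no_linear_form_injective: assumes l: "l \<in> forms n 1" shows "\<not> injective_at l 1"
proof -
  define w where "w = (\<lambda>j. Poly_Mapping.lookup l (Poly_Mapping.single j 1))"
  have l_eq: "l = (\<Sum>j<n. cst (w j) * indet j)" unfolding w_def by (rule linear_form_expand[OF l])
  obtain b i0 where b: "\<And>i. i < k \<Longrightarrow> w 0 * b i + w 1 * b (Suc i) = 0" and i0: "i0 \<le> k" "b i0 \<noteq> 0"
    using kernel_coefficients[of "w 0" "w 1"] by blast
  define c where "c = (\<lambda>j. if 2 \<le> j \<and> j \<le> k + 2 then b (j - 2) else 0)"
  define a where "a = (\<Sum>i<n. cst (c i) * indet i)"
  have a: "a \<in> forms n 1" unfolding a_def by (intro forms_sum forms_cst_mult forms_indet) simp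
  have "a \<notin> annihilator"
  proof
    assume "a \<in> annihilator"
    then have "\<forall>j<n. c j = 0" using independent_indets unfolding independent_mod_def a_def by blast
    then have "c (i0 + 2) = 0" using i0 n by auto
    then show False using i0 by (simp add: c_def)
  qed
  moreover have "l * a \<in> annihilator"
  proof (rule form_in_annihilatorI)
    show "l * a \<in> forms n 2" using forms_mult[OF l a] by (simp add: numeral_2_eq_2)
    fix q assume q: "Poly_Mapping.keys q \<subseteq> {..<n}" "mon_degree q + 2 = Suc k"
    let ?q = "Poly_Mapping.single q 1 :: 'k mpoly"
    let ?y = "\<lambda>j. Poly_Mapping.single j 1 :: nat \<Rightarrow>\<^sub>0 nat"
    have la: "l * a = (\<Sum>j<n. \<Sum>i<n. (cst (w j) * indet j) * (cst (c i) * indet i))"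
      unfolding a_def by (subst l_eq) (rule sum_product)
    \<comment> \<open>Expanding both linear forms turns the value into a double sum over pairs of variables.\<close>
    have "?q * (l * a) = (\<Sum>j<n. \<Sum>i<n. cst (w j) * (cst (c i) * Poly_Mapping.single (q + ?y j + ?y i) 1))"
      unfolding la sum_distrib_left
      by (intro sum.cong refl) (simp add: mult_single ac_simps)
    then have val: "value_at (?q * (l * a)) = (\<Sum>j<n. \<Sum>i<n. w j * (c i * form (q + ?y j + ?y i)))"
      using q(2) by (simp add: value_at_sum value_at_cst_mult value_at_single)
    have zq: "zdeg k q \<le> int k - 1" "0 \<le> zdeg k q" using zdeg_le[of k q] zdeg_nonneg q(2) by auto
    show "value_at (?q * (l * a)) = 0"
    proof (cases "xdeg k q = 0 \<and> zdeg k q = 0")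
      case False
      have "c i * form (q + ?y j + ?y i) = 0" if "i < n" "j < n" for i j
      proof (cases "2 \<le> i \<and> i \<le> k + 2")
        case True
        then have "xdeg k (q + ?y j + ?y i) \<ge> xdeg k q + 1" "zdeg k q \<le> zdeg k (q + ?y j + ?y i)"
          "zdeg k (q + ?y j + ?y i) \<le> zdeg k q + 1"
          by (auto simp: grading_defs)
        then have "form (q + ?y j + ?y i) = 0"
          using False zq xdeg_nonneg[of k q] by (auto simp: perazzo_form_def)
        then show ?thesis by simp
      qed (auto simp: c_def)
      then show ?thesis unfolding val by (intro sum.neutral ballI) simp
    next
      case True
      define s where "s = nat (- balance k q)"
      have "balance k q \<le> 0" "- balance k q \<le> int k - 1"
        using balance_le[of k q] balance_ge[of q k] True q(2) by auto
      then have s: "balance k q = - int s" "s < k" using k by (auto simp: s_def)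
      have "w j * (c i * form (q + ?y j + ?y i)) =
          (if j = 0 then if i = s + 2 then w 0 * b s else 0 else 0) +
          (if j = 1 then if i = s + 3 then w 1 * b (Suc s) else 0 else 0)" if in_range: "i < n" "j < n" for i j
      proof (cases "2 \<le> i \<and> i \<le> k + 2")
        case i: True
        have grade: "xdeg k (q + ?y j + ?y i) = (if 2 \<le> j \<and> j \<le> k + 2 then 2 else 1)"
          "balance k (q + ?y j + ?y i) = int i - 2 - int s + (if j = 1 then - 1 else if 2 \<le> j \<and> j \<le> k + 2 then int j - 2 else 0)"
          "zdeg k (q + ?y j + ?y i) = (if j = k + 3 then 1 else 0)"
          using i True s by (auto simp: grading_defs)
        consider "j = 0" | "j = 1" | "2 \<le> j" "j \<le> k + 2" | "j = k + 3" using in_range n by linarith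
        then show ?thesis
        proof cases
          assume j: "j = 0"
          have "form (q + ?y j + ?y i) = of_bool (i = s + 2)"
            using k unfolding perazzo_form_def grade by (auto simp: j)
          then show ?thesis using i j by (auto simp: c_def)
        next
          assume j: "j = 1"
          have "form (q + ?y j + ?y i) = of_bool (i = s + 3)"
            using k unfolding perazzo_form_def grade by (auto simp: j)
          then show ?thesis using i j by (auto simp: c_def)
        next
          assume j: "2 \<le> j" "j \<le> k + 2"
          have "form (q + ?y j + ?y i) = 0"
            using k j unfolding perazzo_form_def grade by auto
          then show ?thesis using j by auto
        next
          assume j: "j = k + 3"
          have "form (q + ?y j + ?y i) = 0"
            using k j unfolding perazzo_form_def grade by auto
          then show ?thesis using j by auto
        qed
      next
        case False
        then show ?thesis using s(2) by (auto simp: c_def)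
      qed
      then have "value_at (?q * (l * a)) = (\<Sum>j<n. \<Sum>i<n.
          (if j = 0 then if i = s + 2 then w 0 * b s else 0 else 0) +
          (if j = 1 then if i = s + 3 then w 1 * b (Suc s) else 0 else 0))"
        unfolding val by (intro sum.cong refl) simp
      also have "\<dots> = (\<Sum>j<n. (if j = 0 then w 0 * b s else 0) + (if j = 1 then w 1 * b (Suc s) else 0))"
        using s(2) n by (intro sum.cong refl) (auto simp: sum.distrib)
      also have "\<dots> = w 0 * b s + w 1 * b (Suc s)"
        using n by (simp add: sum.distrib)
      also have "\<dots> = 0" using b[OF s(2)] .
      finally show ?thesis .
    qed
  qed
  ultimately show ?thesis using a unfolding injective_at_def by blast
qed

lemma h_vector_perazzo: "h_vector n annihilator =
    map (hilbert_function n annihilator) [0..<Suc (Suc k)]"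
  by (simp add: h_vector_def socle_degree_annihilator del: upt_Suc)

lemma hilbert_function_ends:
  "hilbert_function n annihilator (Suc k) = 1" "hilbert_function n annihilator k = n"
  using hilbert_function_top hilbert_function_symmetric[of 1] hilbert_function_1
  by (simp_all add: socle_degree_annihilator)

text \<open>
  Surjectivity in degree 1 would dualize to injectivity in degree \<open>k - 1 \<ge> 1\<close> and descend to degree
  1, so one noninjective degree suffices.
\<close>

lemma not_weak_lefschetz:
  assumes "2 \<le> k"
  shows "\<not> weak_lefschetz n annihilator"
proof
  assume "weak_lefschetz n annihilator"
  then obtain l where l: "l \<in> forms n 1" "injective_at l 1 \<or> surjective_at l 1"
    unfolding weak_lefschetz_iff by blast
  then have "surjective_at l 1" using no_linear_form_injective by blast
  from injective_at_of_surjective[OF l(1) this] have "injective_at l (k - 1)"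
    using assms by (simp add: socle_degree_annihilator)
  from injective_at_mono[OF l(1) this, of 1] have "injective_at l 1"
    using assms by (simp add: socle_degree_annihilator)
  then show False using no_linear_form_injective l(1) by blast
qed

end

text \<open>
  The value of a quadratic form times a quadratic monomial is the sum of the coefficients in one class
  of monomials with given \<open>x\<close>-degree and balance. Only six classes can occur: for \<open>x\<close>-degree 0 the
  balances \<open>0, - 1, - 2\<close> of \<open>u\<^sup>2, u v, v\<^sup>2\<close>, and for \<open>x\<close>-degree 1 the balances \<open>0, 1, 2\<close> opposite to
  them.
\<close>

lemma (in perazzo) hilbert_function_2_le:
  assumes "k = 3" "n = 6"
  shows "hilbert_function n annihilator 2 \<le> 6"
proof -
  define P where "P = (\<lambda>(t::nat) m. if t < 3 then xdeg k m = 0 \<and> balance k m = - int t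
      else xdeg k m = 1 \<and> balance k m = int t - 3)"
  define f where "f = (\<lambda>t. contract (\<lambda>m. of_bool (P t m) :: 'k))"
  show ?thesis
  proof (rule hilbert_function_leI[of 6 _ f])
    fix t and N :: nat and b :: "nat \<Rightarrow> 'k mpoly" and c
    show "f t (\<Sum>j<N. cst (c j) * b j) = (\<Sum>j<N. c j * f t (b j))"
      by (simp add: f_def contract_sum contract_cst_mult)
  next
    fix p assume p: "p \<in> forms n 2" and zero: "\<And>t. t < 6 \<Longrightarrow> f t p = 0"
    show "p \<in> annihilator"
    proof (rule form_in_annihilatorI[OF p])
      fix q assume q: "Poly_Mapping.keys q \<subseteq> {..<n}" "mon_degree q + 2 = Suc k"
      have zdeg_0: "zdeg k m = 0" if "Poly_Mapping.keys m \<subseteq> {..<n}" for m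
        unfolding zdeg_def weight_def using that assms by (intro sum.neutral) auto
      have add: "xdeg k (q + m) = xdeg k q + xdeg k m" "balance k (q + m) = balance k q + balance k m"
        "zdeg k (q + m) = zdeg k q + zdeg k m" for m
        by (simp_all add: grading_defs)
      have val: "value_at (Poly_Mapping.single q 1 * p) =
          (\<Sum>m\<in>Poly_Mapping.keys p. of_bool (xdeg k m = 1 - xdeg k q \<and> balance k m = - balance k q) * Poly_Mapping.lookup p m)"
        unfolding value_at_def contract_single_mult unfolding contract_def
      proof (rule sum.cong[OF refl])
        fix m assume m: "m \<in> Poly_Mapping.keys p"
        have "zdeg k (q + m) = 0"
          using zdeg_0 q(1) forms_carrier[OF p] m by (simp add: add mem_carrier_iff)
        moreover have "mon_degree (q + m) = Suc k" using q(2) forms_degree[OF p m] by simp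
        ultimately show "(if mon_degree (q + m) = Suc k then form (q + m) else 0) * Poly_Mapping.lookup p m =
            of_bool (xdeg k m = 1 - xdeg k q \<and> balance k m = - balance k q) * Poly_Mapping.lookup p m"
          by (auto simp: perazzo_form_def add)
      qed
      have bounds: "- 2 \<le> balance k m" "balance k m \<le> 3 * xdeg k m" if "mon_degree m = 2" for m
        using balance_ge[of m k] balance_le[of k m] that assms by auto
      have q2: "mon_degree q = 2" using q(2) assms by simp
      have in_class: "value_at (Poly_Mapping.single q 1 * p) = 0"
        if "t < 6" "\<And>m. m \<in> Poly_Mapping.keys p \<Longrightarrow>
          xdeg k m = 1 - xdeg k q \<and> balance k m = - balance k q \<longleftrightarrow> P t m" for t
        using zero[OF that(1)] that(2) unfolding val f_def contract_def by (simp cong: sum.cong)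
      have no_class: "value_at (Poly_Mapping.single q 1 * p) = 0"
        if "\<And>m. m \<in> Poly_Mapping.keys p \<Longrightarrow>
          \<not> (xdeg k m = 1 - xdeg k q \<and> balance k m = - balance k q)"
        unfolding val using that by (intro sum.neutral) auto
      consider "xdeg k q = 0" | "xdeg k q = 1" "balance k q \<in> {0, 1, 2}"
        | "xdeg k q = 1" "balance k q \<notin> {0, 1, 2}" | "xdeg k q \<ge> 2"
        using xdeg_nonneg[of k q] by force
      then show "value_at (Poly_Mapping.single q 1 * p) = 0"
      proof cases
        case 1
        then show ?thesis
          using bounds[OF q2] by (intro in_class[of "nat (3 - balance k q)"]) (auto simp: P_def)
      next
        case 2
        then show ?thesis by (intro in_class[of "nat (balance k q)"]) (auto simp: P_def)
      next
        case 3
        then show ?thesis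
          using bounds[OF forms_degree[OF p]] by (intro no_class) force
      next
        case 4
        then have "1 - xdeg k q < xdeg k m" for m using xdeg_nonneg[of k m] by linarith
        then show ?thesis by (intro no_class) (metis less_irrefl)
      qed
    qed
  qed
qed

lemma failing_cubic:
  assumes "n \<in> {5, 6}"
  shows "\<exists>I :: 'k::field mpoly set. artinian_gorenstein n I \<and> h_vector n I = [1, n, n, 1] \<and> \<not> weak_lefschetz n I"
proof -
  interpret perazzo n 2 "TYPE('k)" using assms by unfold_locales auto
  have "map (hilbert_function n annihilator) [0, 1, 2, 3] = [1, n, n, 1]"
    using hilbert_function_0 hilbert_function_1 hilbert_function_ends by simp
  moreover have "[0..<Suc (Suc 2)] = [0, 1, 2, 3]" by (simp add: upt_rec)
  ultimately have "h_vector n annihilator = [1, n, n, 1]" by (simp only: h_vector_perazzo)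
  then show ?thesis
    using not_weak_lefschetz artinian_gorenstein_iff gorenstein_quotient_axioms by blast
qed

text \<open>
  The bound \<open>h\<^sub>2 \<ge> 6\<close> needs no computation: it follows from the failure of injectivity.
\<close>

lemma failing_quartic:
  "\<exists>I :: 'k::field_char_0 mpoly set. artinian_gorenstein 6 I \<and> h_vector 6 I = [1, 6, 6, 6, 1] \<and> \<not> weak_lefschetz 6 I"
proof -
  interpret perazzo 6 3 "TYPE('k)" by unfold_locales auto
  have degree: "socle_degree 6 annihilator = 4" using socle_degree_annihilator by simp
  have "socle_degree 6 annihilator + 2 \<le> hilbert_function 6 annihilator 2"
    by (rule hilbert_function_ge_of_no_injection[of 1 3]) (use no_linear_form_injective degree in simp_all)
  then have "6 \<le> hilbert_function 6 annihilator 2" using degree by simp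
  then have "hilbert_function 6 annihilator 2 = 6" using hilbert_function_2_le by simp
  then have "map (hilbert_function 6 annihilator) [0, 1, 2, 3, 4] = [1, 6, 6, 6, 1]"
    using hilbert_function_0 hilbert_function_1 hilbert_function_ends by simp
  moreover have "[0..<Suc (Suc 3)] = [0, 1, 2, 3, 4]" by (simp add: upt_rec)
  ultimately have "h_vector 6 annihilator = [1, 6, 6, 6, 1]" by (simp only: h_vector_perazzo)
  then show ?thesis
    using not_weak_lefschetz artinian_gorenstein_iff gorenstein_quotient_axioms by fastforce
qed

section \<open>Sperner number at most six\<close>

theorem corollary4p3:
  fixes h :: "nat list"
  assumes "gorenstein_h_vector TYPE('k::{alg_closed_field, field_char_0}) h"
    and "sperner_number h \<le> 6"
  shows "(\<forall>n (I :: 'k mpoly set). artinian_gorenstein n I \<and> h_vector n I = h \<longrightarrow> weak_lefschetz n I)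
    \<longleftrightarrow> h \<notin> {[1, 5, 5, 1], [1, 6, 6, 1], [1, 6, 6, 6, 1]}"
proof
  assume wlp: "\<forall>n (I :: 'k mpoly set). artinian_gorenstein n I \<and> h_vector n I = h \<longrightarrow> weak_lefschetz n I"
  show "h \<notin> {[1, 5, 5, 1], [1, 6, 6, 1], [1, 6, 6, 6, 1]}"
    using wlp failing_cubic[of 5, where 'k = 'k] failing_cubic[of 6, where 'k = 'k]
      failing_quartic[where 'k = 'k] by blast
next
  assume h: "h \<notin> {[1, 5, 5, 1], [1, 6, 6, 1], [1, 6, 6, 6, 1]}"
  show "\<forall>n (I :: 'k mpoly set). artinian_gorenstein n I \<and> h_vector n I = h \<longrightarrow> weak_lefschetz n I"
  proof (intro allI impI, elim conjE)
    fix n and I :: "'k mpoly set" assume "artinian_gorenstein n I" "h_vector n I = h"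
    interpret gorenstein_quotient n I using \<open>artinian_gorenstein n I\<close> by (simp add: artinian_gorenstein_iff)
    have "(of_nat k :: 'k) \<noteq> 0" if "k > 0" for k :: nat using that by simp
    then show "weak_lefschetz n I"
      using weak_lefschetz_or_exceptional assms(2) h \<open>h_vector n I = h\<close> by blast
  qed
qed

end
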